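(* Let $\Sigma$ be a finite alphabet, $w$ a positive integer, $\tau=(R_1,\dots,R_m)$ a relational vocabulary, and $\varphi(x_1,\dots,x_n)$ a first-order formula over $\tau$ with free variables among $x_1,\dots,x_n$. There is a computable function $f$ such that, given a $(\Sigma,w,\tau)$-structural tuple $\mathcal{D}=(D_0,D_1,\dots,D_m)$ of length $k$, one can count in time $f(\Sigma,w,\tau,\varphi,n)\cdot k^2$ the number of tuples $(v_1,\dots,v_n)$ of elements of the domain of $\mathcal{S}(\mathcal{D})$ such that $\mathcal{S}(\mathcal{D})\models\varphi[v_1,\dots,v_n]$.
   Context: Padding and tensor products. Fix a padding symbol $\#$ not in any alphabet considered. For alphabets $\Gamma_1,\dots,\Gamma_a$, $\Gamma_1\otimes\cdots\otimes\Gamma_a$ is the Cartesian product regarded as an alphabet, and $\Gamma^{\otimes a}$ its $a$-fold power. For nonempty strings $u_i$ over $\Gamma_i$ of lengths $n_i$, $u_1\otimes\cdots\otimes u_a$ is the string of length $\max_i n_i$ whose $j$-th symbol is the tuple of $j$-th symbols of the $u_i$, with $\#$ in place of missing symbols. For languages, $L^{\otimes a}=\{u_1\otimes\cdots\otimes u_a:u_i\in L\}$. For a language $L$ over a tensor alphabet, $\mathcal{R}(L)=\{(u_1,\dots,u_a):u_1\otimes\cdots\otimes u_a\in L\}$. ODDs. For an alphabet $\Sigma$ and $w\ge1$, a $(\Sigma,w)$-layer is a tuple $B=(\ell,r,T,I,F,\iota,\phi)$ with $\ell,r\subseteq\{0,\dots,w-1\}$, $T\subseteq\ell\times(\Sigma\sqcup\{\#\})\times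 r$, $I\subseteq\ell$, $F\subseteq r$, $\iota,\phi$ Booleans, $I=\emptyset$ if $\iota$ is false and $F=\emptyset$ if $\phi$ is false. $\mathcal{B}(\Sigma,w)$ is the finite set of such layers. A $(\Sigma,w)$-ODD of length $k$ is a string $B_1\cdots B_k$ of layers with $\ell(B_{i+1})=r(B_i)$, $\iota(B_i)$ true iff $i=1$, $\phi(B_i)$ true iff $i=k$; $\mathcal{B}(\Sigma,w,k)$ is the set of them. A nonempty string $\sigma_1\cdots\sigma_{k'}$ over $\Sigma$, $k'\le k$, is accepted if, padding it with $\#$ to length $k$ (symbols $\hat\sigma_i$), there are $(p_i,\hat\sigma_i,q_i)\in T(B_i)$ with $p_{i+1}=q_i$, $p_1\in I(B_1)$, $q_k\in F(B_k)$; $L(D)$ is the set of accepted strings. Structural tuples. $\tau=(R_1,\dots,R_m)$ has arities $a_i$. A tuple $(D_0,\dots,D_m)$ is $(\Sigma,w,\tau)$-structural, of length $k$, if $D_0\in\mathcal{B}(\Sigma,w,k)$, $D_i\in\mathcal{B}(\Sigma^{\otimes a_i},w,k)$ and $L(D_i)\subseteq L(D_0)^{\otimes a_i}$ for $i\in[m]$; its derived structure $\mathcal{S}(D_0,\dots,D_m)$ is the $\tau$-structure with domain $L(D_0)$ interpreting $R_i$ as $\mathcal{R}(L(D_i))$. *)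

theory Defs
  imports Main "HOL-Library.Product_Lexorder" "HOL-Library.Option_ord" "HOL-Library.List_Lexorder"
begin

section \<open>Padding and tensor products\<close>

text \<open>
  The padding symbol \<open>#\<close> is \<^term>\<open>None\<close>. A tuple symbol is a list of length \<open>a\<close>. Since
  convolutions of strings of different lengths contain \<open>#\<close> inside tuples, the tensor alphabet
  is the product of the alphabets extended by \<open>#\<close>.
\<close>

definition tensor_alphabet :: "'a set \<Rightarrow> nat \<Rightarrow> 'a option list set" where
  "tensor_alphabet \<Sigma> a = {xs. length xs = a \<and> set xs \<subseteq> insert None (Some ` \<Sigma>)}"

definition padded_nth :: "'a list \<Rightarrow> nat \<Rightarrow> 'a option" where
  "padded_nth u j = (if j < length u then Some (u ! j) else None)"

definition tensor :: "'a list list \<Rightarrow> 'a option list list" where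
  "tensor us = map (\<lambda>j. map (\<lambda>u. padded_nth u j) us) [0..<Max (length ` set us)]"

definition tensor_power :: "nat \<Rightarrow> 'a list set \<Rightarrow> 'a option list list set" where
  "tensor_power a L = {tensor us | us. length us = a \<and> set us \<subseteq> L}"

definition relation_of :: "nat \<Rightarrow> 'a option list list set \<Rightarrow> 'a list list set" where
  "relation_of a L = {us. length us = a \<and> [] \<notin> set us \<and> tensor us \<in> L}"

section \<open>Ordered decision diagrams\<close>

record 's layer =
  lstates :: "nat set"
  rstates :: "nat set"
  transitions :: "(nat \<times> 's option \<times> nat) set"
  istates :: "nat set"
  fstates :: "nat set"
  iflag :: bool
  fflag :: bool

definition layers :: "'s set \<Rightarrow> nat \<Rightarrow> 's layer set" where
  "layers \<Sigma> w = {B.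
     lstates B \<subseteq> {..<w} \<and> rstates B \<subseteq> {..<w} \<and>
     transitions B \<subseteq> lstates B \<times> insert None (Some ` \<Sigma>) \<times> rstates B \<and>
     istates B \<subseteq> lstates B \<and> fstates B \<subseteq> rstates B \<and>
     (\<not> iflag B \<longrightarrow> istates B = {}) \<and> (\<not> fflag B \<longrightarrow> fstates B = {})}"

definition odds :: "'s set \<Rightarrow> nat \<Rightarrow> nat \<Rightarrow> 's layer list set" where
  "odds \<Sigma> w k = {D. 1 \<le> k \<and> length D = k \<and> set D \<subseteq> layers \<Sigma> w \<and>
     (\<forall>i. Suc i < k \<longrightarrow> lstates (D ! Suc i) = rstates (D ! i)) \<and>
     (\<forall>i<k. iflag (D ! i) \<longleftrightarrow> i = 0) \<and>
     (\<forall>i<k. fflag (D ! i) \<longleftrightarrow> Suc i = k)}"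

definition odd_accepts :: "'s layer list \<Rightarrow> 's list \<Rightarrow> bool" where
  "odd_accepts D s \<longleftrightarrow> s \<noteq> [] \<and> length s \<le> length D \<and>
     (\<exists>p q. (\<forall>i<length D. (p i, padded_nth s i, q i) \<in> transitions (D ! i)) \<and>
            (\<forall>i. Suc i < length D \<longrightarrow> p (Suc i) = q i) \<and>
            p 0 \<in> istates (D ! 0) \<and>
            q (length D - 1) \<in> fstates (D ! (length D - 1)))"

definition odd_lang :: "'s set \<Rightarrow> 's layer list \<Rightarrow> 's list set" where
  "odd_lang \<Sigma> D = {s \<in> lists \<Sigma>. odd_accepts D s}"

section \<open>First-order logic over relational vocabularies\<close>

text \<open>
  A vocabulary \<open>(R\<^sub>1, \<dots>, R\<^sub>m)\<close> is the list of its (positive) arities; \<open>Rel i\<close> refers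
  to \<open>R\<^sub>i\<^sub>+\<^sub>1\<close> and \<open>x\<^sub>i\<^sub>+\<^sub>1\<close> is the variable \<open>i\<close>.
\<close>

datatype fm =
    Eq nat nat
  | Rel nat "nat list"
  | Neg fm
  | And fm fm
  | Or fm fm
  | Exists nat fm
  | Forall nat fm

fun wf_fm :: "nat list \<Rightarrow> fm \<Rightarrow> bool" where
  "wf_fm \<tau> (Eq x y) \<longleftrightarrow> True"
| "wf_fm \<tau> (Rel i xs) \<longleftrightarrow> i < length \<tau> \<and> length xs = \<tau> ! i"
| "wf_fm \<tau> (Neg \<phi>) \<longleftrightarrow> wf_fm \<tau> \<phi>"
| "wf_fm \<tau> (And \<phi> \<psi>) \<longleftrightarrow> wf_fm \<tau> \<phi> \<and> wf_fm \<tau> \<psi>"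
| "wf_fm \<tau> (Or \<phi> \<psi>) \<longleftrightarrow> wf_fm \<tau> \<phi> \<and> wf_fm \<tau> \<psi>"
| "wf_fm \<tau> (Exists x \<phi>) \<longleftrightarrow> wf_fm \<tau> \<phi>"
| "wf_fm \<tau> (Forall x \<phi>) \<longleftrightarrow> wf_fm \<tau> \<phi>"

fun free_vars :: "fm \<Rightarrow> nat set" where
  "free_vars (Eq x y) = {x, y}"
| "free_vars (Rel i xs) = set xs"
| "free_vars (Neg \<phi>) = free_vars \<phi>"
| "free_vars (And \<phi> \<psi>) = free_vars \<phi> \<union> free_vars \<psi>"
| "free_vars (Or \<phi> \<psi>) = free_vars \<phi> \<union> free_vars \<psi>"
| "free_vars (Exists x \<phi>) = free_vars \<phi> - {x}"
| "free_vars (Forall x \<phi>) = free_vars \<phi> - {x}"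

record 'e rel_structure =
  domain :: "'e set"
  interp :: "nat \<Rightarrow> 'e list set"

fun sat :: "'e rel_structure \<Rightarrow> (nat \<Rightarrow> 'e) \<Rightarrow> fm \<Rightarrow> bool" where
  "sat S e (Eq x y) \<longleftrightarrow> e x = e y"
| "sat S e (Rel i xs) \<longleftrightarrow> map e xs \<in> interp S i"
| "sat S e (Neg \<phi>) \<longleftrightarrow> \<not> sat S e \<phi>"
| "sat S e (And \<phi> \<psi>) \<longleftrightarrow> sat S e \<phi> \<and> sat S e \<psi>"
| "sat S e (Or \<phi> \<psi>) \<longleftrightarrow> sat S e \<phi> \<or> sat S e \<psi>"
| "sat S e (Exists x \<phi>) \<longleftrightarrow> (\<exists>v\<in>domain S. sat S (e(x := v)) \<phi>)"
| "sat S e (Forall x \<phi>) \<longleftrightarrow> (\<forall>v\<in>domain S. sat S (e(x := v)) \<phi>)"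

definition solutions :: "'e rel_structure \<Rightarrow> fm \<Rightarrow> nat \<Rightarrow> 'e list set" where
  "solutions S \<phi> n = {vs. length vs = n \<and> set vs \<subseteq> domain S \<and> sat S (\<lambda>i. vs ! i) \<phi>}"

section \<open>Structural tuples\<close>

text \<open>\<open>(D\<^sub>0, D\<^sub>1, \<dots>, D\<^sub>m)\<close> is represented by \<open>D0\<close> and the list \<open>Ds = [D\<^sub>1, \<dots>, D\<^sub>m]\<close>.\<close>

definition structural ::
  "'a set \<Rightarrow> nat \<Rightarrow> nat list \<Rightarrow> nat \<Rightarrow> 'a layer list \<Rightarrow> 'a option list layer list list \<Rightarrow> bool" where
  "structural \<Sigma> w \<tau> k D0 Ds \<longleftrightarrow>
     D0 \<in> odds \<Sigma> w k \<and> length Ds = length \<tau> \<and>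
     (\<forall>i<length \<tau>. Ds ! i \<in> odds (tensor_alphabet \<Sigma> (\<tau> ! i)) w k \<and>
        odd_lang (tensor_alphabet \<Sigma> (\<tau> ! i)) (Ds ! i) \<subseteq> tensor_power (\<tau> ! i) (odd_lang \<Sigma> D0))"

definition derived_structure ::
  "'a set \<Rightarrow> nat list \<Rightarrow> 'a layer list \<Rightarrow> 'a option list layer list list \<Rightarrow> 'a list rel_structure" where
  "derived_structure \<Sigma> \<tau> D0 Ds =
     \<lparr>domain = odd_lang \<Sigma> D0,
      interp = (\<lambda>i. relation_of (\<tau> ! i) (odd_lang (tensor_alphabet \<Sigma> (\<tau> ! i)) (Ds ! i)))\<rparr>"

section \<open>Computation model\<close>

text \<open>
  Algorithms are programs of pure first-order Lisp over binary trees of cons cells. A program is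
  the list of the bodies of its functions, a body refers to the arguments of its function by
  position, and the function \<open>0\<close> is the main function. Every evaluation step (variable access,
  constant, cons, head, tail, test for \<open>Leaf\<close>, call) takes one unit of time and constant time on
  a pointer machine or on a random access machine with words of logarithmic length. There is no
  arithmetic: numbers are lists of bits, so that time is bit complexity.
\<close>

datatype tree = Leaf | Node tree tree

fun left :: "tree \<Rightarrow> tree" where
  "left Leaf = Leaf"
| "left (Node a b) = a"

fun right :: "tree \<Rightarrow> tree" where
  "right Leaf = Leaf"
| "right (Node a b) = b"

datatype expr =
    Arg nat
  | Nil_e
  | Cons_e expr expr
  | Head_e expr
  | Tail_e expr
  | If_e expr expr expr
  | Call nat "expr list"

type_synonym program = "expr list"

text \<open>\<open>eval P env e v t\<close>: under arguments \<open>env\<close>, \<open>e\<close> evaluates to \<open>v\<close> in exactly \<open>t\<close> steps.\<close>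

inductive eval :: "program \<Rightarrow> tree list \<Rightarrow> expr \<Rightarrow> tree \<Rightarrow> nat \<Rightarrow> bool"
  and evals :: "program \<Rightarrow> tree list \<Rightarrow> expr list \<Rightarrow> tree list \<Rightarrow> nat \<Rightarrow> bool"
  for P :: program where
  eval_Arg: "i < length env \<Longrightarrow> eval P env (Arg i) (env ! i) 1"
| eval_Nil: "eval P env Nil_e Leaf 1"
| eval_Cons: "eval P env a u s \<Longrightarrow> eval P env b v t \<Longrightarrow>
    eval P env (Cons_e a b) (Node u v) (s + t + 1)"
| eval_Head: "eval P env a v t \<Longrightarrow> eval P env (Head_e a) (left v) (t + 1)"
| eval_Tail: "eval P env a v t \<Longrightarrow> eval P env (Tail_e a) (right v) (t + 1)"
| eval_IfT: "eval P env c u s \<Longrightarrow> u \<noteq> Leaf \<Longrightarrow> eval P env a v t \<Longrightarrow>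
    eval P env (If_e c a b) v (s + t + 1)"
| eval_IfF: "eval P env c Leaf s \<Longrightarrow> eval P env b v t \<Longrightarrow>
    eval P env (If_e c a b) v (s + t + 1)"
| eval_Call: "evals P env as vs s \<Longrightarrow> f < length P \<Longrightarrow> eval P vs (P ! f) v t \<Longrightarrow>
    eval P env (Call f as) v (s + t + 1)"
| evals_Nil: "evals P env [] [] 0"
| evals_Cons: "eval P env a v s \<Longrightarrow> evals P env as vs t \<Longrightarrow>
    evals P env (a # as) (v # vs) (s + t)"

text \<open>The model is deterministic, so a program has at most one result and one running time.\<close>

inductive_cases eval_ArgE: "eval P env (Arg i) v t"
inductive_cases eval_NilE: "eval P env Nil_e v t"
inductive_cases eval_ConsE: "eval P env (Cons_e a b) v t"
inductive_cases eval_HeadE: "eval P env (Head_e a) v t"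
inductive_cases eval_TailE: "eval P env (Tail_e a) v t"
inductive_cases eval_IfE: "eval P env (If_e c a b) v t"
inductive_cases eval_CallE: "eval P env (Call f as) v t"
inductive_cases evals_NilE: "evals P env [] vs t"
inductive_cases evals_ConsE: "evals P env (a # as) vs t"

definition det :: "program \<Rightarrow> tree list \<Rightarrow> expr \<Rightarrow> tree \<Rightarrow> nat \<Rightarrow> bool" where
  "det P env e v t \<longleftrightarrow> (\<forall>v' t'. eval P env e v' t' \<longrightarrow> v' = v \<and> t' = t)"

definition dets :: "program \<Rightarrow> tree list \<Rightarrow> expr list \<Rightarrow> tree list \<Rightarrow> nat \<Rightarrow> bool" where
  "dets P env es vs t \<longleftrightarrow> (\<forall>vs' t'. evals P env es vs' t' \<longrightarrow> vs' = vs \<and> t' = t)"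

lemma detI: "(\<And>v' t'. eval P env e v' t' \<Longrightarrow> v' = v \<and> t' = t) \<Longrightarrow> det P env e v t"
  by (simp add: det_def)

lemma detsI: "(\<And>vs' t'. evals P env es vs' t' \<Longrightarrow> vs' = vs \<and> t' = t) \<Longrightarrow> dets P env es vs t"
  by (simp add: dets_def)

lemma detD: "eval P env e v' t' \<Longrightarrow> det P env e v t \<Longrightarrow> v' = v \<and> t' = t"
  unfolding det_def by (elim allE impE)

lemma detsD: "evals P env es vs' t' \<Longrightarrow> dets P env es vs t \<Longrightarrow> vs' = vs \<and> t' = t"
  unfolding dets_def by (elim allE impE)

lemma eval_det:
  "eval P env e v t \<Longrightarrow> det P env e v t"
  "evals P env es vs t \<Longrightarrow> dets P env es vs t"
proof (induction rule: eval_evals.inducts)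
  case eval_Arg
  show ?case by (rule detI, erule eval_ArgE) simp
next
  case eval_Nil
  show ?case by (rule detI, erule eval_NilE) simp
next
  case eval_Cons
  show ?case by (rule detI, erule eval_ConsE) (use eval_Cons.IH in \<open>auto dest: detD\<close>)
next
  case eval_Head
  show ?case by (rule detI, erule eval_HeadE) (use eval_Head.IH in \<open>auto dest: detD\<close>)
next
  case eval_Tail
  show ?case by (rule detI, erule eval_TailE) (use eval_Tail.IH in \<open>auto dest: detD\<close>)
next
  case eval_IfT
  show ?case by (rule detI, erule eval_IfE) (use eval_IfT.IH eval_IfT.hyps in \<open>auto dest: detD\<close>)
next
  case eval_IfF
  show ?case by (rule detI, erule eval_IfE) (use eval_IfF.IH in \<open>auto dest: detD\<close>)
next
  case eval_Call
  show ?case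
    by (rule detI, erule eval_CallE) (use eval_Call.IH in \<open>auto dest: detD detsD\<close>)
next
  case evals_Nil
  show ?case by (rule detsI, erule evals_NilE) simp
next
  case evals_Cons
  show ?case
    by (rule detsI, erule evals_ConsE) (use evals_Cons.IH in \<open>auto dest: detD detsD\<close>)
qed

lemma eval_deterministic:
  "eval P env e v t \<Longrightarrow> eval P env e v' t' \<Longrightarrow> v' = v \<and> t' = t"
  using detD eval_det(1) by blast

definition runs :: "program \<Rightarrow> tree \<Rightarrow> tree \<Rightarrow> nat \<Rightarrow> bool" where
  "runs P x y t \<longleftrightarrow> eval P [x] (Call 0 [Arg 0]) y t"

section \<open>Encoding of inputs and outputs\<close>

definition code_bool :: "bool \<Rightarrow> tree" where
  "code_bool b = (if b then Node Leaf Leaf else Leaf)"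

text \<open>Binary representation, least significant bit first, without leading zeros.\<close>

fun code_nat :: "nat \<Rightarrow> tree" where
  "code_nat n = (if n = 0 then Leaf else Node (code_bool (odd n)) (code_nat (n div 2)))"

declare code_nat.simps [simp del]

fun code_list :: "('a \<Rightarrow> tree) \<Rightarrow> 'a list \<Rightarrow> tree" where
  "code_list c [] = Leaf"
| "code_list c (x # xs) = Node (c x) (code_list c xs)"

definition code_set :: "('a::linorder \<Rightarrow> tree) \<Rightarrow> 'a set \<Rightarrow> tree" where
  "code_set c A = code_list c (sorted_list_of_set A)"

fun code_option :: "('a \<Rightarrow> tree) \<Rightarrow> 'a option \<Rightarrow> tree" where
  "code_option c None = Leaf"
| "code_option c (Some x) = Node Leaf (c x)"

fun code_prod :: "('a \<Rightarrow> tree) \<Rightarrow> ('b \<Rightarrow> tree) \<Rightarrow> 'a \<times> 'b \<Rightarrow> tree" where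
  "code_prod c d (x, y) = Node (c x) (d y)"

fun code_fm :: "fm \<Rightarrow> tree" where
  "code_fm (Eq x y) = Node (code_nat 0) (Node (code_nat x) (code_nat y))"
| "code_fm (Rel i xs) = Node (code_nat 1) (Node (code_nat i) (code_list code_nat xs))"
| "code_fm (Neg \<phi>) = Node (code_nat 2) (code_fm \<phi>)"
| "code_fm (And \<phi> \<psi>) = Node (code_nat 3) (Node (code_fm \<phi>) (code_fm \<psi>))"
| "code_fm (Or \<phi> \<psi>) = Node (code_nat 4) (Node (code_fm \<phi>) (code_fm \<psi>))"
| "code_fm (Exists x \<phi>) = Node (code_nat 5) (Node (code_nat x) (code_fm \<phi>))"
| "code_fm (Forall x \<phi>) = Node (code_nat 6) (Node (code_nat x) (code_fm \<phi>))"

definition code_layer :: "('s::linorder \<Rightarrow> tree) \<Rightarrow> 's layer \<Rightarrow> tree" where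
  "code_layer c B = code_list id
     [code_set code_nat (lstates B),
      code_set code_nat (rstates B),
      code_set (code_prod code_nat (code_prod (code_option c) code_nat)) (transitions B),
      code_set code_nat (istates B),
      code_set code_nat (fstates B),
      code_bool (iflag B),
      code_bool (fflag B)]"

text \<open>
  Alphabets have to be part of an input, so their symbols are natural numbers. A parameter tuple
  is \<open>(\<Sigma>, w, \<tau>, \<phi>, n)\<close>.
\<close>

type_synonym params = "nat set \<times> nat \<times> nat list \<times> fm \<times> nat"

definition valid_params :: "params set" where
  "valid_params = {(\<Sigma>, w, \<tau>, \<phi>, n).
     finite \<Sigma> \<and> 1 \<le> w \<and> (\<forall>a\<in>set \<tau>. 1 \<le> a) \<and> wf_fm \<tau> \<phi> \<and> free_vars \<phi> \<subseteq> {..<n}}"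

definition code_params :: "params \<Rightarrow> tree" where
  "code_params =
     code_prod (code_set code_nat) (code_prod code_nat
       (code_prod (code_list code_nat) (code_prod code_fm code_nat)))"

definition code_tuple :: "nat layer list \<Rightarrow> nat option list layer list list \<Rightarrow> tree" where
  "code_tuple D0 Ds =
     Node (code_list (code_layer code_nat) D0)
          (code_list (code_list (code_layer (code_list (code_option code_nat)))) Ds)"

definition computable_on :: "('a \<Rightarrow> tree) \<Rightarrow> 'a set \<Rightarrow> ('a \<Rightarrow> nat) \<Rightarrow> bool" where
  "computable_on c A f \<longleftrightarrow> (\<exists>P. \<forall>x\<in>A. \<exists>t. runs P (c x) (code_nat (f x)) t)"

end

theory Submission
  imports Defs "HOL-Library.Multiset"
begin

text \<open>
  Every formula is turned into a deterministic layered automaton that reads one column of symbols, one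
  for each variable, per layer: atoms use the subset construction on the given diagrams, connectives
  use products, and a quantifier over \<open>x\<close> uses the set of all pairs consisting of a state of the body
  and a state of the automaton of the domain that are reachable with some track for \<open>x\<close>. The number of
  states depends on the parameters only. The solutions are counted by dynamic programming over the
  layers: a table maps every reachable state to the number of \<open>n\<close>-track words leading to it. Its entries
  have \<open>O(k)\<close> bits, so each of the \<open>k\<close> layers costs \<open>O(k)\<close> bit operations.

  All factors that depend on the parameters alone come from functions that are closed under
  composition and under well-founded recursion; each such function runs in time bounded by a
  monotone function of the size of its argument that is itself computable, which yields \<open>f\<close>.
\<close>

text \<open>Three obstacles shape the proof. The cost must split into a factor from the parameters
  and one from \<open>k\<close>. Parameter-only computations are therefore never costed precisely;
  they get some computable bound, however large, while passes over layers, rows and bits are costed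
  by hand.

  Following table sizes through the loop would fail: a layer turns a bound \<open>N\<close> into
  \<open>R N\<close>, and \<open>k\<close> layers would iterate \<open>R\<close>. Only the bit
  lengths are bounded in this way, gaining \<open>R N\<close> per layer. Keys are bounded
  semantically: each is the state of some run, and states of runs have a size that does not depend
  on the layer. The cost lemma assumes this bound (\<open>safe\<close>), and the correctness proof
  supplies it.

  Most tracks are not padded strings. The domain automaton therefore also checks the padding, a
  quantifier keeps its state next to that of the body, and the counted tracks are restricted by
  extra conjuncts. As every word has exactly one run, counting words amounts to counting runs, and a
  universal quantifier needs no complementation. States are lists rather than sets; different orders
  of one set only add keys, still within the bound on the number of trees.\<close>

section \<open>Composable programs with upper bounds on their running time\<close>

definition ev :: "program \<Rightarrow> tree \<Rightarrow> expr \<Rightarrow> tree \<Rightarrow> nat \<Rightarrow> bool" where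
  "ev P x e v c \<longleftrightarrow> (\<exists>t\<le>c. eval P [x] e v t)"

lemma ev_mono: "ev P x e v c \<Longrightarrow> c \<le> d \<Longrightarrow> ev P x e v d"
  unfolding ev_def by (meson le_trans)

lemma ev_Arg: "ev P x (Arg 0) x 1"
  unfolding ev_def using eval_Arg[of 0 "[x]" P] by auto

lemma ev_Nil: "ev P x Nil_e Leaf 1"
  unfolding ev_def using eval_Nil by blast

lemma ev_Cons: "ev P x a u s \<Longrightarrow> ev P x b v t \<Longrightarrow> ev P x (Cons_e a b) (Node u v) (s + t + 1)"
  unfolding ev_def using eval_Cons by (meson add_mono le_refl)

lemma ev_Head: "ev P x a v t \<Longrightarrow> ev P x (Head_e a) (left v) (t + 1)"
  unfolding ev_def using eval_Head by (meson add_mono le_refl)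

lemma ev_Tail: "ev P x a v t \<Longrightarrow> ev P x (Tail_e a) (right v) (t + 1)"
  unfolding ev_def using eval_Tail by (meson add_mono le_refl)

lemma ev_IfT: "ev P x c u s \<Longrightarrow> u \<noteq> Leaf \<Longrightarrow> ev P x a v t \<Longrightarrow> ev P x (If_e c a b) v (s + t + 1)"
  unfolding ev_def using eval_IfT by (meson add_mono le_refl)

lemma ev_IfF: "ev P x c Leaf s \<Longrightarrow> ev P x b v t \<Longrightarrow> ev P x (If_e c a b) v (s + t + 1)"
  unfolding ev_def using eval_IfF by (meson add_mono le_refl)

lemma ev_Call:
  assumes "ev P x a u s" "f < length P" "ev P u (P ! f) v t"
  shows "ev P x (Call f [a]) v (s + t + 1)"
proof -
  obtain s' t' where "s' \<le> s" "eval P [x] a u s'" "t' \<le> t" "eval P [u] (P ! f) v t'"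
    using assms unfolding ev_def by blast
  moreover from this have "evals P [x] [a] [u] (s' + 0)"
    by (intro evals_Cons evals_Nil)
  ultimately have "eval P [x] (Call f [a]) v (s' + 0 + t' + 1)"
    using assms(2) by (intro eval_Call)
  then show ?thesis
    unfolding ev_def using \<open>s' \<le> s\<close> \<open>t' \<le> t\<close> by (intro exI[of _ "s' + t' + 1"]) auto
qed

text \<open>
  Quantifying over the surrounding program up to the length of its front part makes programs
  composable without renumbering their calls.
\<close>

definition CT :: "(tree \<Rightarrow> tree) \<Rightarrow> (tree \<Rightarrow> nat) \<Rightarrow> bool" where
  "CT F C \<longleftrightarrow> (\<forall>n. \<exists>R e. \<forall>Q S x. length Q = n \<longrightarrow> ev (Q @ R @ S) x e (F x) (C x))"

lemma CT_obtain:
  assumes "CT F C"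
  obtains R e where "\<And>Q S x. length Q = n \<Longrightarrow> ev (Q @ R @ S) x e (F x) (C x)"
  using assms unfolding CT_def by metis

lemma CT_mono: "CT F C \<Longrightarrow> (\<And>x. C x \<le> D x) \<Longrightarrow> CT F D"
  unfolding CT_def by (meson ev_mono)

lemma CT_id: "CT (\<lambda>x. x) (\<lambda>_. 1)"
  unfolding CT_def using ev_Arg by blast

lemma CT_Leaf: "CT (\<lambda>_. Leaf) (\<lambda>_. 1)"
  unfolding CT_def using ev_Nil by blast

lemma CT_left: "CT F C \<Longrightarrow> CT (\<lambda>x. left (F x)) (\<lambda>x. C x + 1)"
  unfolding CT_def using ev_Head by meson

lemma CT_right: "CT F C \<Longrightarrow> CT (\<lambda>x. right (F x)) (\<lambda>x. C x + 1)"
  unfolding CT_def using ev_Tail by meson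

lemma CT_Node:
  assumes "CT F C" "CT G D"
  shows "CT (\<lambda>x. Node (F x) (G x)) (\<lambda>x. C x + D x + 1)"
  unfolding CT_def
proof
  fix n
  obtain R1 e1 where 1: "\<And>Q S x. length Q = n \<Longrightarrow> ev (Q @ R1 @ S) x e1 (F x) (C x)"
    using CT_obtain[OF assms(1)] by metis
  obtain R2 e2 where 2: "\<And>Q S x. length Q = n + length R1 \<Longrightarrow> ev (Q @ R2 @ S) x e2 (G x) (D x)"
    using CT_obtain[OF assms(2)] by metis
  show "\<exists>R e. \<forall>Q S x. length Q = n \<longrightarrow> ev (Q @ R @ S) x e (Node (F x) (G x)) (C x + D x + 1)"
    using 1[of _ "R2 @ _"] 2[of "_ @ R1"]
    by (intro exI[of _ "R1 @ R2"] exI[of _ "Cons_e e1 e2"]) (auto intro: ev_Cons[simplified])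
qed

lemma CT_if:
  assumes "CT P B" "CT F C" "CT G D"
  shows "CT (\<lambda>x. if P x \<noteq> Leaf then F x else G x)
    (\<lambda>x. B x + (if P x \<noteq> Leaf then C x else D x) + 1)"
  unfolding CT_def
proof
  fix n
  obtain R0 e0 where 0: "\<And>Q S x. length Q = n \<Longrightarrow> ev (Q @ R0 @ S) x e0 (P x) (B x)"
    using CT_obtain[OF assms(1)] by metis
  obtain R1 e1 where 1: "\<And>Q S x. length Q = n + length R0 \<Longrightarrow> ev (Q @ R1 @ S) x e1 (F x) (C x)"
    using CT_obtain[OF assms(2)] by metis
  obtain R2 e2 where 2: "\<And>Q S x. length Q = n + length R0 + length R1 \<Longrightarrow>
      ev (Q @ R2 @ S) x e2 (G x) (D x)"
    using CT_obtain[OF assms(3)] by metis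
  show "\<exists>R e. \<forall>Q S x. length Q = n \<longrightarrow> ev (Q @ R @ S) x e (if P x \<noteq> Leaf then F x else G x)
      (B x + (if P x \<noteq> Leaf then C x else D x) + 1)"
  proof (intro exI[of _ "R0 @ R1 @ R2"] exI[of _ "If_e e0 e1 e2"] allI impI)
    fix Q S x assume n: "length (Q :: program) = n"
    let ?P = "Q @ (R0 @ R1 @ R2) @ S"
    have "ev ?P x e0 (P x) (B x)" using 0[OF n, of "R1 @ R2 @ S"] by simp
    moreover have "ev ?P x e1 (F x) (C x)" using 1[of "Q @ R0" "R2 @ S"] n by simp
    moreover have "ev ?P x e2 (G x) (D x)" using 2[of "Q @ R0 @ R1" S] n by simp
    ultimately show "ev ?P x (If_e e0 e1 e2) (if P x \<noteq> Leaf then F x else G x)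
      (B x + (if P x \<noteq> Leaf then C x else D x) + 1)"
      using ev_IfT[of ?P x e0] ev_IfF[of ?P x e0] by auto
  qed
qed

text \<open>The body of \<open>F\<close> becomes a function of its own, placed behind both program
  parts: its \<open>Arg 0\<close> must denote the value of \<open>G\<close> instead of the original
  argument, and only a call changes the environment.\<close>

lemma CT_comp:
  assumes "CT F C" "CT G D"
  shows "CT (\<lambda>x. F (G x)) (\<lambda>x. D x + C (G x) + 1)"
  unfolding CT_def
proof
  fix n
  obtain R1 e1 where 1: "\<And>Q S x. length Q = n \<Longrightarrow> ev (Q @ R1 @ S) x e1 (G x) (D x)"
    using CT_obtain[OF assms(2)] by metis
  obtain R2 e2 where 2: "\<And>Q S x. length Q = n + length R1 \<Longrightarrow> ev (Q @ R2 @ S) x e2 (F x) (C x)"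
    using CT_obtain[OF assms(1)] by metis
  show "\<exists>R e. \<forall>Q S x. length Q = n \<longrightarrow> ev (Q @ R @ S) x e (F (G x)) (D x + C (G x) + 1)"
  proof (intro exI[of _ "R1 @ R2 @ [e2]"] exI[of _ "Call (n + length R1 + length R2) [e1]"]
      allI impI)
    fix Q S x assume n: "length (Q :: program) = n"
    let ?P = "Q @ (R1 @ R2 @ [e2]) @ S"
    have "ev ?P x e1 (G x) (D x)" using 1[OF n, of "R2 @ [e2] @ S"] by simp
    moreover have "ev ?P (G x) e2 (F (G x)) (C (G x))" using 2[of "Q @ R1" "[e2] @ S"] n by simp
    moreover have "?P ! (n + length R1 + length R2) = e2" using n by (simp add: nth_append)
    ultimately show "ev ?P x (Call (n + length R1 + length R2) [e1]) (F (G x)) (D x + C (G x) + 1)"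
      using n by (intro ev_Call) auto
  qed
qed

text \<open>The scheme of all hand-costed loops. The hypothesis on \<open>C\<close> is the
  recurrence of the running time, so a closed form may be guessed or the exact solution taken. The 5
  units are the test, two calls, the pairing and an access to \<open>x\<close>; the final 2 are the
  entry call and its argument.\<close>

lemma CT_rec:
  assumes P: "CT P p" and G: "CT G g" and H: "CT H h" and Z: "CT Z z"
    and f: "\<And>x. f x = (if P x \<noteq> Leaf then H (Node x (f (G x))) else Z x)"
    and dec: "\<And>x. P x \<noteq> Leaf \<Longrightarrow> m (G x) < (m x :: nat)"
    and C: "\<And>x. p x + (if P x \<noteq> Leaf then g x + h (Node x (f (G x))) + C (G x) + 5 else z x + 1) \<le> C x"
  shows "CT f (\<lambda>x. C x + 2)"
  unfolding CT_def
proof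
  fix n
  obtain R0 e0 where 0: "\<And>Q S x. length Q = n \<Longrightarrow> ev (Q @ R0 @ S) x e0 (P x) (p x)"
    using CT_obtain[OF P] by metis
  obtain R1 e1 where 1: "\<And>Q S x. length Q = n + length R0 \<Longrightarrow> ev (Q @ R1 @ S) x e1 (G x) (g x)"
    using CT_obtain[OF G] by metis
  obtain R2 e2 where 2: "\<And>Q S x. length Q = n + length R0 + length R1 \<Longrightarrow>
      ev (Q @ R2 @ S) x e2 (H x) (h x)"
    using CT_obtain[OF H] by metis
  obtain R3 e3 where 3: "\<And>Q S x. length Q = n + length R0 + length R1 + length R2 \<Longrightarrow>
      ev (Q @ R3 @ S) x e3 (Z x) (z x)"
    using CT_obtain[OF Z] by metis
  \<comment> \<open>Position \<open>i\<close> holds the step and \<open>Suc i\<close> the loop. The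
    step needs a position of its own because its argument is the pair of \<open>x\<close> and the
    recursive result.\<close>
  define i where "i = n + length R0 + length R1 + length R2 + length R3"
  define b where "b = If_e e0 (Call i [Cons_e (Arg 0) (Call (Suc i) [e1])]) e3"
  show "\<exists>R e. \<forall>Q S x. length Q = n \<longrightarrow> ev (Q @ R @ S) x e (f x) (C x + 2)"
  proof (intro exI[of _ "R0 @ R1 @ R2 @ R3 @ [e2, b]"] exI[of _ "Call (Suc i) [Arg 0]"]
      allI impI)
    fix Q S x assume n: "length (Q :: program) = n"
    let ?P = "Q @ (R0 @ R1 @ R2 @ R3 @ [e2, b]) @ S"
    have e0: "ev ?P x e0 (P x) (p x)" for x
      using 0[OF n, of "R1 @ R2 @ R3 @ [e2, b] @ S"] by simp
    have e1: "ev ?P x e1 (G x) (g x)" for x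
      using 1[of "Q @ R0" "R2 @ R3 @ [e2, b] @ S"] n by simp
    have e2: "ev ?P x e2 (H x) (h x)" for x
      using 2[of "Q @ R0 @ R1" "R3 @ [e2, b] @ S"] n by simp
    have e3: "ev ?P x e3 (Z x) (z x)" for x
      using 3[of "Q @ R0 @ R1 @ R2" "[e2, b] @ S"] n by simp
    have i: "?P ! i = e2" "?P ! Suc i = b" "i < length ?P" "Suc i < length ?P"
      using n by (simp_all add: nth_append i_def)
    have b: "ev ?P x b (f x) (C x)" for x
    proof (induction "m x" arbitrary: x rule: less_induct)
      case less
      show ?case
      proof (cases "P x = Leaf")
        case True
        then have "ev ?P x b (Z x) (p x + z x + 1)"
          using ev_IfF[OF _ e3[of x], of e0 "p x"] e0[of x] True unfolding b_def by simp
        then show ?thesis using C[of x] True f[of x] by (auto elim: ev_mono)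
      next
        case False
        have "ev ?P x (Call (Suc i) [e1]) (f (G x)) (g x + C (G x) + 1)"
          using e1[of x] less[OF dec[OF False]] i by (intro ev_Call) simp_all
        then have c: "ev ?P x (Call i [Cons_e (Arg 0) (Call (Suc i) [e1])]) (H (Node x (f (G x))))
           ((1 + (g x + C (G x) + 1) + 1) + h (Node x (f (G x))) + 1)"
          using ev_Call[OF ev_Cons[OF ev_Arg], OF _ i(3), unfolded i(1), OF _ e2] by blast
        have "ev ?P x b (f x)
           (p x + ((1 + (g x + C (G x) + 1) + 1) + h (Node x (f (G x))) + 1) + 1)"
          using ev_IfT[OF e0[of x] False c, of e3] False f[of x] unfolding b_def by simp
        then show ?thesis using C[of x] False by (auto elim: ev_mono)
      qed
    qed
    have "ev ?P x (Call (Suc i) [Arg 0]) (f x) (1 + C x + 1)"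
      using ev_Call[OF ev_Arg i(4), unfolded i(2), OF b] .
    then show "ev ?P x (Call (Suc i) [Arg 0]) (f x) (C x + 2)" by (simp add: add.commute)
  qed
qed

text \<open>The cost function is built by \<open>rec_nat\<close> with fuel, as \<open>g\<close> and
  \<open>m\<close> are arbitrary here; the measure shows that fuel above \<open>m x\<close> does not
  change the value.\<close>

lemma linear_recursion_exists:
  assumes "\<And>x. p x \<Longrightarrow> m (g x) < (m x :: nat)"
  shows "\<exists>C. \<forall>x. C x = (if p x then a x + C (g x) else (b x :: nat))"
proof -
  obtain D where D: "D 0 = b" "\<And>i. D (Suc i) = (\<lambda>x. if p x then a x + D i (g x) else b x)"
    using that[of "rec_nat b (\<lambda>_ D x. if p x then a x + D (g x) else b x)"] by simp
  have eq: "m x < i \<Longrightarrow> m x < j \<Longrightarrow> D i x = D j x" for i j x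
  proof (induction i arbitrary: j x)
    case (Suc i)
    then obtain j' where j: "j = Suc j'" by (cases j) auto
    have "p x \<Longrightarrow> D i (g x) = D j' (g x)"
      using Suc.prems assms[of x] by (intro Suc.IH) (auto simp: j)
    then show ?case by (simp add: j D)
  qed simp
  show ?thesis
  proof (intro exI[of _ "\<lambda>x. D (Suc (m x)) x"] allI)
    fix x
    have "p x \<Longrightarrow> D (m x) (g x) = D (Suc (m (g x))) (g x)"
      using assms[of x] by (intro eq) auto
    then show "D (Suc (m x)) x = (if p x then a x + D (Suc (m (g x))) (g x) else b x)"
      by (simp add: D(2))
  qed
qed

lemma CT_rec_ex:
  assumes P: "CT P p" and G: "CT G g" and H: "CT H h" and Z: "CT Z z"
    and f: "\<And>x. f x = (if P x \<noteq> Leaf then H (Node x (f (G x))) else Z x)"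
    and dec: "\<And>x. P x \<noteq> Leaf \<Longrightarrow> m (G x) < (m x :: nat)"
  obtains C where "CT f (\<lambda>x. C x + 2)"
    "\<And>x. C x = p x + (if P x \<noteq> Leaf then g x + h (Node x (f (G x))) + C (G x) + 5 else z x + 1)"
proof -
  obtain C where C: "\<And>x. C x = (if P x \<noteq> Leaf
      then (p x + g x + h (Node x (f (G x))) + 5) + C (G x) else p x + z x + 1)"
    using linear_recursion_exists[of "\<lambda>x. P x \<noteq> Leaf" m G
        "\<lambda>x. p x + g x + h (Node x (f (G x))) + 5" "\<lambda>x. p x + z x + 1"] dec by blast
  have C': "C x = p x + (if P x \<noteq> Leaf then g x + h (Node x (f (G x))) + C (G x) + 5 else z x + 1)"
    for x using C[of x] by simp
  have "CT f (\<lambda>x. C x + 2)"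
    by (rule CT_rec[where m = m, OF P G H Z]) (fact f, fact dec, simp add: C'[symmetric])
  then show ?thesis using C' that by blast
qed


section \<open>Trees as lists and unary numbers\<close>

fun lst :: "tree \<Rightarrow> tree list" where
  "lst Leaf = []"
| "lst (Node a b) = a # lst b"

abbreviation enc :: "tree list \<Rightarrow> tree" where
  "enc \<equiv> code_list (\<lambda>x. x)"

lemma lst_enc [simp]: "lst (enc xs) = xs"
  by (induction xs) auto

lemma enc_lst [simp]: "enc (lst t) = t"
  by (induction t) auto

lemma code_list_enc: "code_list c xs = enc (map c xs)"
  by (induction xs) auto

lemma enc_eq_Leaf [simp]: "enc xs = Leaf \<longleftrightarrow> xs = []"
  by (cases xs) auto

lemma lst_eq_Nil [simp]: "lst t = [] \<longleftrightarrow> t = Leaf"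
  by (cases t) auto

lemma enc_inject [simp]: "enc xs = enc ys \<longleftrightarrow> xs = ys"
  by (metis lst_enc)

lemma size_enc: "size (enc xs) = sum_list (map size xs) + length xs"
  by (induction xs) auto

lemma length_lst_le: "length (lst t) \<le> size t"
  by (induction t) auto

lemma size_lst_less: "y \<in> set (lst t) \<Longrightarrow> size y < size t"
  by (induction t) auto

lemma size_left_le: "size (left t) \<le> size t" and size_right_le: "size (right t) \<le> size t"
  by (cases t; simp)+

lemma size_left_less: "t \<noteq> Leaf \<Longrightarrow> size (left t) < size t"
  and size_right_less: "t \<noteq> Leaf \<Longrightarrow> size (right t) < size t"
  by (cases t; simp)+

definition un :: "nat \<Rightarrow> tree" where
  "un n = enc (replicate n Leaf)"

lemma un_simps [simp]: "un 0 = Leaf" "un (Suc n) = Node Leaf (un n)" "size (un n) = n"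
  "lst (un n) = replicate n Leaf"
  by (simp_all add: un_def size_enc)

text \<open>Termination in some time. This is all that is asked of the bounds entering
  \<open>f\<close>, since the time for computing \<open>f\<close> itself is unrestricted.\<close>

definition TC :: "(tree \<Rightarrow> tree) \<Rightarrow> bool" where
  "TC F \<longleftrightarrow> (\<exists>C. CT F C)"

lemma CT_TC: "CT F C \<Longrightarrow> TC F"
  unfolding TC_def by blast

lemma TC_intros:
  "TC (\<lambda>x. x)" "TC (\<lambda>_. Leaf)" "TC F \<Longrightarrow> TC (\<lambda>x. left (F x))" "TC F \<Longrightarrow> TC (\<lambda>x. right (F x))"
  "TC F \<Longrightarrow> TC G \<Longrightarrow> TC (\<lambda>x. Node (F x) (G x))"
  unfolding TC_def by (blast intro: CT_id CT_Leaf CT_left CT_right CT_Node)+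

lemma TC_comp: "TC F \<Longrightarrow> TC G \<Longrightarrow> TC (\<lambda>x. F (G x))"
  unfolding TC_def by (blast intro: CT_comp)

lemma TC_rec:
  assumes "TC P" "TC G" "TC H" "TC Z"
    and "\<And>x. f x = (if P x \<noteq> Leaf then H (Node x (f (G x))) else Z x)"
    and "\<And>x. P x \<noteq> Leaf \<Longrightarrow> m (G x) < (m x :: nat)"
  shows "TC f"
proof -
  obtain p g h z where "CT P p" "CT G g" "CT H h" "CT Z z"
    using assms(1-4) unfolding TC_def by blast
  from CT_rec_ex[of P p G g H h Z z f m, OF this assms(5,6)] show ?thesis
    unfolding TC_def by metis
qed

fun app_tree :: "tree \<Rightarrow> tree" where
  "app_tree Leaf = Leaf"
| "app_tree (Node Leaf b) = b"
| "app_tree (Node (Node u a) b) = Node u (app_tree (Node a b))"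

lemma TC_app_tree: "TC app_tree"
proof (rule TC_rec[where P = left and G = "\<lambda>x. Node (right (left x)) (right x)"
      and H = "\<lambda>x. Node (left (left (left x))) (right x)" and Z = right and m = "\<lambda>x. size (left x)"])
  show "app_tree x = (if left x \<noteq> Leaf
      then Node (left (left (left (Node x (app_tree (Node (right (left x)) (right x)))))))
             (right (Node x (app_tree (Node (right (left x)) (right x))))) else right x)" for x
    by (cases x rule: app_tree.cases) auto
qed (auto intro!: TC_intros size_right_less)

lemma app_tree_un: "app_tree (Node (un a) (un b)) = un (a + b)"
  by (induction a) auto

definition mul_tree :: "tree \<Rightarrow> tree" where
  "mul_tree x = ((\<lambda>r. app_tree (Node (right x) r)) ^^ length (lst (left x))) Leaf"

lemma TC_mul_tree: "TC mul_tree"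
proof (rule TC_rec[where P = left and G = "\<lambda>x. Node (right (left x)) (right x)"
      and H = "\<lambda>x. app_tree (Node (right (left x)) (right x))" and Z = "\<lambda>_. Leaf"
      and m = "\<lambda>x. size (left x)"])
  fix x
  show "mul_tree x = (if left x \<noteq> Leaf
      then app_tree (Node (right (left (Node x (mul_tree (Node (right (left x)) (right x))))))
             (right (Node x (mul_tree (Node (right (left x)) (right x)))))) else Leaf)"
    by (cases "left x") (simp_all add: mul_tree_def)
qed (auto intro!: TC_intros TC_comp[OF TC_app_tree] size_right_less)

lemma mul_tree_un: "mul_tree (Node (un a) (un b)) = un (a * b)"
  unfolding mul_tree_def by (induction a) (simp_all add: app_tree_un)

definition iter_tree :: "(tree \<Rightarrow> tree) \<Rightarrow> tree \<Rightarrow> tree" where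
  "iter_tree F x = (F ^^ length (lst (left x))) (right x)"

lemma TC_iter_tree:
  assumes "TC F"
  shows "TC (iter_tree F)"
proof (rule TC_rec[where P = left and G = "\<lambda>x. Node (right (left x)) (right x)"
      and H = "\<lambda>x. F (right x)" and Z = right and m = "\<lambda>x. size (left x)"])
  fix x
  show "iter_tree F x = (if left x \<noteq> Leaf
      then F (right (Node x (iter_tree F (Node (right (left x)) (right x))))) else right x)"
    by (cases "left x") (simp_all add: iter_tree_def)
qed (auto intro!: TC_intros TC_comp[OF assms] size_right_less)

lemma iter_tree_un:
  assumes "\<And>n. F (un n) = un (b n)"
  shows "iter_tree F (Node (un a) (un n)) = un ((b ^^ a) n)"
  unfolding iter_tree_def by (induction a) (simp_all add: assms)

section \<open>Computable monotone bounds\<close>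

text \<open>The functions from which \<open>f\<close> is assembled: monotone, so that an upper bound
  may be inserted into another one, and computed in unary, so that iterating a computed number of
  times is recursion over a list.\<close>

definition ub :: "(nat \<Rightarrow> nat) \<Rightarrow> bool" where
  "ub b \<longleftrightarrow> mono b \<and> (\<exists>F. TC F \<and> (\<forall>n. F (un n) = un (b n)))"

lemma ub_mono: "ub b \<Longrightarrow> m \<le> n \<Longrightarrow> b m \<le> b n"
  unfolding ub_def by (blast dest: monoD)

lemma ub_id: "ub (\<lambda>n. n)"
  unfolding ub_def by (auto intro!: monoI exI[of _ "\<lambda>x. x"] TC_intros)

lemma TC_const: "TC (\<lambda>_. c)"
  by (induction c) (auto intro: TC_intros)

lemma ub_const: "ub (\<lambda>_. c)"
  unfolding ub_def by (auto intro!: monoI exI[of _ "\<lambda>_. un c"] TC_const)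

lemma ub_add: assumes "ub a" "ub b" shows "ub (\<lambda>n. a n + b n)"
proof -
  obtain F G where F: "TC F" "\<forall>n. F (un n) = un (a n)" and G: "TC G" "\<forall>n. G (un n) = un (b n)"
    using assms unfolding ub_def by blast
  show ?thesis
    unfolding ub_def using assms F G
    by (intro conjI monoI exI[of _ "\<lambda>x. app_tree (Node (F x) (G x))"] TC_comp[OF TC_app_tree])
      (auto simp: app_tree_un intro!: TC_intros add_mono dest: ub_mono)
qed

lemma ub_mult: assumes "ub a" "ub b" shows "ub (\<lambda>n. a n * b n)"
proof -
  obtain F G where F: "TC F" "\<forall>n. F (un n) = un (a n)" and G: "TC G" "\<forall>n. G (un n) = un (b n)"
    using assms unfolding ub_def by blast
  show ?thesis
    unfolding ub_def using assms F G
    by (intro conjI monoI exI[of _ "\<lambda>x. mul_tree (Node (F x) (G x))"] TC_comp[OF TC_mul_tree])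
      (auto simp: mul_tree_un intro!: TC_intros mult_mono dest: ub_mono)
qed

lemma ub_comp: assumes "ub a" "ub b" shows "ub (\<lambda>n. a (b n))"
proof -
  obtain F G where F: "TC F" "\<forall>n. F (un n) = un (a n)" and G: "TC G" "\<forall>n. G (un n) = un (b n)"
    using assms unfolding ub_def by blast
  show ?thesis
    unfolding ub_def using assms F G
    by (intro conjI monoI exI[of _ "\<lambda>x. F (G x)"] TC_comp[OF F(1) G(1)]) (auto dest: ub_mono)
qed

lemma funpow_ge: "(\<And>n. n \<le> b n) \<Longrightarrow> (n :: nat) \<le> (b ^^ k) n"
  by (induction k) (auto intro: le_trans)

lemma funpow_mono_bound:
  assumes "mono b" "\<And>n. n \<le> b n" "i \<le> j" "m \<le> (n :: nat)"
  shows "(b ^^ i) m \<le> (b ^^ j) n"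
proof -
  have "(b ^^ i) m \<le> (b ^^ i) n" using assms(1,4) by (intro funpow_mono)
  also have "\<dots> \<le> (b ^^ (j - i)) ((b ^^ i) n)" using assms(2) by (rule funpow_ge)
  also have "\<dots> = (b ^^ j) n" using assms(3) by (metis funpow_add comp_apply le_add_diff_inverse2)
  finally show ?thesis .
qed

text \<open>The number of iterations may depend on the argument, so a recursion whose depth is the
  input size still has a bound in the class. The price is growth like towers of exponentials. The
  condition \<open>n \<le> b n\<close> gives monotonicity in the number of iterations.\<close>

lemma ub_funpow:
  assumes "ub b" "\<And>n. n \<le> b n" "ub i" "ub a"
  shows "ub (\<lambda>n. (b ^^ i n) (a n))"
proof -
  obtain F G H where F: "TC F" "\<And>n. F (un n) = un (b n)" and G: "TC G" "\<And>n. G (un n) = un (i n)"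
    and H: "TC H" "\<And>n. H (un n) = un (a n)"
    using assms(1,3,4) unfolding ub_def by metis
  have "mono (\<lambda>n. (b ^^ i n) (a n))"
    using assms by (intro monoI funpow_mono_bound) (auto simp: ub_mono ub_def)
  then show ?thesis
    unfolding ub_def using F G H
    by (intro conjI exI[of _ "\<lambda>x. iter_tree F (Node (G x) (H x))"] TC_comp[OF TC_iter_tree])
      (auto simp: iter_tree_un intro!: TC_intros)
qed

lemma ub_Suc: "ub a \<Longrightarrow> ub (\<lambda>n. Suc (a n))"
  using ub_add[of a "\<lambda>_. 1"] ub_const[of 1] by simp

lemmas ub_intros = ub_id ub_const ub_add ub_mult ub_Suc ub_Suc[OF ub_id]

lemma ub_power2:
  assumes "ub a"
  shows "ub (\<lambda>n. 2 ^ a n)"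
proof -
  have *: "((\<lambda>n. 2 * n) ^^ k) m = 2 ^ k * (m :: nat)" for k m
    by (induction k) auto
  show ?thesis
    using ub_funpow[of "\<lambda>n. 2 * n" a "\<lambda>_. 1"] assms unfolding * by (simp add: ub_intros)
qed

section \<open>Functions computable within computable bounds\<close>

text \<open>The size of the result needs a bound of its own: subtrees are shared, so a result can be
  exponentially larger than the time spent on it, and composition needs the size of the inner
  result.\<close>

definition PR :: "(tree \<Rightarrow> tree) \<Rightarrow> bool" where
  "PR F \<longleftrightarrow> (\<exists>b. ub b \<and> CT F (\<lambda>x. b (size x)) \<and> (\<forall>x. size (F x) \<le> b (size x)))"

lemma PR_I: "ub b \<Longrightarrow> CT F (\<lambda>x. b (size x)) \<Longrightarrow> (\<And>x. size (F x) \<le> b (size x)) \<Longrightarrow> PR F"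
  unfolding PR_def by blast

lemma PR_obtain:
  assumes "PR F"
  obtains b where "ub b" "CT F (\<lambda>x. b (size x))" "\<And>x. size (F x) \<le> b (size x)" "\<And>n. n \<le> b n"
proof -
  obtain b where b: "ub b" "CT F (\<lambda>x. b (size x))" "\<And>x. size (F x) \<le> b (size x)"
    using assms unfolding PR_def by blast
  show ?thesis
    by (rule that[of "\<lambda>n. b n + n"]) (auto intro: ub_intros b CT_mono[OF b(2)] trans_le_add1)
qed

lemma PR_id: "PR (\<lambda>x. x)"
  by (rule PR_I[of "\<lambda>n. n + 1"]) (auto intro: ub_intros CT_mono[OF CT_id])

lemma PR_Leaf: "PR (\<lambda>_. Leaf)"
  by (rule PR_I[of "\<lambda>n. n + 1"]) (auto intro: ub_intros CT_mono[OF CT_Leaf])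

lemma PR_left: assumes "PR F" shows "PR (\<lambda>x. left (F x))"
proof -
  obtain b where "ub b" "CT F (\<lambda>x. b (size x))" "\<And>x. size (F x) \<le> b (size x)"
    using PR_obtain[OF assms] by metis
  then show ?thesis
    by (intro PR_I[of "\<lambda>n. b n + 1"] ub_intros CT_left) (auto intro: le_trans[OF size_left_le] le_SucI)
qed

lemma PR_right: assumes "PR F" shows "PR (\<lambda>x. right (F x))"
proof -
  obtain b where "ub b" "CT F (\<lambda>x. b (size x))" "\<And>x. size (F x) \<le> b (size x)"
    using PR_obtain[OF assms] by metis
  then show ?thesis
    by (intro PR_I[of "\<lambda>n. b n + 1"] ub_intros CT_right) (auto intro: le_trans[OF size_right_le] le_SucI)
qed

lemma PR_Node: assumes "PR F" "PR G" shows "PR (\<lambda>x. Node (F x) (G x))"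
proof -
  obtain b where b: "ub b" "CT F (\<lambda>x. b (size x))" "\<And>x. size (F x) \<le> b (size x)"
    using PR_obtain[OF assms(1)] by metis
  obtain c where c: "ub c" "CT G (\<lambda>x. c (size x))" "\<And>x. size (G x) \<le> c (size x)"
    using PR_obtain[OF assms(2)] by metis
  show ?thesis
    using b c by (intro PR_I[of "\<lambda>n. b n + c n + 1"] ub_intros CT_Node) (auto intro: add_mono)
qed

lemma PR_const: "PR (\<lambda>_. c)"
  by (induction c) (auto intro: PR_Leaf PR_Node)

lemma PR_if: assumes "PR P" "PR F" "PR G" shows "PR (\<lambda>x. if P x \<noteq> Leaf then F x else G x)"
proof -
  obtain a where a: "ub a" "CT P (\<lambda>x. a (size x))"
    using PR_obtain[OF assms(1)] by metis
  obtain b where b: "ub b" "CT F (\<lambda>x. b (size x))" "\<And>x. size (F x) \<le> b (size x)"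
    using PR_obtain[OF assms(2)] by metis
  obtain c where c: "ub c" "CT G (\<lambda>x. c (size x))" "\<And>x. size (G x) \<le> c (size x)"
    using PR_obtain[OF assms(3)] by metis
  show ?thesis
    using a b c
    by (intro PR_I[of "\<lambda>n. a n + b n + c n + 1"] ub_intros CT_mono[OF CT_if])
      (auto intro: trans_le_add1 trans_le_add2 le_SucI)
qed

lemma PR_comp: assumes "PR F" "PR G" shows "PR (\<lambda>x. F (G x))"
proof -
  obtain b where b: "ub b" "CT F (\<lambda>x. b (size x))" "\<And>x. size (F x) \<le> b (size x)"
    using PR_obtain[OF assms(1)] by metis
  obtain c where c: "ub c" "CT G (\<lambda>x. c (size x))" "\<And>x. size (G x) \<le> c (size x)"
    using PR_obtain[OF assms(2)] by metis
  have "b (size (G x)) \<le> b (c (size x))" for x using b(1) c(3) by (rule ub_mono)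
  then show ?thesis
    using b c
    by (intro PR_I[of "\<lambda>n. c n + b (c n) + 1"] ub_intros CT_mono[OF CT_comp[OF b(2) c(2)]] ub_comp[OF b(1)])
      (auto intro: le_trans[OF b(3)] trans_le_add2 le_SucI)
qed

text \<open>Divide and conquer: \<open>G\<close> lists the sub-arguments and \<open>H\<close>
  combines them, each paired with its value. Sub-arguments may be larger than \<open>x\<close>; only
  the measure decreases, and as it is at most the size of the input, so is the depth. A bound
  \<open>E\<close> for one level, iterated along the depth, then bounds time and size.\<close>

lemma PR_dc:
  assumes "PR G" "PR H"
    and f: "\<And>x. f x = H (Node x (enc (map (\<lambda>y. Node y (f y)) (lst (G x)))))"
    and dec: "\<And>x y. y \<in> set (lst (G x)) \<Longrightarrow> m y < m x" and m: "\<And>x. m x \<le> size x"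
  shows "PR f"
proof -
  obtain g where g: "ub g" "CT G (\<lambda>x. g (size x))" "\<And>x. size (G x) \<le> g (size x)" "\<And>n. n \<le> g n"
    using PR_obtain[OF assms(1)] by metis
  obtain h where h: "ub h" "CT H (\<lambda>x. h (size x))" "\<And>x. size (H x) \<le> h (size x)"
    using PR_obtain[OF assms(2)] by metis
  \<comment> \<open>\<open>N z\<close> bounds the argument of \<open>H\<close> if \<open>x\<close>,
    the number of children, the children and their values are all bounded by \<open>z\<close>: a
    list cell with a pair takes \<open>2 * z + 2\<close>. In \<open>E\<close>, the 12 is the
    overhead of \<open>em\<close> below for one child, and \<open>7 = 3 + 4\<close> the overhead
    outside the children.\<close>
  define N where "N z = 1 + z + z * (2 * z + 2)" for z :: nat
  define E where "E z = z + 7 + z * (z + 12) + (g (N z) + h (N z))" for z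
  have ub_N: "ub N" unfolding N_def by (intro ub_intros)
  have ub_E: "ub E"
    unfolding E_def by (intro ub_intros ub_comp[OF g(1) ub_N] ub_comp[OF h(1) ub_N])
  have E_ge: "n \<le> E n" for n by (simp add: E_def)
  have g_E: "g n \<le> E n" for n
  proof -
    have "n \<le> N n" by (simp add: N_def)
    then have "g n \<le> g (N n)" by (rule ub_mono[OF g(1)])
    then show ?thesis by (simp add: E_def)
  qed
  \<comment> \<open>Two applications of \<open>E\<close> per level: the inner one covers the growth
    of the sub-arguments, the outer one the combination of their results.\<close>
  define B where "B d = E ^^ (2 * d)" for d
  have B_Suc: "B (Suc d) n = E (B d (E n))" for d n
    by (simp add: B_def funpow_swap1)
  have B_mono: "m \<le> n \<Longrightarrow> B d m \<le> B d n" for d m n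
    unfolding B_def using E_ge ub_E by (intro funpow_mono_bound) (auto simp: ub_def)
  have B_ge: "n \<le> B d n" for d n unfolding B_def by (intro funpow_ge E_ge)
  have step: "size (f x) \<le> B (Suc d) n \<and>
      g n + (3 + (\<Sum>y\<leftarrow>ys. B d (size y) + 12)) + h (size (Node x (enc (map (\<lambda>y. Node y (f y)) ys)))) + 4
        \<le> B (Suc d) n"
    if n: "n = size x" and ys: "ys = lst (G x)"
      and IH: "\<And>y. y \<in> set ys \<Longrightarrow> size (f y) \<le> B d (size y)" for d x n ys
  proof -
    define M where "M = B d (E n)"
    have gM: "g n \<le> M" and nM: "n \<le> M"
      unfolding M_def using B_ge[of "E n" d] g_E[of n] E_ge[of n] by linarith+
    have len: "length ys \<le> g n"
      using length_lst_le[of "G x"] g(3)[of x] by (simp add: n ys)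
    have yg: "size y \<le> g n" if "y \<in> set ys" for y
      using size_lst_less[of y "G x"] g(3)[of x] that n ys by auto
    have BM: "B d (size y) \<le> M" if "y \<in> set ys" for y
      unfolding M_def using yg[OF that] g_E[of n] by (intro B_mono) simp
    have "(\<Sum>y\<leftarrow>ys. B d (size y) + 12) \<le> (\<Sum>y\<leftarrow>ys. M + 12)"
      using BM by (intro sum_list_mono) auto
    also have "\<dots> \<le> M * (M + 12)"
      using len gM by (simp add: sum_list_triv add_mult_distrib2)
        (metis add_mono le_trans mult_le_mono1)
    finally have 1: "(\<Sum>y\<leftarrow>ys. B d (size y) + 12) \<le> M * (M + 12)" .
    have "size (enc (map (\<lambda>y. Node y (f y)) ys)) = (\<Sum>y\<leftarrow>ys. size y + size (f y) + 2)"
      by (induction ys) (auto simp: size_enc)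
    also have "\<dots> \<le> (\<Sum>y\<leftarrow>ys. M + M + 2)"
      using IH BM yg gM by (intro sum_list_mono add_mono) (auto intro: le_trans)
    also have "\<dots> \<le> M * (2 * M + 2)"
      using mult_le_mono1[OF le_trans[OF len gM], of "2 * M + 2"] by (simp add: sum_list_triv mult_2)
    finally have 2: "size (Node x (enc (map (\<lambda>y. Node y (f y)) ys))) \<le> N M"
      using nM by (simp add: N_def n)
    then have "h (size (Node x (enc (map (\<lambda>y. Node y (f y)) ys)))) \<le> h (N M)"
      by (rule ub_mono[OF h(1)])
    moreover from this have "size (f x) \<le> h (N M)"
      using le_trans[OF h(3)] by (subst f) (auto simp: ys[symmetric])
    moreover have "B (Suc d) n = M + 7 + M * (M + 12) + (g (N M) + h (N M))"
      by (simp add: B_Suc E_def M_def)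
    ultimately show ?thesis using 1 gM by linarith
  qed
  have size_f: "m x < d \<Longrightarrow> size (f x) \<le> B d (size x)" for d x
  proof (induction d arbitrary: x)
    case (Suc d)
    have "y \<in> set (lst (G x)) \<Longrightarrow> size (f y) \<le> B d (size y)" for y
      using Suc.IH[of y] Suc.prems dec[of y x] by auto
    then show ?case using step[OF refl refl] by blast
  qed simp
  define b where "b n = B (Suc n) n + 2" for n
  have "CT f (\<lambda>x. b (size x))"
    unfolding CT_def
  proof
    fix n
    obtain R1 e1 where 1: "\<And>Q S x. length Q = n \<Longrightarrow> ev (Q @ R1 @ S) x e1 (G x) (g (size x))"
      using CT_obtain[OF g(2)] by metis
    obtain R2 e2 where 2: "\<And>Q S x. length Q = n + length R1 \<Longrightarrow>
        ev (Q @ R2 @ S) x e2 (H x) (h (size x))"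
      using CT_obtain[OF h(2)] by metis
    define i where "i = n + length R1 + length R2"
    \<comment> \<open>\<open>em\<close> at position \<open>i + 1\<close> maps \<open>ef\<close> at
      position \<open>i + 2\<close> over a list, and \<open>ef\<close> calls \<open>em\<close>. The
      mutual recursion is resolved by an induction on the list under an assumption on
      \<open>ef\<close>, nested in an induction on the depth.\<close>
    define em where "em = If_e (Arg 0)
      (Cons_e (Cons_e (Head_e (Arg 0)) (Call (i + 2) [Head_e (Arg 0)])) (Call (i + 1) [Tail_e (Arg 0)])) Nil_e"
    define ef where "ef = Call i [Cons_e (Arg 0) (Call (i + 1) [e1])]"
    show "\<exists>R e. \<forall>Q S x. length Q = n \<longrightarrow> ev (Q @ R @ S) x e (f x) (b (size x))"
    proof (intro exI[of _ "R1 @ R2 @ [e2, em, ef]"] exI[of _ "Call (i + 2) [Arg 0]"] allI impI)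
      fix Q S x assume n: "length (Q :: program) = n"
      define P where "P = Q @ (R1 @ R2 @ [e2, em, ef]) @ S"
      have e1: "ev P x e1 (G x) (g (size x))" for x
        using 1[OF n, of "R2 @ [e2, em, ef] @ S"] by (simp add: P_def)
      have e2: "ev P x e2 (H x) (h (size x))" for x
        using 2[of "Q @ R1" "[e2, em, ef] @ S"] n by (simp add: P_def)
      have i: "P ! i = e2" "P ! (i + 1) = em" "P ! (i + 2) = ef"
        "i < length P" "i + 1 < length P" "i + 2 < length P"
        using n by (simp_all add: nth_append i_def P_def)
      have em: "ev P (enc ys) em (enc (map (\<lambda>y. Node y (f y)) ys)) (3 + (\<Sum>y\<leftarrow>ys. c y + 12))"
        if "\<And>y. y \<in> set ys \<Longrightarrow> ev P y ef (f y) (c y)" for ys c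
        using that
      proof (induction ys)
        case Nil
        show ?case unfolding em_def
          using ev_IfF[OF ev_Arg[of P Leaf] ev_Nil] by (simp add: numeral_3_eq_3)
      next
        case (Cons y ys)
        let ?l = "Node y (enc ys)"
        have l: "ev P ?l (Head_e (Arg 0)) y (1 + 1)" and r: "ev P ?l (Tail_e (Arg 0)) (enc ys) (1 + 1)"
          using ev_Head[OF ev_Arg[of P ?l]] ev_Tail[OF ev_Arg[of P ?l]] by simp_all
        have y: "ev P y ef (f y) (c y)" using Cons.prems by simp
        have ys: "ev P (enc ys) em (enc (map (\<lambda>y. Node y (f y)) ys)) (3 + (\<Sum>y\<leftarrow>ys. c y + 12))"
          using Cons by simp
        note y' = ev_Call[OF l i(6), unfolded i(3), OF y]
        note ys' = ev_Call[OF r i(5), unfolded i(2), OF ys]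
        from ev_IfT[OF ev_Arg _ ev_Cons[OF ev_Cons[OF l y'] ys'], of Nil_e]
        show ?case unfolding em_def by (auto elim: ev_mono)
      qed
      have ef: "m x < d \<Longrightarrow> ev P x ef (f x) (B d (size x))" for d x
      proof (induction d arbitrary: x)
        case (Suc d)
        define ys where "ys = lst (G x)"
        have "ev P y ef (f y) (B d (size y))" if "y \<in> set ys" for y
          using Suc.IH[of y] Suc.prems dec[of y x] that by (auto simp: ys_def)
        from em[of "lst (G x)" "\<lambda>y. B d (size y)", folded ys_def, OF this]
        have em': "ev P (G x) em (enc (map (\<lambda>y. Node y (f y)) ys)) (3 + (\<Sum>y\<leftarrow>ys. B d (size y) + 12))"
          by (simp add: ys_def)
        have "ev P x ef (f x) (1 + (g (size x) + (3 + (\<Sum>y\<leftarrow>ys. B d (size y) + 12)) + 1) + 1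
            + h (size (Node x (enc (map (\<lambda>y. Node y (f y)) ys)))) + 1)"
          unfolding ef_def f[of x] ys_def[symmetric]
          using ev_Call[OF ev_Cons[OF ev_Arg ev_Call[OF e1 i(5), unfolded i(2), OF em']] i(4),
              unfolded i(1), OF e2] .
        moreover have "\<And>y. y \<in> set ys \<Longrightarrow> size (f y) \<le> B d (size y)"
          using size_f dec[of _ x] Suc.prems unfolding ys_def by (meson less_Suc_eq_le less_le_trans)
        ultimately show ?case using step[OF refl ys_def, of d] by (auto elim!: ev_mono)
      qed simp
      have "m x < Suc (size x)" using m by (simp add: less_Suc_eq_le)
      from ev_Call[OF ev_Arg i(6), unfolded i(3), OF ef[OF this]]
      show "ev (Q @ (R1 @ R2 @ [e2, em, ef]) @ S) x (Call (i + 2) [Arg 0]) (f x) (b (size x))"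
        unfolding P_def[symmetric] b_def by (auto elim: ev_mono)
    qed
  qed
  moreover have "size (f x) \<le> b (size x)" for x
    using size_f[of x "Suc (size x)"] m[of x] by (simp add: b_def less_Suc_eq_le)
  moreover have "ub b"
    unfolding b_def B_def using E_ge ub_E ub_add[OF ub_const[of 1] ub_id]
    by (intro ub_intros ub_funpow) simp_all
  ultimately show ?thesis by (intro PR_I)
qed


text \<open>Divide and conquer with at most one part: the list of sub-arguments is empty exactly in
  the base case, and this is how the combining function recognises it.\<close>

lemma PR_rec:
  assumes "PR P" "PR G" "PR H" "PR Z"
    and f: "\<And>x. f x = (if P x \<noteq> Leaf then H (Node x (f (G x))) else Z x)"
    and dec: "\<And>x. P x \<noteq> Leaf \<Longrightarrow> m (G x) < m x" and m: "\<And>x. m x \<le> size x"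
  shows "PR f"
proof (rule PR_dc[where G = "\<lambda>x. if P x \<noteq> Leaf then Node (G x) Leaf else Leaf" and m = m
      and H = "\<lambda>z. if right z \<noteq> Leaf then H (Node (left z) (right (left (right z)))) else Z (left z)"])
  show "PR (\<lambda>x. if P x \<noteq> Leaf then Node (G x) Leaf else Leaf)"
    by (intro PR_if PR_Node PR_const assms)
  show "PR (\<lambda>z. if right z \<noteq> Leaf then H (Node (left z) (right (left (right z)))) else Z (left z))"
    by (intro PR_if PR_comp[OF \<open>PR H\<close>] PR_comp[OF \<open>PR Z\<close>] PR_Node PR_left PR_right PR_id)
  show "f x = (\<lambda>z. if right z \<noteq> Leaf then H (Node (left z) (right (left (right z)))) else Z (left z))
      (Node x (enc (map (\<lambda>y. Node y (f y)) (lst (if P x \<noteq> Leaf then Node (G x) Leaf else Leaf)))))" for x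
    using f[of x] by simp
qed (use dec m in \<open>auto split: if_splits\<close>)

section \<open>Closure under Boolean and list operations\<close>

abbreviation "PRL L \<equiv> PR (\<lambda>x. enc (L x))"
abbreviation "PRb p \<equiv> PR (\<lambda>x. code_bool (p x))"

lemma code_bool_eq_Leaf [simp]: "code_bool b = Leaf \<longleftrightarrow> \<not> b"
  by (simp add: code_bool_def)

lemma PR_ifb: "PRb p \<Longrightarrow> PR F \<Longrightarrow> PR G \<Longrightarrow> PR (\<lambda>x. if p x then F x else G x)"
  using PR_if[of "\<lambda>x. code_bool (p x)" F G] by simp

text \<open>Several arguments are packed into a pair. The rule transfers closure of the packed
  function to arbitrary arguments, which is the form needed for chaining such rules by
  \<open>intro\<close>.\<close>

lemma PR_let:
  assumes "PR (\<lambda>p. F (left p) (right p))" "PR A" "PR B"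
  shows "PR (\<lambda>x. F (A x) (B x))"
  using PR_comp[OF assms(1) PR_Node[OF assms(2,3)]] by simp

text \<open>The parameter \<open>x\<close> travels in the right component through the recursion,
  because the called function sees nothing but its own argument. The other list operations below are
  written as folds for this reason.\<close>

lemma PR_foldr:
  assumes H: "PR (\<lambda>p. H (left p) (left (right p)) (right (right p)))" and Z: "PR Z" and L: "PRL L"
  shows "PR (\<lambda>x. foldr (\<lambda>a r. H a r x) (L x) (Z x))"
proof -
  define f where "f z = foldr (\<lambda>a r. H a r (right z)) (lst (left z)) (Z (right z))" for z
  have "PR f"
  proof (rule PR_rec[where P = left and G = "\<lambda>z. Node (right (left z)) (right z)"
        and Z = "\<lambda>z. Z (right z)" and m = "\<lambda>z. size (left z)"
        and H = "\<lambda>q. H (left (left (left q))) (right q) (right (left q))"])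
    have "PR (\<lambda>q. Node (left (left (left q))) (Node (right q) (right (left q))))"
      by (intro PR_Node PR_left PR_right PR_id)
    from PR_comp[OF H this] show "PR (\<lambda>q. H (left (left (left q))) (right q) (right (left q)))"
      by simp
    show "f x = (if left x \<noteq> Leaf
         then H (left (left (left (Node x (f (Node (right (left x)) (right x)))))))
               (right (Node x (f (Node (right (left x)) (right x)))))
               (right (left (Node x (f (Node (right (left x)) (right x))))))
         else Z (right x))" for x
      by (cases "left x") (simp_all add: f_def)
  qed (auto intro!: PR_comp[OF Z] PR_Node PR_left PR_right PR_id size_right_less size_left_le)
  from PR_comp[OF this PR_Node[OF L PR_id]] show ?thesis by (simp add: f_def)
qed

definition eq_pair :: "tree \<Rightarrow> tree" where
  "eq_pair p = code_bool (left p = right p)"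

text \<open>Both subtrees have to be compared, a branching recursion, so \<open>PR_dc\<close> is
  needed in place of \<open>PR_rec\<close>.\<close>

lemma PR_eq_pair: "PR eq_pair"
proof (rule PR_dc[where m = "\<lambda>p. size (left p)"
    and G = "\<lambda>p. if left p \<noteq> Leaf then if right p \<noteq> Leaf
      then Node (Node (left (left p)) (left (right p))) (Node (Node (right (left p)) (right (right p))) Leaf)
      else Leaf else Leaf"
    and H = "\<lambda>z. if left (left z) \<noteq> Leaf
      then if right (left z) \<noteq> Leaf
        then if right (left (right z)) \<noteq> Leaf then right (left (right (right z))) else Leaf
        else Leaf
      else if right (left z) \<noteq> Leaf then Leaf else Node Leaf Leaf"])
  show "eq_pair x = (\<lambda>z. if left (left z) \<noteq> Leaf
      then if right (left z) \<noteq> Leaf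
        then if right (left (right z)) \<noteq> Leaf then right (left (right (right z))) else Leaf
        else Leaf
      else if right (left z) \<noteq> Leaf then Leaf else Node Leaf Leaf)
    (Node x (enc (map (\<lambda>y. Node y (eq_pair y))
      (lst (if left x \<noteq> Leaf then if right x \<noteq> Leaf
      then Node (Node (left (left x)) (left (right x))) (Node (Node (right (left x)) (right (right x))) Leaf)
      else Leaf else Leaf)))))" for x
    by (cases "left x"; cases "right x") (auto simp: eq_pair_def code_bool_def)
qed (auto intro!: PR_if PR_Node PR_left PR_right PR_const PR_id size_left_less size_right_less size_left_le
    split: if_splits)

lemma PRb_eq: "PR F \<Longrightarrow> PR G \<Longrightarrow> PRb (\<lambda>x. F x = G x)"
  using PR_comp[OF PR_eq_pair PR_Node] by (simp add: eq_pair_def)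

lemma PRb_True: "PRb (\<lambda>_. True)" and PRb_False: "PRb (\<lambda>_. False)"
  by (simp_all add: PR_const)

lemma PRb_if: "PRb p \<Longrightarrow> PRb q \<Longrightarrow> PRb r \<Longrightarrow> PRb (\<lambda>x. if p x then q x else r x)"
  using PR_ifb[of p "\<lambda>x. code_bool (q x)" "\<lambda>x. code_bool (r x)"]
  by (simp add: if_distrib[of code_bool])

lemma PRb_cong: "PRb q \<Longrightarrow> (\<And>x. p x = q x) \<Longrightarrow> PRb p"
  by presburger

lemma PRb_not: "PRb p \<Longrightarrow> PRb (\<lambda>x. \<not> p x)"
  by (rule PRb_cong[OF PRb_if[of p "\<lambda>_. False" "\<lambda>_. True"]]) (auto intro: PR_const)

lemma PRb_conj: "PRb p \<Longrightarrow> PRb q \<Longrightarrow> PRb (\<lambda>x. p x \<and> q x)"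
  by (rule PRb_cong[OF PRb_if[of p q "\<lambda>_. False"]]) (auto intro: PR_const)

lemma PRb_disj: "PRb p \<Longrightarrow> PRb q \<Longrightarrow> PRb (\<lambda>x. p x \<or> q x)"
  by (rule PRb_cong[OF PRb_if[of p "\<lambda>_. True" q]]) (auto intro: PR_const)

lemma PRb_imp: "PRb p \<Longrightarrow> PRb q \<Longrightarrow> PRb (\<lambda>x. p x \<longrightarrow> q x)"
  by (rule PRb_cong[OF PRb_if[of p q "\<lambda>_. True"]]) (auto intro: PR_const)

lemma PRL_Nil: "PRL (\<lambda>_. [])" and PRL_lst: "PR T \<Longrightarrow> PRL (\<lambda>x. lst (T x))"
  and PRL_Cons: "PR A \<Longrightarrow> PRL L \<Longrightarrow> PRL (\<lambda>x. A x # L x)"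
  by (simp_all add: PR_const PR_Node)

lemma PRL_if: "PRb p \<Longrightarrow> PRL K \<Longrightarrow> PRL L \<Longrightarrow> PRL (\<lambda>x. if p x then K x else L x)"
  using PR_ifb[of p "\<lambda>x. enc (K x)" "\<lambda>x. enc (L x)"] by (simp add: if_distrib[of enc])

lemma PRL_append:
  assumes "PRL K" "PRL L"
  shows "PRL (\<lambda>x. K x @ L x)"
proof -
  have *: "enc (xs @ ys) = foldr Node xs (enc ys)" for xs ys by (induction xs) auto
  show ?thesis
    unfolding * using assms PR_foldr[of "\<lambda>a r x. Node a r"] by (simp add: PR_Node PR_left PR_right PR_id)
qed

lemma PRL_map:
  assumes "PR (\<lambda>p. F (left p) (right p))" "PRL L"
  shows "PRL (\<lambda>x. map (\<lambda>a. F a x) (L x))"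
proof -
  have *: "enc (map f xs) = foldr (\<lambda>a r. Node (f a) r) xs Leaf" for f xs by (induction xs) auto
  have "PR (\<lambda>p. Node (left p) (right (right p)))" by (intro PR_Node PR_left PR_right PR_id)
  from PR_comp[OF assms(1) this] show ?thesis
    unfolding * by (intro PR_foldr[of "\<lambda>a r x. Node (F a x) r"] PR_Node PR_const assms PR_left PR_right PR_id) simp
qed

lemma PRL_filter:
  assumes "PRb (\<lambda>p. q (left p) (right p))" "PRL L"
  shows "PRL (\<lambda>x. filter (\<lambda>a. q a x) (L x))"
proof -
  have *: "enc (filter f xs) = foldr (\<lambda>a r. if f a then Node a r else r) xs Leaf" for f xs
    by (induction xs) auto
  have "PR (\<lambda>p. Node (left p) (right (right p)))" by (intro PR_Node PR_left PR_right PR_id)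
  from PR_comp[OF assms(1) this] show ?thesis
    unfolding *
    by (intro PR_foldr[of "\<lambda>a r x. if q a x then Node a r else r"] PR_ifb PR_Node PR_const assms PR_left PR_right PR_id) simp
qed

lemma PRL_concat_map:
  assumes "PRL (\<lambda>p. F (left p) (right p))" "PRL L"
  shows "PRL (\<lambda>x. concat (map (\<lambda>a. F a x) (L x)))"
proof -
  have "concat (map f xs) = lst (foldr (\<lambda>a r. enc (f a @ lst r)) xs Leaf)" for f xs
    by (induction xs) auto
  then have *: "enc (concat (map f xs)) = foldr (\<lambda>a r. enc (f a @ lst r)) xs Leaf" for f xs
    by (metis enc_lst)
  have "PR (\<lambda>p. Node (left p) (right (right p)))" by (intro PR_Node PR_left PR_right PR_id)
  from PR_comp[OF assms(1) this] show ?thesis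
    unfolding *
    by (intro PR_foldr[of "\<lambda>a r x. enc (F a x @ lst r)"] PRL_append PRL_lst PR_const assms PR_left PR_right PR_id) simp
qed

lemma PRb_ex:
  assumes "PRb (\<lambda>p. q (left p) (right p))" "PRL L"
  shows "PRb (\<lambda>x. \<exists>a\<in>set (L x). q a x)"
proof -
  have *: "code_bool (\<exists>a\<in>set xs. f a) = code_bool (enc (filter f xs) \<noteq> Leaf)" for f xs
    by (simp add: filter_empty_conv)
  show ?thesis
    unfolding * by (intro PRb_not PRb_eq PR_const PRL_filter assms)
qed

lemma PRb_all: "PRb (\<lambda>p. q (left p) (right p)) \<Longrightarrow> PRL L \<Longrightarrow> PRb (\<lambda>x. \<forall>a\<in>set (L x). q a x)"
  using PRb_not[OF PRb_ex[of "\<lambda>a x. \<not> q a x"]] PRb_not by simp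

lemma PRb_mem: "PR T \<Longrightarrow> PRL L \<Longrightarrow> PRb (\<lambda>x. T x \<in> set (L x))"
  using PRb_ex[of "\<lambda>a x. a = T x" L] PRb_eq[OF PR_left[OF PR_id] PR_comp[of T, OF _ PR_right[OF PR_id]]]
  by simp

lemma PRL_remdups:
  assumes "PRL L"
  shows "PRL (\<lambda>x. remdups (L x))"
proof -
  have *: "enc (remdups xs) = foldr (\<lambda>a r. if a \<in> set (lst r) then r else Node a r) xs Leaf" for xs
  proof (induction xs)
    case (Cons a xs)
    from Cons[symmetric] show ?case by simp
  qed simp
  show ?thesis
    unfolding *
    by (intro PR_foldr[of "\<lambda>a r x. if a \<in> set (lst r) then r else Node a r"] PR_ifb PRb_mem PRL_lst PR_Node
        PR_const assms PR_left PR_right PR_id)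
qed

lemmas PR_intros = PR_id PR_const PR_left PR_right PR_Node PR_ifb PRb_eq PRb_True PRb_False
  PRb_not PRb_conj PRb_disj PRb_imp PRL_Nil PRL_lst PRL_Cons PRL_if PRL_append PRL_map PRL_filter
  PRL_concat_map PRb_ex PRb_all PRb_mem PRL_remdups PR_foldr

lemma PR_let3:
  assumes "PR (\<lambda>z. F (left z) (left (right z)) (right (right z)))" "PR A" "PR B" "PR C"
  shows "PR (\<lambda>x. F (A x) (B x) (C x))"
  using PR_comp[OF assms(1) PR_Node[OF assms(2) PR_Node[OF assms(3,4)]]] by simp

section \<open>Binary numbers\<close>

lemma left_code_nat [simp]: "left (code_nat n) = code_bool (odd n)"
  by (subst code_nat.simps) (auto simp: code_bool_def)

lemma right_code_nat [simp]: "right (code_nat n) = code_nat (n div 2)"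
  by (subst code_nat.simps) (auto simp: code_nat.simps[of 0])

lemma code_nat_0 [simp]: "code_nat 0 = Leaf"
  by (simp add: code_nat.simps)

lemma code_nat_eq_Leaf [simp]: "code_nat n = Leaf \<longleftrightarrow> n = 0" "Leaf = code_nat n \<longleftrightarrow> n = 0"
  by (subst code_nat.simps; simp)+

lemma code_nat_pos: "0 < n \<Longrightarrow> code_nat n = Node (code_bool (odd n)) (code_nat (n div 2))"
  by (subst code_nat.simps) simp

lemma code_bool_inject [simp]: "code_bool a = code_bool b \<longleftrightarrow> a = b"
  by (simp add: code_bool_def)

lemma inj_code_nat: "inj code_nat"
proof (rule injI)
  show "code_nat m = code_nat n \<Longrightarrow> m = n" for m n
  proof (induction m arbitrary: n rule: less_induct)
    case (less m)
    show ?case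
    proof (cases "m = 0")
      case True then show ?thesis using less.prems by (metis code_nat_eq_Leaf)
    next
      case False
      then have "n \<noteq> 0" using less.prems by (metis code_nat_eq_Leaf)
      moreover have "odd m = odd n" using less.prems by (metis left_code_nat code_bool_inject)
      moreover have "m div 2 = n div 2"
        using less.IH[of "m div 2" "n div 2"] less.prems False by (metis right_code_nat div_less_dividend gr0I one_less_numeral_iff semiring_norm(76))
      ultimately show ?thesis by (metis odd_two_times_div_two_succ dvd_mult_div_cancel)
    qed
  qed
qed

lemma code_nat_inject [simp]: "code_nat m = code_nat n \<longleftrightarrow> m = n"
  using inj_code_nat by (auto dest: injD)

definition bit_sum :: "tree \<Rightarrow> tree \<Rightarrow> tree \<Rightarrow> bool" where
  "bit_sum c a b \<longleftrightarrow> (if c \<noteq> Leaf then if a \<noteq> Leaf then b \<noteq> Leaf else b = Leaf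
     else if a \<noteq> Leaf then b = Leaf else b \<noteq> Leaf)"

definition bit_carry :: "tree \<Rightarrow> tree \<Rightarrow> tree \<Rightarrow> bool" where
  "bit_carry c a b \<longleftrightarrow> (if c \<noteq> Leaf then if a \<noteq> Leaf then True else b \<noteq> Leaf
     else if a \<noteq> Leaf then b \<noteq> Leaf else False)"

text \<open>Ripple-carry addition from the least significant bit on. It continues while either
  operand has bits left; since \<open>left Leaf = Leaf\<close>, an exhausted operand supplies
  zeros.\<close>

function add_tree :: "tree \<Rightarrow> tree \<Rightarrow> tree \<Rightarrow> tree" where
  "add_tree c a b = (if a = Leaf \<and> b = Leaf then if c \<noteq> Leaf then Node (Node Leaf Leaf) Leaf else Leaf
     else Node (code_bool (bit_sum c (left a) (left b)))
       (add_tree (code_bool (bit_carry c (left a) (left b))) (right a) (right b)))"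
  by auto
termination
proof (relation "measure (\<lambda>(c, a, b). size a + size b)")
  fix c a b :: tree
  assume "\<not> (a = Leaf \<and> b = Leaf)"
  then show "((code_bool (bit_carry c (left a) (left b)), right a, right b), c, a, b)
      \<in> measure (\<lambda>(c, a, b). size a + size b)"
    by (cases a; cases b) auto
qed simp

declare add_tree.simps [simp del]

lemma add_tree_code_nat:
  "add_tree (code_bool c) (code_nat m) (code_nat n) = code_nat (m + n + of_bool c)"
proof (induction "m + n" arbitrary: c m n rule: less_induct)
  case less
  show ?case
  proof (cases "m = 0 \<and> n = 0")
    case True
    then show ?thesis by (simp add: add_tree.simps[of _ Leaf Leaf] code_nat_pos code_bool_def)
  next
    case False
    then have "m div 2 + n div 2 < m + n" by linarith
    note IH = less[OF this]
    define d where "d = bit_carry (code_bool c) (code_bool (odd m)) (code_bool (odd n))"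
    have d: "(m + n + of_bool c) div 2 = m div 2 + n div 2 + of_bool d"
      unfolding d_def bit_carry_def by (cases "odd m"; cases "odd n"; cases c) (auto elim!: oddE evenE)
    have s: "odd (m + n + of_bool c) = bit_sum (code_bool c) (code_bool (odd m)) (code_bool (odd n))"
      unfolding bit_sum_def by (cases "odd m"; cases "odd n"; cases c) auto
    have "0 < m + n + of_bool c" using False by auto
    from code_nat_pos[OF this] have "code_nat (m + n + of_bool c)
        = Node (code_bool (odd (m + n + of_bool c))) (code_nat (m div 2 + n div 2 + of_bool d))"
      unfolding d .
    then show ?thesis
      unfolding s using False IH[of d] by (subst add_tree.simps) (auto simp: d_def[symmetric])
  qed
qed

definition add_args :: "tree \<Rightarrow> tree" where
  "add_args x = add_tree (left x) (left (right x)) (right (right x))"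

definition add_more :: "tree \<Rightarrow> tree" where
  "add_more x = (if left (right x) \<noteq> Leaf then left (right x) else right (right x))"

definition add_next :: "tree \<Rightarrow> tree" where
  "add_next x = Node (code_bool (bit_carry (left x) (left (left (right x))) (left (right (right x)))))
     (Node (right (left (right x))) (right (right (right x))))"

definition add_step :: "tree \<Rightarrow> tree" where
  "add_step z = Node (code_bool (bit_sum (left (left z)) (left (left (right (left z))))
     (left (right (right (left z)))))) (right z)"

definition add_end :: "tree \<Rightarrow> tree" where
  "add_end x = (if left x \<noteq> Leaf then Node (Node Leaf Leaf) Leaf else Leaf)"

lemma add_args_rec:
  "add_args x = (if add_more x \<noteq> Leaf then add_step (Node x (add_args (add_next x))) else add_end x)"
  unfolding add_args_def add_more_def add_step_def add_end_def add_next_def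
  by (subst add_tree.simps) auto

lemma add_next_dec:
  "add_more x \<noteq> Leaf \<Longrightarrow> size (left (right (add_next x))) + size (right (right (add_next x)))
      < size (left (right x)) + size (right (right x))"
  unfolding add_more_def add_next_def by (cases "left (right x)"; cases "right (right x)") auto

lemma size_left_right: "size (left x) + size (right x) \<le> size x"
  by (cases x) auto

lemma PR_add_args: "PR add_args"
proof (rule PR_rec[where f = add_args and P = add_more and G = add_next and H = add_step and Z = add_end
      and m = "\<lambda>x. size (left (right x)) + size (right (right x))"])
  show "add_args x = (if add_more x \<noteq> Leaf then add_step (Node x (add_args (add_next x))) else add_end x)"
    for x by (rule add_args_rec)
  show "size (left (right (add_next x))) + size (right (right (add_next x)))
      < size (left (right x)) + size (right (right x))" if "add_more x \<noteq> Leaf" for x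
    using that by (rule add_next_dec)
  show "PR add_more" "PR add_next" "PR add_step" "PR add_end"
    unfolding add_more_def add_next_def add_step_def add_end_def bit_sum_def bit_carry_def
    by (intro PR_intros PRb_if)+
  show "size (left (right x)) + size (right (right x)) \<le> size x" for x
    using size_left_right[of "right x"] size_right_le[of x] by linarith
qed

lemmas PR_add = PR_let3[of add_tree, OF PR_add_args[unfolded add_args_def]]

definition inc :: "tree \<Rightarrow> tree" where
  "inc t = add_tree (code_bool True) t Leaf"

lemma PR_inc: "PR T \<Longrightarrow> PR (\<lambda>x. inc (T x))"
  unfolding inc_def by (intro PR_add PR_const)

lemma inc_code_nat [simp]: "inc (code_nat n) = code_nat (Suc n)"
  using add_tree_code_nat[of True n 0] by (simp add: inc_def)

text \<open>Horner's rule: \<open>foldr\<close> treats the most significant bit first, and each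
  further bit doubles the value obtained so far.\<close>

definition bin_to_un :: "tree \<Rightarrow> tree" where
  "bin_to_un t = foldr (\<lambda>b r. enc ((if b \<noteq> Leaf then [Leaf] else []) @ lst r @ lst r)) (lst t) Leaf"

lemma PR_bin_to_un: "PR T \<Longrightarrow> PR (\<lambda>x. bin_to_un (T x))"
  unfolding bin_to_un_def by (intro PR_intros)

lemma bin_to_un_code_nat [simp]: "bin_to_un (code_nat n) = un n"
proof (induction n rule: less_induct)
  case (less n)
  show ?case
  proof (cases "n = 0")
    case True
    then show ?thesis by (simp add: bin_to_un_def)
  next
    case False
    have "bin_to_un (code_nat n) = enc ((if odd n then [Leaf] else []) @ lst (un (n div 2)) @ lst (un (n div 2)))"
      using less[of "n div 2"] False by (simp add: bin_to_un_def code_nat_pos)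
    also have "\<dots> = un ((if odd n then 1 else 0) + (n div 2 + n div 2))"
      by (simp add: un_def replicate_add)
    also have "(if odd n then 1 else 0) + (n div 2 + n div 2) = n" by presburger
    finally show ?thesis .
  qed
qed

text \<open>The list is descending because every new head is the successor of the previous
  one.\<close>

definition vars :: "tree \<Rightarrow> tree" where
  "vars t = foldr (\<lambda>_ r. Node (if r = Leaf then Leaf else inc (left r)) r) (lst (bin_to_un t)) Leaf"

lemma PR_vars: "PR T \<Longrightarrow> PR (\<lambda>x. vars (T x))"
  unfolding vars_def by (intro PR_intros PR_bin_to_un PR_inc)

lemma vars_code_nat [simp]: "vars (code_nat n) = enc (map code_nat (rev [0..<n]))"
proof -
  have "foldr (\<lambda>_ r. Node (if r = Leaf then Leaf else inc (left r)) r) (replicate n Leaf) Leaf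
      = enc (map code_nat (rev [0..<n]))"
  proof (induction n)
    case (Suc n)
    then show ?case using inc_code_nat[of 0] by (cases n) auto
  qed simp
  then show ?thesis by (simp add: vars_def)
qed

definition un_to_bin :: "tree \<Rightarrow> tree" where
  "un_to_bin t = foldr (\<lambda>_ r. inc r) (lst t) Leaf"

lemma PR_un_to_bin: "PR T \<Longrightarrow> PR (\<lambda>x. un_to_bin (T x))"
  unfolding un_to_bin_def by (intro PR_intros PR_inc)

lemma un_to_bin_un [simp]: "un_to_bin (un n) = code_nat n"
  unfolding un_to_bin_def by (induction n) simp_all

text \<open>All bounds are functions of the size of the coded parameters, so the program computing
  \<open>f\<close> begins by measuring its input.\<close>

definition size_un :: "tree \<Rightarrow> tree" where
  "size_un t = un (size t)"

lemma PR_size_un: "PR size_un"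
proof (rule PR_dc[where m = size and G = "\<lambda>x. if x \<noteq> Leaf then enc [left x, right x] else Leaf"
      and H = "\<lambda>z. if left z = Leaf then Leaf
        else Node Leaf (enc (lst (right (left (right z))) @ lst (right (left (right (right z))))))"])
  show "size_un x = (\<lambda>z. if left z = Leaf then Leaf
        else Node Leaf (enc (lst (right (left (right z))) @ lst (right (left (right (right z)))))))
     (Node x (enc (map (\<lambda>y. Node y (size_un y)) (lst (if x \<noteq> Leaf then enc [left x, right x] else Leaf)))))"
    for x
    by (cases x) (simp_all add: size_un_def un_def replicate_add)
qed (auto intro!: PR_intros size_left_less size_right_less simp del: code_list.simps split: if_splits)

section \<open>The automaton of a formula\<close>

definition layer_right :: "tree \<Rightarrow> tree" where "layer_right B = left (right B)"
definition layer_trans :: "tree \<Rightarrow> tree" where "layer_trans B = left (right (right B))"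
definition layer_init :: "tree \<Rightarrow> tree" where "layer_init B = left (right (right (right B)))"
definition layer_fin :: "tree \<Rightarrow> tree" where "layer_fin B = left (right (right (right (right B))))"
definition layer_iflag :: "tree \<Rightarrow> tree" where
  "layer_iflag B = left (right (right (right (right (right B)))))"
definition layer_fflag :: "tree \<Rightarrow> tree" where
  "layer_fflag B = left (right (right (right (right (right (right B))))))"

lemmas layer_defs = layer_right_def layer_trans_def layer_init_def layer_fin_def layer_iflag_def
  layer_fflag_def

text \<open>A step of the subset construction. In the first layer the initial states take the place
  of \<open>R\<close>, so one start state serves all diagrams.\<close>

definition post :: "tree \<Rightarrow> tree \<Rightarrow> tree \<Rightarrow> tree" where
  "post B R a = enc (filter (\<lambda>q. (layer_fflag B \<noteq> Leaf \<longrightarrow> q \<in> set (lst (layer_fin B))) \<and>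
     (\<exists>t\<in>set (lst (layer_trans B)).
        left t \<in> set (lst (if layer_iflag B \<noteq> Leaf then layer_init B else R)) \<and>
        left (right t) = a \<and> right (right t) = q))
     (lst (layer_right B)))"

lemma PR_post: "PR A \<Longrightarrow> PR B \<Longrightarrow> PR C \<Longrightarrow> PR (\<lambda>x. post (A x) (B x) (C x))"
  by (rule PR_let3) (unfold post_def layer_defs, intro PR_intros)

text \<open>The last symbol is remembered in order to reject tracks that are not padded nonempty
  strings: \<open>#\<close> in the first column, or a letter after \<open>#\<close>. Rejection means
  the empty set of states, from which no later layer recovers.\<close>

definition dom_step :: "tree \<Rightarrow> tree \<Rightarrow> tree \<Rightarrow> tree" where
  "dom_step B s a = Node a
     (if (if layer_iflag B \<noteq> Leaf then a \<noteq> Leaf else left s = Leaf \<longrightarrow> a = Leaf)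
      then post B (right s) a else Leaf)"

lemma PR_dom_step: "PR A \<Longrightarrow> PR B \<Longrightarrow> PR C \<Longrightarrow> PR (\<lambda>x. dom_step (A x) (B x) (C x))"
  by (rule PR_let3) (unfold dom_step_def layer_defs, intro PR_intros PR_post PRb_if)

abbreviation ctx_symbols :: "tree \<Rightarrow> tree list" where "ctx_symbols ctx \<equiv> lst (left ctx)"
abbreviation ctx_dom :: "tree \<Rightarrow> tree" where "ctx_dom ctx \<equiv> left (right ctx)"
abbreviation ctx_rels :: "tree \<Rightarrow> tree" where "ctx_rels ctx \<equiv> right (right ctx)"
abbreviation ctx_first :: "tree \<Rightarrow> bool" where "ctx_first ctx \<equiv> layer_iflag (ctx_dom ctx) \<noteq> Leaf"

text \<open>A column in which all strings have ended lies beyond their tensor product. It is then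
  the padding symbol of the tensor alphabet itself, not a tuple of paddings.\<close>

definition tuple_symbol :: "tree list \<Rightarrow> tree" where
  "tuple_symbol as = (if \<forall>a\<in>set as. a = Leaf then Leaf else Node Leaf (enc as))"

text \<open>Before the first layer the state is \<open>Leaf\<close>, which would read as the empty
  set; the pair of the two start states is substituted there.\<close>

definition quant_states :: "tree \<Rightarrow> tree \<Rightarrow> tree list" where
  "quant_states ctx q = (if ctx_first ctx then [Node Leaf Leaf] else lst (right q))"

definition ex_bit :: "tree list \<Rightarrow> tree" where
  "ex_bit S = code_bool (\<exists>p\<in>set S. right (right p) \<noteq> Leaf \<and> left (left p) \<noteq> Leaf)"

text \<open>Every track leads to exactly one pair, since the automaton of the body is deterministic.
  Hence universality is read off the same set as existence.\<close>

definition all_bit :: "tree list \<Rightarrow> tree" where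
  "all_bit S = code_bool (\<forall>p\<in>set S. right (right p) \<noteq> Leaf \<longrightarrow> left (left p) \<noteq> Leaf)"

text \<open>
  A state is \<^term>\<open>Node b s\<close> with an acceptance bit \<open>b\<close> (accepting iff it is not \<^term>\<open>Leaf\<close>), and
  \<^term>\<open>Leaf\<close> is the state of every formula before the first layer, where the selectors return
  \<^term>\<open>Leaf\<close> for the subformulas as well.
\<close>

primrec delta :: "fm \<Rightarrow> tree \<Rightarrow> (nat \<Rightarrow> tree) \<Rightarrow> tree \<Rightarrow> tree" where
  "delta (Eq x y) q c ctx = Node (code_bool ((ctx_first ctx \<or> left q \<noteq> Leaf) \<and> c x = c y)) Leaf"
| "delta (Rel i xs) q c ctx =
     (let R = post (left ((right ^^ i) (ctx_rels ctx))) (right q) (tuple_symbol (map c xs)) in Node R R)"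
| "delta (Neg \<phi>) q c ctx =
     (let r = delta \<phi> (right q) c ctx in Node (code_bool (left r = Leaf)) r)"
| "delta (And \<phi> \<psi>) q c ctx =
     (let r = delta \<phi> (left (right q)) c ctx; s = delta \<psi> (right (right q)) c ctx
      in Node (code_bool (left r \<noteq> Leaf \<and> left s \<noteq> Leaf)) (Node r s))"
| "delta (Or \<phi> \<psi>) q c ctx =
     (let r = delta \<phi> (left (right q)) c ctx; s = delta \<psi> (right (right q)) c ctx
      in Node (code_bool (left r \<noteq> Leaf \<or> left s \<noteq> Leaf)) (Node r s))"
| "delta (Exists x \<phi>) q c ctx =
     (let S = remdups (concat (map (\<lambda>p. map (\<lambda>a. Node (delta \<phi> (left p) (c(x := a)) ctx)
          (dom_step (ctx_dom ctx) (right p) a)) (ctx_symbols ctx)) (quant_states ctx q)))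
      in Node (ex_bit S) (enc S))"
| "delta (Forall x \<phi>) q c ctx =
     (let S = remdups (concat (map (\<lambda>p. map (\<lambda>a. Node (delta \<phi> (left p) (c(x := a)) ctx)
          (dom_step (ctx_dom ctx) (right p) a)) (ctx_symbols ctx)) (quant_states ctx q)))
      in Node (all_bit S) (enc S))"

text \<open>The first entry wins, so a quantifier overrides a variable by prepending an entry to the
  column.\<close>

definition look :: "tree \<Rightarrow> tree \<Rightarrow> tree" where
  "look v col = foldr (\<lambda>e r. if left e = v then right e else r) (lst col) Leaf"

lemma PR_look: "PR A \<Longrightarrow> PR B \<Longrightarrow> PR (\<lambda>x. look (A x) (B x))"
  by (rule PR_let) (unfold look_def, intro PR_intros)

lemma look_Node [simp]: "look v (Node e col) = (if left e = v then right e else look v col)"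
  by (simp add: look_def)

lemma look_Leaf [simp]: "look v Leaf = Leaf"
  by (simp add: look_def)

definition nth_tree :: "tree \<Rightarrow> tree \<Rightarrow> tree" where
  "nth_tree i t = left (foldr (\<lambda>_ r. right r) (lst (bin_to_un i)) t)"

lemma PR_nth_tree: "PR A \<Longrightarrow> PR B \<Longrightarrow> PR (\<lambda>x. nth_tree (A x) (B x))"
  by (rule PR_let) (unfold nth_tree_def, intro PR_intros PR_bin_to_un)

lemma nth_tree_code_nat [simp]: "nth_tree (code_nat i) t = left ((right ^^ i) t)"
proof -
  have "foldr (\<lambda>_. right) (replicate i Leaf) t = (right ^^ i) t" by (induction i) auto
  then show ?thesis by (simp add: nth_tree_def)
qed

text \<open>
  The transition function on coded formulas by divide and conquer. The last component of an argument
  is ignored by the function and carries the state of the domain automaton through a recursive call.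
\<close>

definition delta_arg :: "tree \<Rightarrow> tree \<Rightarrow> tree \<Rightarrow> tree \<Rightarrow> tree \<Rightarrow> tree" where
  "delta_arg t q col ctx s = Node t (Node q (Node col (Node ctx s)))"

definition arg_fm :: "tree \<Rightarrow> tree" where "arg_fm x = left x"
definition arg_state :: "tree \<Rightarrow> tree" where "arg_state x = left (right x)"
definition arg_col :: "tree \<Rightarrow> tree" where "arg_col x = left (right (right x))"
definition arg_ctx :: "tree \<Rightarrow> tree" where "arg_ctx x = left (right (right (right x)))"
definition arg_dom :: "tree \<Rightarrow> tree" where "arg_dom x = right (right (right (right x)))"

lemmas arg_defs = arg_fm_def arg_state_def arg_col_def arg_ctx_def arg_dom_def

lemma arg_simps [simp]:
  "arg_fm (delta_arg t q col ctx s) = t" "arg_state (delta_arg t q col ctx s) = q"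
  "arg_col (delta_arg t q col ctx s) = col" "arg_ctx (delta_arg t q col ctx s) = ctx"
  "arg_dom (delta_arg t q col ctx s) = s"
  by (simp_all add: arg_defs delta_arg_def)

definition delta_calls :: "tree \<Rightarrow> tree" where
  "delta_calls x = (let t = arg_fm x; q = arg_state x; col = arg_col x; ctx = arg_ctx x in
     enc (if left t = code_nat 2 then [delta_arg (right t) (right q) col ctx Leaf]
       else if left t = code_nat 3 \<or> left t = code_nat 4
       then [delta_arg (left (right t)) (left (right q)) col ctx Leaf,
             delta_arg (right (right t)) (right (right q)) col ctx Leaf]
       else if left t = code_nat 5 \<or> left t = code_nat 6
       then concat (map (\<lambda>p. map (\<lambda>a. delta_arg (right (right t)) (left p) (Node (Node (left (right t)) a) col)
           ctx (dom_step (ctx_dom ctx) (right p) a)) (ctx_symbols ctx)) (quant_states ctx q))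
       else []))"

definition delta_combine :: "tree \<Rightarrow> tree" where
  "delta_combine z = (let x = left z; t = arg_fm x; q = arg_state x; col = arg_col x; ctx = arg_ctx x;
       r = right (left (right z)); s = right (left (right (right z))) in
     if left t = Leaf
     then Node (code_bool ((ctx_first ctx \<or> left q \<noteq> Leaf) \<and>
        look (left (right t)) col = look (right (right t)) col)) Leaf
     else if left t = code_nat 1
     then (\<lambda>R. Node R R) (post (nth_tree (left (right t)) (ctx_rels ctx)) (right q)
       (tuple_symbol (map (\<lambda>v. look v col) (lst (right (right t))))))
     else if left t = code_nat 2 then Node (code_bool (left r = Leaf)) r
     else if left t = code_nat 3 then Node (code_bool (left r \<noteq> Leaf \<and> left s \<noteq> Leaf)) (Node r s)
     else if left t = code_nat 4 then Node (code_bool (left r \<noteq> Leaf \<or> left s \<noteq> Leaf)) (Node r s)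
     else (\<lambda>S. Node (if left t = code_nat 5 then ex_bit (lst S) else all_bit (lst S)) S)
       (enc (remdups (map (\<lambda>y. Node (right y) (arg_dom (left y))) (lst (right z))))))"

lemma PR_delta_calls: "PR delta_calls"
  unfolding delta_calls_def Let_def quant_states_def delta_arg_def arg_defs layer_defs
  by (intro PR_intros PR_dom_step)

lemma PR_tuple_symbol: "PRL L \<Longrightarrow> PR (\<lambda>x. tuple_symbol (L x))"
  using PR_comp[of "\<lambda>z. tuple_symbol (lst z)" "\<lambda>x. enc (L x)"] unfolding tuple_symbol_def
  by (intro PR_intros)

lemma PR_delta_combine: "PR delta_combine"
  unfolding delta_combine_def Let_def arg_defs layer_defs ex_bit_def all_bit_def
  by (intro PR_intros PR_post PR_nth_tree PR_tuple_symbol PR_look)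

text \<open>Divide and conquer with explicit fuel is total for arbitrary \<open>G\<close> and
  \<open>H\<close>. By \<open>dcn_fuel\<close> the fuel is irrelevant once it exceeds a decreasing
  measure.\<close>

primrec dcn :: "(tree \<Rightarrow> tree) \<Rightarrow> (tree \<Rightarrow> tree) \<Rightarrow> nat \<Rightarrow> tree \<Rightarrow> tree" where
  "dcn G H 0 x = Leaf"
| "dcn G H (Suc d) x = H (Node x (enc (map (\<lambda>y. Node y (dcn G H d y)) (lst (G x)))))"

lemma dcn_fuel:
  assumes "\<And>x y. y \<in> set (lst (G x)) \<Longrightarrow> m y < (m x :: nat)"
  shows "m x < d \<Longrightarrow> m x < e \<Longrightarrow> dcn G H d x = dcn G H e x"
proof (induction d arbitrary: x e)
  case (Suc d)
  then obtain e' where e: "e = Suc e'" by (cases e) auto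
  have "map (\<lambda>y. Node y (dcn G H d y)) (lst (G x)) = map (\<lambda>y. Node y (dcn G H e' y)) (lst (G x))"
  proof (rule map_cong)
    fix y assume "y \<in> set (lst (G x))"
    then have "m y < m x" by (rule assms)
    then show "Node y (dcn G H d y) = Node y (dcn G H e' y)"
      using Suc.prems by (simp add: Suc.IH[of y e'] e)
  qed simp
  then show ?case by (simp only: e dcn.simps)
qed simp

definition delta_tree :: "tree \<Rightarrow> tree" where
  "delta_tree x = dcn delta_calls delta_combine (Suc (size (arg_fm x))) x"

text \<open>A recursive call occurs only under a nonzero tag, so the formula component loses at
  least the node carrying the tag. This must hold for all trees, also for those that code no
  formula, because \<open>PR_dc\<close> asks for it.\<close>

lemma delta_calls_dec: "y \<in> set (lst (delta_calls x)) \<Longrightarrow> size (arg_fm y) < size (arg_fm x)"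
proof -
  assume y: "y \<in> set (lst (delta_calls x))"
  consider "left (arg_fm x) = code_nat 2"
    | "left (arg_fm x) \<noteq> code_nat 2" "left (arg_fm x) = code_nat 3 \<or> left (arg_fm x) = code_nat 4"
    | "left (arg_fm x) \<noteq> code_nat 2" "\<not> (left (arg_fm x) = code_nat 3 \<or> left (arg_fm x) = code_nat 4)"
      "left (arg_fm x) = code_nat 5 \<or> left (arg_fm x) = code_nat 6"
    | "left (arg_fm x) \<noteq> code_nat 2" "\<not> (left (arg_fm x) = code_nat 3 \<or> left (arg_fm x) = code_nat 4)"
      "\<not> (left (arg_fm x) = code_nat 5 \<or> left (arg_fm x) = code_nat 6)"
    by argo
  then have "left (arg_fm x) \<noteq> Leaf \<and> (arg_fm y = right (arg_fm x) \<or>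
      arg_fm y = left (right (arg_fm x)) \<or> arg_fm y = right (right (arg_fm x)))"
  proof cases
    case 1
    then show ?thesis using y by (simp add: delta_calls_def)
  next
    case 2
    then have "left (arg_fm x) \<noteq> Leaf" by (metis code_nat_eq_Leaf(1) zero_neq_numeral)
    moreover have "arg_fm y = left (right (arg_fm x)) \<or> arg_fm y = right (right (arg_fm x))"
      using y unfolding delta_calls_def Let_def if_not_P[OF 2(1)] if_P[OF 2(2)] lst_enc by auto
    ultimately show ?thesis by blast
  next
    case 3
    then have "left (arg_fm x) \<noteq> Leaf" by (metis code_nat_eq_Leaf(1) zero_neq_numeral)
    moreover have "arg_fm y = right (right (arg_fm x))"
      using y unfolding delta_calls_def Let_def if_not_P[OF 3(1)] if_not_P[OF 3(2)] if_P[OF 3(3)] lst_enc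
      by (auto simp del: code_list.simps)
    ultimately show ?thesis by blast
  next
    case 4
    have False
      using y unfolding delta_calls_def Let_def if_not_P[OF 4(1)] if_not_P[OF 4(2)] if_not_P[OF 4(3)] by simp
    then show ?thesis ..
  qed
  then have "left (arg_fm x) \<noteq> Leaf" and y: "arg_fm y = right (arg_fm x) \<or>
      arg_fm y = left (right (arg_fm x)) \<or> arg_fm y = right (right (arg_fm x))" by blast+
  then have "size (right (arg_fm x)) < size (arg_fm x)"
    by (intro size_right_less) auto
  then show "size (arg_fm y) < size (arg_fm x)"
    using y size_left_le[of "right (arg_fm x)"] size_right_le[of "right (arg_fm x)"] by auto
qed

lemma delta_tree_rec:
  "delta_tree x = delta_combine (Node x (enc (map (\<lambda>y. Node y (delta_tree y)) (lst (delta_calls x)))))"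
proof -
  have "dcn delta_calls delta_combine (size (arg_fm x)) y = delta_tree y" if "y \<in> set (lst (delta_calls x))" for y
    unfolding delta_tree_def using delta_calls_dec[OF that]
    by (intro dcn_fuel[where m = "\<lambda>x. size (arg_fm x)"]) (simp_all add: delta_calls_dec)
  then have "map (\<lambda>y. Node y (dcn delta_calls delta_combine (size (arg_fm x)) y)) (lst (delta_calls x))
      = map (\<lambda>y. Node y (delta_tree y)) (lst (delta_calls x))" by simp
  then show ?thesis unfolding delta_tree_def[of x] by (simp only: dcn.simps)
qed

lemma PR_delta_tree: "PR delta_tree"
  by (rule PR_dc[OF PR_delta_calls PR_delta_combine delta_tree_rec delta_calls_dec])
    (auto simp: arg_fm_def size_left_le)

lemma delta_tree:
  "delta_tree (delta_arg (code_fm \<phi>) q col ctx s) = delta \<phi> q (\<lambda>x. look (code_nat x) col) ctx"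
proof (induction \<phi> arbitrary: q col s)
  case (Eq x y)
  show ?case by (subst delta_tree_rec) (simp add: delta_combine_def)
next
  case (Rel i xs)
  show ?case by (subst delta_tree_rec) (simp add: delta_combine_def code_list_enc[of code_nat] comp_def Let_def)
next
  case (Neg \<phi>)
  show ?case by (subst delta_tree_rec) (simp add: delta_combine_def delta_calls_def Neg)
next
  case (And \<phi> \<psi>)
  show ?case by (subst delta_tree_rec) (simp add: delta_combine_def delta_calls_def And)
next
  case (Or \<phi> \<psi>)
  show ?case by (subst delta_tree_rec) (simp add: delta_combine_def delta_calls_def Or)
next
  case (Exists x \<phi>)
  have "(\<lambda>y. if x = y then a else look (code_nat y) col) = (\<lambda>x. look (code_nat x) col)(x := a)" for a
    by auto
  then show ?case by (subst delta_tree_rec) (simp add: delta_combine_def delta_calls_def Exists map_concat comp_def Let_def)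
next
  case (Forall x \<phi>)
  have "(\<lambda>y. if x = y then a else look (code_nat y) col) = (\<lambda>x. look (code_nat x) col)(x := a)" for a
    by auto
  then show ?case by (subst delta_tree_rec) (simp add: delta_combine_def delta_calls_def Forall map_concat comp_def Let_def)
qed

section \<open>The counting loop\<close>

definition CC :: "(tree \<Rightarrow> tree) \<Rightarrow> bool" where
  "CC F \<longleftrightarrow> (\<exists>K. CT F (\<lambda>_. K))"

abbreviation "CCb p \<equiv> CC (\<lambda>x. code_bool (p x))"

lemma CC_id: "CC (\<lambda>x. x)" and CC_Leaf: "CC (\<lambda>_. Leaf)"
  unfolding CC_def by (blast intro: CT_id CT_Leaf)+

lemma CC_left: "CC F \<Longrightarrow> CC (\<lambda>x. left (F x))" and CC_right: "CC F \<Longrightarrow> CC (\<lambda>x. right (F x))"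
  unfolding CC_def by (erule exE, rule exI, erule CT_left) (erule exE, rule exI, erule CT_right)

lemma CC_Node: "CC F \<Longrightarrow> CC G \<Longrightarrow> CC (\<lambda>x. Node (F x) (G x))"
  unfolding CC_def by (elim exE, rule exI, rule CT_Node)

lemma CC_const: "CC (\<lambda>_. c)"
  by (induction c) (auto intro: CC_Leaf CC_Node)

lemma CC_if: assumes "CC P" "CC F" "CC G" shows "CC (\<lambda>x. if P x \<noteq> Leaf then F x else G x)"
proof -
  obtain a b c where "CT P (\<lambda>_. a)" "CT F (\<lambda>_. b)" "CT G (\<lambda>_. c)"
    using assms unfolding CC_def by blast
  then have "CT (\<lambda>x. if P x \<noteq> Leaf then F x else G x) (\<lambda>_. a + b + c + 1)"
    by (rule CT_mono[OF CT_if]) auto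
  then show ?thesis unfolding CC_def ..
qed

lemma CC_ifb: "CCb p \<Longrightarrow> CC F \<Longrightarrow> CC G \<Longrightarrow> CC (\<lambda>x. if p x then F x else G x)"
  using CC_if[of "\<lambda>x. code_bool (p x)" F G] by simp

lemma CCb_if: "CCb p \<Longrightarrow> CCb q \<Longrightarrow> CCb r \<Longrightarrow> CCb (\<lambda>x. if p x then q x else r x)"
  using CC_ifb[of p "\<lambda>x. code_bool (q x)" "\<lambda>x. code_bool (r x)"]
  by (simp add: if_distrib[of code_bool])

lemma CCb_ne: "CC F \<Longrightarrow> CCb (\<lambda>x. F x \<noteq> Leaf)" and CCb_eq: "CC F \<Longrightarrow> CCb (\<lambda>x. F x = Leaf)"
proof -
  assume F: "CC F"
  have eq: "code_bool (t \<noteq> Leaf) = (if t \<noteq> Leaf then Node Leaf Leaf else Leaf)"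
    "code_bool (t = Leaf) = (if t \<noteq> Leaf then Leaf else Node Leaf Leaf)" for t
    by (simp_all add: code_bool_def)
  show "CCb (\<lambda>x. F x \<noteq> Leaf)" "CCb (\<lambda>x. F x = Leaf)"
    unfolding eq by (intro CC_if F CC_const)+
qed

lemmas CC_intros = CC_id CC_const CC_left CC_right CC_Node CC_ifb CCb_if CCb_ne CCb_eq

text \<open>The measure for everything kept in a list: bits of a number, rows of a table, layers of
  a diagram.\<close>

abbreviation len :: "tree \<Rightarrow> nat" where "len t \<equiv> length (lst t)"

lemma len_right: "t \<noteq> Leaf \<Longrightarrow> len t = Suc (len (right t))"
  by (cases t) auto

text \<open>Each round removes a bit from at least one operand and does constant work.\<close>

lemma CT_add:
  obtains K where "CT add_args (\<lambda>x. K * (len (left (right x)) + len (right (right x)) + 1))"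
proof -
  have "CC add_more" "CC add_next" "CC add_step" "CC add_end"
    unfolding add_more_def add_next_def add_step_def add_end_def bit_sum_def bit_carry_def
    by (intro CC_intros)+
  then obtain p g h z where CT: "CT add_more (\<lambda>_. p)" "CT add_next (\<lambda>_. g)" "CT add_step (\<lambda>_. h)"
      "CT add_end (\<lambda>_. z)"
    unfolding CC_def by blast
  define L where "L x = len (left (right x)) + len (right (right x))" for x
  define K where "K = p + g + h + z + 6"
  have L: "Suc (L (add_next x)) \<le> L x" if "add_more x \<noteq> Leaf" for x
    using that unfolding L_def add_next_def add_more_def
    by (cases "left (right x)"; cases "right (right x)") auto
  have "CT add_args (\<lambda>x. K * (L x + 1) + 2)"
  proof (rule CT_rec[OF CT, where m = L])
    show "L (add_next x) < L x" if "add_more x \<noteq> Leaf" for x using L[OF that] by simp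
    show "p + (if add_more x \<noteq> Leaf then g + h + K * (L (add_next x) + 1) + 5 else z + 1) \<le> K * (L x + 1)" for x
    proof (cases "add_more x = Leaf")
      case False
      have "K * (L (add_next x) + 1) + K \<le> K * (L x + 1)"
        using mult_le_mono2[OF L[OF False], of K] by simp
      then show ?thesis using False by (simp add: K_def)
    qed (simp add: K_def)
  qed (rule add_args_rec)
  then have "CT add_args (\<lambda>x. (K + 2) * (L x + 1))"
    by (rule CT_mono) (simp add: algebra_simps)
  then show ?thesis unfolding L_def by (rule that)
qed

lemma len_add_tree: "len (add_tree c a b) \<le> max (len a) (len b) + 1"
proof (induction c a b rule: add_tree.induct)
  case (1 c a b)
  show ?case
  proof (cases "a = Leaf \<and> b = Leaf")
    case True
    then show ?thesis by (subst add_tree.simps) simp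
  next
    case False
    then have "max (len (right a)) (len (right b)) + 1 \<le> max (len a) (len b)"
      by (cases a; cases b) auto
    moreover have "len (add_tree c a b) = Suc (len (add_tree (code_bool (bit_carry c (left a) (left b))) (right a) (right b)))"
      using False by (subst add_tree.simps) auto
    ultimately show ?thesis using 1[OF False] by linarith
  qed
qed

section \<open>Inserting weighted states into a table\<close>

text \<open>\<open>N\<close> will depend on the parameters only, whereas \<open>\<beta>\<close>
  grows with the processed layers. The costs up to the loop all have the shape
  \<open>b N * (\<beta> + 1)\<close>, linear in the number of bits.\<close>

definition bounded_table :: "nat \<Rightarrow> nat \<Rightarrow> tree \<Rightarrow> bool" where
  "bounded_table N \<beta> t \<longleftrightarrow> len t \<le> N \<and> (\<forall>e\<in>set (lst t). size (left e) \<le> N \<and> len (right e) \<le> \<beta>)"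

fun insert_count :: "tree \<Rightarrow> tree \<Rightarrow> tree \<Rightarrow> tree" where
  "insert_count q c Leaf = Node (Node q c) Leaf"
| "insert_count q c (Node e t) = (if left e = q then Node (Node q (add_tree Leaf c (right e))) t
     else Node e (insert_count q c t))"

definition insert_args :: "tree \<Rightarrow> tree" where
  "insert_args x = insert_count (left (left x)) (right (left x)) (right x)"

lemma CT_insert:
  obtains C b where "ub b" "CT insert_args C"
    "\<And>q c t N \<beta>. size q \<le> N \<Longrightarrow> len c \<le> \<beta> \<Longrightarrow> bounded_table N \<beta> t \<Longrightarrow>
      C (Node (Node q c) t) \<le> b N * (\<beta> + 1)"
proof -
  obtain e where e: "ub e" "CT eq_pair (\<lambda>x. e (size x))" using PR_obtain[OF PR_eq_pair] by metis
  obtain a where a: "CT add_args (\<lambda>x. a * (len (left (right x)) + len (right (right x)) + 1))"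
    using CT_add .
  define M where "M x = (if right x \<noteq> Leaf
      then (if eq_pair (Node (left (left (right x))) (left (left x))) \<noteq> Leaf then Leaf else Node Leaf Leaf)
      else Leaf)" for x
  define H where "H z = Node (left (right (left z))) (right z)" for z
  define G where "G x = Node (left x) (right (right x))" for x
  define E where "E x = (if right x \<noteq> Leaf
      then Node (Node (left (left x)) (add_args (Node Leaf (Node (right (left x)) (right (left (right x)))))))
         (right (right x))
      else Node (Node (left (left x)) (right (left x))) Leaf)" for x
  have CC: "CC (\<lambda>x. right x)" "CC (\<lambda>x. Node (left (left (right x))) (left (left x)))" "CC (\<lambda>_. Leaf)"
    "CC (\<lambda>_. Node Leaf Leaf)" "CC H" "CC G"
    "CC (\<lambda>x. Node Leaf (Node (right (left x)) (right (left (right x)))))"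
    "CC (\<lambda>x. left (left x))" "CC (\<lambda>x. right (right x))" "CC (\<lambda>x. Node (Node (left (left x)) (right (left x))) Leaf)"
    unfolding H_def G_def by (intro CC_intros)+
  obtain k1 k2 k3 k4 h g k5 k6 k7 k8 where k: "CT (\<lambda>x. right x) (\<lambda>_. k1)"
    "CT (\<lambda>x. Node (left (left (right x))) (left (left x))) (\<lambda>_. k2)" "CT (\<lambda>_. Leaf) (\<lambda>_. k3)"
    "CT (\<lambda>_. Node Leaf Leaf) (\<lambda>_. k4)" "CT H (\<lambda>_. h)" "CT G (\<lambda>_. g)"
    "CT (\<lambda>x. Node Leaf (Node (right (left x)) (right (left (right x))))) (\<lambda>_. k5)"
    "CT (\<lambda>x. left (left x)) (\<lambda>_. k6)" "CT (\<lambda>x. right (right x)) (\<lambda>_. k7)"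
    "CT (\<lambda>x. Node (Node (left (left x)) (right (left x))) Leaf) (\<lambda>_. k8)"
    using CC unfolding CC_def by (elim exE) (rule that; assumption)
  define S where "S x = size (Node (left (left (right x))) (left (left x)))" for x
  define A where "A x = len (right (left x)) + len (right (left (right x)))" for x
  define p where "p x = k1 + k2 + k3 + k4 + 6 + e (S x)" for x
  define z where "z x = k1 + k5 + k6 + k7 + k8 + 6 + a * (A x + 1)" for x
  have P: "CT M p"
    unfolding M_def
    by (rule CT_mono[OF CT_if[OF k(1) CT_if[OF CT_comp[OF e(2) k(2)] k(3) k(4)] k(3)]])
      (auto simp: p_def S_def)
  have Z: "CT E z"
    unfolding E_def
    by (rule CT_mono[OF CT_if[OF k(1) CT_Node[OF CT_Node[OF k(8) CT_comp[OF a k(7)]] k(9)] k(10)]])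
      (auto simp: z_def A_def)
  have rec: "insert_args x = (if M x \<noteq> Leaf then H (Node x (insert_args (G x))) else E x)" for x
    by (cases "right x") (auto simp: insert_args_def M_def H_def G_def E_def eq_pair_def add_args_def)
  have dec: "M x \<noteq> Leaf \<Longrightarrow> size (right (G x)) < size (right x)" for x
    by (cases "right x") (auto simp: M_def G_def)
  obtain C where C: "CT insert_args (\<lambda>x. C x + 2)"
    "\<And>x. C x = p x + (if M x \<noteq> Leaf then g + h + C (G x) + 5 else z x + 1)"
    using CT_rec_ex[of M p G "\<lambda>_. g" H "\<lambda>_. h" E z insert_args "\<lambda>x. size (right x)",
        OF P k(6) k(5) Z rec dec] by metis
  \<comment> \<open>\<open>2 * n + 1\<close> is the size of the pair of keys handed to the equality
    test; the multiple of \<open>a\<close> pays for adding two numbers of \<open>\<beta>\<close>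
    bits.\<close>
  define W where "W n = k1 + k2 + k3 + k4 + g + h + 20 + e (2 * n + 1) + k1 + k5 + k6 + k7 + k8 + 3 * a" for n
  have ub_W: "ub W" unfolding W_def
    using ub_comp[OF e(1), of "\<lambda>n. 2 * n + 1"] by (intro ub_intros) (simp add: ub_intros)
  have bound: "C (Node (Node q c) t) \<le> (len t + 1) * (W N * (\<beta> + 1))"
    if "size q \<le> N" "len c \<le> \<beta>" "bounded_table N \<beta> t" for q c t N \<beta>
    using that(3)
  proof (induction t)
    case Leaf
    have "S (Node (Node q c) Leaf) \<le> 2 * N + 1" using that(1) by (simp add: S_def)
    then have "p (Node (Node q c) Leaf) \<le> k1 + k2 + k3 + k4 + 6 + e (2 * N + 1)"
      unfolding p_def using ub_mono[OF e(1)] by simp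
    moreover have "a * (A (Node (Node q c) Leaf) + 1) \<le> a * (\<beta> + 1)"
      using that(2) by (intro mult_le_mono2) (simp add: A_def)
    moreover have "C (Node (Node q c) Leaf) = p (Node (Node q c) Leaf) + (z (Node (Node q c) Leaf) + 1)"
      by (subst C(2)) (simp add: M_def)
    ultimately have "C (Node (Node q c) Leaf) \<le> (k1 + k2 + k3 + k4 + 13 + e (2 * N + 1) + k1 + k5 + k6 + k7 + k8) + a * (\<beta> + 1)"
      unfolding z_def by linarith
    also have "\<dots> \<le> (k1 + k2 + k3 + k4 + 13 + e (2 * N + 1) + k1 + k5 + k6 + k7 + k8) * (\<beta> + 1) + a * (\<beta> + 1)"
      by simp
    also have "\<dots> \<le> W N * (\<beta> + 1)"
      unfolding add_mult_distrib[symmetric] by (intro mult_le_mono1) (simp add: W_def)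
    finally show ?case by simp
  next
    case (Node y t)
    let ?x = "Node (Node q c) (Node y t)"
    have y: "size (left y) \<le> N" "len (right y) \<le> \<beta>" and t: "bounded_table N \<beta> t"
      using Node.prems by (auto simp: bounded_table_def)
    have "S ?x \<le> 2 * N + 1" using that(1) y by (simp add: S_def)
    then have p: "p ?x \<le> k1 + k2 + k3 + k4 + 6 + e (2 * N + 1)"
      unfolding p_def using ub_mono[OF e(1)] by simp
    have z: "a * (A ?x + 1) \<le> 2 * a * (\<beta> + 1)"
    proof -
      have "A ?x + 1 \<le> 2 * (\<beta> + 1)" using that(2) y by (simp add: A_def)
      from mult_le_mono2[OF this, of a] show ?thesis by simp
    qed
    have IH: "C (Node (Node q c) t) \<le> (len t + 1) * (W N * (\<beta> + 1))"
      using Node.IH(2) t by simp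
    have G: "G ?x = Node (Node q c) t" by (simp add: G_def)
    have "C ?x \<le> (k1 + k2 + k3 + k4 + g + h + 20 + e (2 * N + 1) + k1 + k5 + k6 + k7 + k8) + 2 * a * (\<beta> + 1)
         + C (Node (Node q c) t)"
      using p z by (subst C(2)) (auto simp: z_def G)
    also have "\<dots> \<le> (k1 + k2 + k3 + k4 + g + h + 20 + e (2 * N + 1) + k1 + k5 + k6 + k7 + k8) * (\<beta> + 1)
         + 2 * a * (\<beta> + 1) + (len t + 1) * (W N * (\<beta> + 1))"
      by (intro add_mono IH) simp_all
    also have "\<dots> \<le> W N * (\<beta> + 1) + (len t + 1) * (W N * (\<beta> + 1))"
      unfolding add_mult_distrib[symmetric] by (intro add_mono mult_le_mono1) (simp_all add: W_def)
    finally show ?case by simp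
  qed
  show ?thesis
  proof (rule that[of "\<lambda>n. (n + 1) * W n + 2", OF _ C(1)])
    show "ub (\<lambda>n. (n + 1) * W n + 2)" using ub_W by (intro ub_intros)
    fix q c t :: tree and N \<beta> :: nat assume *: "size q \<le> N" "len c \<le> \<beta>" "bounded_table N \<beta> t"
    have "C (Node (Node q c) t) \<le> (len t + 1) * (W N * (\<beta> + 1))" by (rule bound[OF *])
    also have "\<dots> \<le> (N + 1) * (W N * (\<beta> + 1))"
      using *(3) by (intro mult_le_mono1) (simp add: bounded_table_def)
    finally show "C (Node (Node q c) t) + 2 \<le> ((N + 1) * W N + 2) * (\<beta> + 1)"
      by (simp add: algebra_simps)
  qed
qed

lemma bounded_table_mono: "bounded_table N \<beta> t \<Longrightarrow> N \<le> N' \<Longrightarrow> \<beta> \<le> \<beta>' \<Longrightarrow> bounded_table N' \<beta>' t"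
  unfolding bounded_table_def by force

text \<open>A sum has at most one bit more than its longer summand. Each insertion is thus charged
  one row and one bit, whether or not its key is already present.\<close>

lemma bounded_table_insert:
  assumes "size q \<le> N" "len c \<le> \<beta>" "bounded_table N \<beta>' t" "\<beta> \<le> \<beta>'"
  shows "bounded_table (Suc N) (Suc \<beta>') (insert_count q c t)"
proof -
  have "\<forall>e\<in>set (lst (insert_count q c t)). size (left e) \<le> N \<and> len (right e) \<le> Suc \<beta>'"
    using assms(3) unfolding bounded_table_def
  proof (induction t)
    case (Node e t)
    have "len (add_tree Leaf c (right e)) \<le> Suc \<beta>'"
      using len_add_tree[of Leaf c "right e"] Node.prems assms(2,4) by auto
    with Node assms(1) show ?case by (auto simp: le_SucI)
  qed (use assms in auto)
  moreover have "len (insert_count q c t) \<le> Suc (len t)" by (induction t) auto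
  ultimately show ?thesis using assms(3) unfolding bounded_table_def by force
qed

text \<open>A state reached by \<open>c\<close> words passes the weight \<open>c\<close> to each of
  its successors, repeated ones included.\<close>

definition insert_all :: "tree \<Rightarrow> tree \<Rightarrow> tree \<Rightarrow> tree" where
  "insert_all qs c t = foldr (\<lambda>q t. insert_count q c t) (lst qs) t"

lemma bounded_table_insert_all:
  assumes "\<And>q. q \<in> set (lst qs) \<Longrightarrow> size q \<le> N" "len c \<le> \<beta>" "bounded_table N \<beta> t"
  shows "bounded_table (N + len qs) (\<beta> + len qs) (insert_all qs c t)"
  using assms(1)
proof (induction qs)
  case Leaf
  then show ?case using assms(3) by (simp add: insert_all_def)
next
  case (Node q qs)
  have "size q \<le> N + len qs" using Node.prems by (simp add: trans_le_add1)
  from bounded_table_insert[OF this assms(2) Node.IH(2)] Node.prems show ?case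
    by (simp add: insert_all_def)
qed


lemma CC_obtain:
  assumes "CC F"
  obtains K where "CT F (\<lambda>_. K)"
  using assms unfolding CC_def by blast

text \<open>Moves a bit count that depends on the parameters only into the coefficient, keeping
  costs in the shape \<open>b N * (\<beta> + 1)\<close>.\<close>

lemma absorb: "x * (\<beta> + n + 1) \<le> x * (n + 1) * (\<beta> + (1 :: nat))"
  by (simp add: algebra_simps)

definition insert_all_args :: "tree \<Rightarrow> tree" where
  "insert_all_args x = insert_all (left x) (left (right x)) (right (right x))"

lemma CT_insert_all:
  obtains C b where "ub b" "CT insert_all_args C"
    "\<And>qs c t N \<beta>. (\<And>q. q \<in> set (lst qs) \<Longrightarrow> size q \<le> N) \<Longrightarrow> len qs \<le> N \<Longrightarrow> len c \<le> \<beta> \<Longrightarrow>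
      bounded_table N \<beta> t \<Longrightarrow> C (Node qs (Node c t)) \<le> b N * (\<beta> + 1)"
proof -
  obtain I i where i: "ub i" "CT insert_args I" and I: "\<And>q c t N \<beta>. size q \<le> N \<Longrightarrow> len c \<le> \<beta> \<Longrightarrow>
      bounded_table N \<beta> t \<Longrightarrow> I (Node (Node q c) t) \<le> i N * (\<beta> + 1)"
    using CT_insert by metis
  define B where "B z = Node (Node (left (left (left z))) (left (right (left z)))) (right z)" for z
  have "CC B" unfolding B_def by (intro CC_intros)
  then obtain k where k: "CT B (\<lambda>_. k)" by (rule CC_obtain)
  have "CC left" "CC (\<lambda>x. Node (right (left x)) (right x))" "CC (\<lambda>x. right (right x))"
    by (intro CC_intros)+
  then obtain p g z where CT: "CT left (\<lambda>_. p)" "CT (\<lambda>x. Node (right (left x)) (right x)) (\<lambda>_. g)"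
    "CT (\<lambda>x. right (right x)) (\<lambda>_. z)"
    unfolding CC_def by (elim exE) (rule that; assumption)
  have rec: "insert_all_args x = (if left x \<noteq> Leaf
    then insert_args (B (Node x (insert_all_args (Node (right (left x)) (right x))))) else right (right x))" for x
    by (cases "left x") (simp_all add: insert_all_args_def insert_args_def insert_all_def B_def)
  have dec: "left x \<noteq> Leaf \<Longrightarrow> size (left (Node (right (left x)) (right x))) < size (left x)" for x
    by (simp add: size_right_less)
  obtain C where C: "CT insert_all_args (\<lambda>x. C x + 2)"
    "\<And>x. C x = p + (if left x \<noteq> Leaf then g + (k + I (B (Node x
        (insert_all_args (Node (right (left x)) (right x))))) + 1)
       + C (Node (right (left x)) (right x)) + 5 else z + 1)"
    using CT_rec_ex[where f = insert_all_args and m = "\<lambda>x. size (left x)",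
        OF CT(1,2) CT_comp[OF i(2) k] CT(3) rec dec] by metis
  \<comment> \<open>\<open>2 * N\<close>: the table starts with at most \<open>N\<close> rows and
    can gain one for each of at most \<open>N\<close> successors. The factor \<open>N + 1\<close>
    absorbs the bits gained meanwhile.\<close>
  define W where "W N = p + g + k + z + 6 + i (2 * N) * (N + 1)" for N
  have ub_b: "ub (\<lambda>n. (n + 1) * W n + 2)"
    unfolding W_def using ub_comp[OF i(1), of "\<lambda>n. 2 * n"] by (intro ub_intros) (simp add: ub_intros)
  have "C (Node qs (Node c t)) + 2 \<le> ((N + 1) * W N + 2) * (\<beta> + 1)"
    if *: "\<And>q. q \<in> set (lst qs) \<Longrightarrow> size q \<le> N" "len qs \<le> N" "len c \<le> \<beta>" "bounded_table N \<beta> t" for qs c t N \<beta>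
  proof -
    have "C (Node qs (Node c t)) \<le> (len qs + 1) * (W N * (\<beta> + 1))"
      using *(1,2)
    proof (induction qs)
      case Leaf
      show ?case by (subst C(2)) (simp add: W_def)
    next
      case (Node q qs)
      have "bounded_table (N + len qs) (\<beta> + len qs) (insert_all qs c t)"
        using Node.prems *(3,4) by (intro bounded_table_insert_all) auto
      then have "bounded_table (2 * N) (\<beta> + N) (insert_all qs c t)"
        using Node.prems by (elim bounded_table_mono) auto
      moreover have "size q \<le> 2 * N" using Node.prems(1)[of q] by simp
      ultimately have "I (Node (Node q c) (insert_all qs c t)) \<le> i (2 * N) * (\<beta> + N + 1)"
        using *(3) by (intro I) (auto simp: trans_le_add1)
      also have "\<dots> \<le> i (2 * N) * (N + 1) * (\<beta> + 1)" by (rule absorb)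
      finally have 1: "I (Node (Node q c) (insert_all qs c t)) \<le> i (2 * N) * (N + 1) * (\<beta> + 1)" .
      have IH: "C (Node qs (Node c t)) \<le> (len qs + 1) * (W N * (\<beta> + 1))"
        using Node by simp
      have "C (Node (Node q qs) (Node c t)) = (p + g + k + 6) + I (Node (Node q c) (insert_all qs c t))
          + C (Node qs (Node c t))"
        by (subst C(2)) (simp add: insert_all_args_def B_def)
      also have "\<dots> \<le> (p + g + k + 6) * (\<beta> + 1) + i (2 * N) * (N + 1) * (\<beta> + 1)
          + (len qs + 1) * (W N * (\<beta> + 1))"
        using 1 IH by (intro add_mono) simp_all
      also have "\<dots> \<le> W N * (\<beta> + 1) + (len qs + 1) * (W N * (\<beta> + 1))"
        unfolding add_mult_distrib[symmetric] by (intro add_mono mult_le_mono1) (simp_all add: W_def)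
      finally show ?case by simp
    qed
    also have "\<dots> \<le> (N + 1) * (W N * (\<beta> + 1))" using *(2) by (intro mult_le_mono1) simp
    finally show ?thesis by (simp add: algebra_simps)
  qed
  from that[OF ub_b C(1) this] show ?thesis by blast
qed

section \<open>Processing one layer\<close>

text \<open>Lists one successor per column, with repetitions, since different columns extend a word
  differently. The argument is a state with a layer context, both bounded in terms of the
  parameters, so membership in \<open>PR\<close> is all that is needed.\<close>

definition steps :: "tree \<Rightarrow> tree" where
  "steps z = enc (map (\<lambda>col. delta_tree (delta_arg (left (right (left (right z)))) (left z) col
     (Node (left (left (right z))) (right (right z))) Leaf)) (lst (right (right (left (right z))))))"

lemma PR_steps: "PR steps"
  unfolding steps_def delta_arg_def by (intro PR_intros PR_comp[OF PR_delta_tree])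

definition new_table :: "tree \<Rightarrow> tree \<Rightarrow> tree" where
  "new_table t ctx = foldr (\<lambda>e r. insert_all (steps (Node (left e) ctx)) (right e) r) (lst t) Leaf"

definition new_table_args :: "tree \<Rightarrow> tree" where
  "new_table_args x = new_table (left x) (right x)"

text \<open>Applying the table bound again would iterate \<open>R\<close>. The loop keeps only its
  statement about bits and takes the bound on keys and rows from elsewhere.\<close>

lemma CT_new_table:
  obtains C b R where "ub b" "ub R" "CT new_table_args C"
    "\<And>t ctx N \<beta>. bounded_table N \<beta> t \<Longrightarrow> size ctx \<le> N \<Longrightarrow> C (Node t ctx) \<le> b N * (\<beta> + 1)"
    "\<And>t ctx N \<beta>. bounded_table N \<beta> t \<Longrightarrow> size ctx \<le> N \<Longrightarrow> bounded_table (R N) (\<beta> + R N) (new_table t ctx)"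
proof -
  obtain s where s: "ub s" "CT steps (\<lambda>x. s (size x))" "\<And>x. size (steps x) \<le> s (size x)"
    using PR_obtain[OF PR_steps] by metis
  obtain I i where i: "ub i" "CT insert_all_args I" and I: "\<And>qs c t N \<beta>.
      (\<And>q. q \<in> set (lst qs) \<Longrightarrow> size q \<le> N) \<Longrightarrow> len qs \<le> N \<Longrightarrow> len c \<le> \<beta> \<Longrightarrow>
      bounded_table N \<beta> t \<Longrightarrow> I (Node qs (Node c t)) \<le> i N * (\<beta> + 1)"
    using CT_insert_all by metis
  define A where "A z = Node (steps (Node (left (left (left (left z)))) (right (left z))))
     (Node (right (left (left (left z)))) (right z))" for z
  have "CC left" "CC (\<lambda>x. Node (right (left x)) (right x))"
    "CC (\<lambda>z. Node (left (left (left (left z)))) (right (left z)))"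
    "CC (\<lambda>z. Node (right (left (left (left z)))) (right z))"
    by (intro CC_intros)+
  then obtain p g k l where CT: "CT left (\<lambda>_. p)" "CT (\<lambda>x. Node (right (left x)) (right x)) (\<lambda>_. g)"
    "CT (\<lambda>z. Node (left (left (left (left z)))) (right (left z))) (\<lambda>_. k)"
    "CT (\<lambda>z. Node (right (left (left (left z)))) (right z)) (\<lambda>_. l)"
    unfolding CC_def by (elim exE) (rule that; assumption)
  define h where "h z = k + s (size (Node (left (left (left (left z)))) (right (left z)))) + 1 + l + 1 + I (A z) + 1" for z
  have H: "CT (\<lambda>z. insert_all_args (A z)) h"
    unfolding h_def A_def using CT_comp[OF i(2) CT_Node[OF CT_comp[OF s(2) CT(3)] CT(4)]] .
  have step: "new_table_args (Node (Node e t) ctx)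
      = insert_all (steps (Node (left e) ctx)) (right e) (new_table t ctx)" for e t ctx
    by (simp add: new_table_args_def new_table_def)
  have rec: "new_table_args x = (if left x \<noteq> Leaf
      then insert_all_args (A (Node x (new_table_args (Node (right (left x)) (right x))))) else Leaf)" for x
    by (cases "left x")
      (simp_all add: new_table_args_def insert_all_args_def A_def new_table_def)
  have dec: "left x \<noteq> Leaf \<Longrightarrow> size (left (Node (right (left x)) (right x))) < size (left x)" for x
    by (simp add: size_right_less)
  obtain C where C: "CT new_table_args (\<lambda>x. C x + 2)"
    "\<And>x. C x = p + (if left x \<noteq> Leaf then g + h (Node x (new_table_args (Node (right (left x)) (right x))))
       + C (Node (right (left x)) (right x)) + 5 else 1 + 1)"
    using CT_rec_ex[where f = new_table_args and m = "\<lambda>x. size (left x)",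
        OF CT(1,2) H CT_Leaf rec dec] by metis
  define M where "M N = s (2 * N + 1)" for N
  define R where "R N = M N * (N + 1)" for N
  define W where "W N = p + g + k + l + 9 + M N + i (R N) * (R N + 1)" for N
  have ub_M: "ub M" unfolding M_def using ub_comp[OF s(1), of "\<lambda>n. 2 * n + 1"] by (simp add: ub_intros)
  then have ub_R: "ub R" unfolding R_def by (intro ub_intros)
  have "ub W" unfolding W_def using ub_comp[OF i(1) ub_R] ub_M ub_R by (intro ub_intros)
  then have ub_b: "ub (\<lambda>n. (n + 1) * W n + 2)" by (intro ub_intros)
  have qs: "len (steps (Node q ctx)) \<le> M N" "\<And>q'. q' \<in> set (lst (steps (Node q ctx))) \<Longrightarrow> size q' \<le> M N"
    "s (size (Node q ctx)) \<le> M N"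
    if "size q \<le> N" "size ctx \<le> N" for q ctx N
  proof -
    show *: "s (size (Node q ctx)) \<le> M N"
      unfolding M_def using that by (intro ub_mono[OF s(1)]) simp
    show "len (steps (Node q ctx)) \<le> M N"
      using length_lst_le[of "steps (Node q ctx)"] s(3)[of "Node q ctx"] * by linarith
    show "size q' \<le> M N" if "q' \<in> set (lst (steps (Node q ctx)))" for q'
      using size_lst_less[OF that] s(3)[of "Node q ctx"] * by linarith
  qed
  have table: "bounded_table (M N * (len t + 1)) (\<beta> + M N * (len t + 1)) (new_table t ctx)"
    if "bounded_table N \<beta> t" "size ctx \<le> N" for t ctx N \<beta>
    using that(1)
  proof (induction t)
    case Leaf
    show ?case by (simp add: new_table_def bounded_table_def)
  next
    case (Node e t)
    have e: "size (left e) \<le> N" "len (right e) \<le> \<beta>" and t: "bounded_table N \<beta> t"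
      using Node.prems by (auto simp: bounded_table_def)
    have "bounded_table (M N * (len t + 1) + len (steps (Node (left e) ctx)))
       (\<beta> + M N * (len t + 1) + len (steps (Node (left e) ctx)))
       (insert_all (steps (Node (left e) ctx)) (right e) (new_table t ctx))"
    proof (rule bounded_table_insert_all)
      show "size q \<le> M N * (len t + 1)" if "q \<in> set (lst (steps (Node (left e) ctx)))" for q
        using qs(2)[OF e(1) \<open>size ctx \<le> N\<close> that] by (simp add: trans_le_add1)
    qed (use e Node.IH(2)[OF t] in auto)
    then have "bounded_table (M N * (len t + 1) + M N) (\<beta> + M N * (len t + 1) + M N)
       (insert_all (steps (Node (left e) ctx)) (right e) (new_table t ctx))"
      using qs(1)[OF e(1) that(2)] by (elim bounded_table_mono) auto
    then show ?case using step[of e t ctx] by (simp add: new_table_args_def algebra_simps)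
  qed
  have table': "bounded_table (R N) (\<beta> + R N) (new_table t ctx)"
    if "bounded_table N \<beta> t" "size ctx \<le> N" for t ctx N \<beta>
    using table[OF that]
  proof (rule bounded_table_mono)
    show "M N * (len t + 1) \<le> R N"
      unfolding R_def using that(1) by (intro mult_le_mono2) (simp add: bounded_table_def)
    then show "\<beta> + M N * (len t + 1) \<le> \<beta> + R N" by simp
  qed
  have cost: "C (Node t ctx) \<le> (len t + 1) * (W N * (\<beta> + 1))"
    if "bounded_table N \<beta> t" "size ctx \<le> N" for t ctx N \<beta>
    using that(1)
  proof (induction t)
    case Leaf
    show ?case by (subst C(2)) (simp add: W_def)
  next
    case (Node e t)
    let ?qs = "steps (Node (left e) ctx)"
    have e: "size (left e) \<le> N" "len (right e) \<le> \<beta>" and t: "bounded_table N \<beta> t"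
      using Node.prems by (auto simp: bounded_table_def)
    have MR: "M N \<le> R N" by (simp add: R_def)
    have "I (Node ?qs (Node (right e) (new_table t ctx))) \<le> i (R N) * (\<beta> + R N + 1)"
    proof (rule I)
      show "len ?qs \<le> R N" using qs(1)[OF e(1) that(2)] MR by linarith
      show "size q \<le> R N" if "q \<in> set (lst ?qs)" for q
        using qs(2)[OF e(1) \<open>size ctx \<le> N\<close> that] MR by linarith
    qed (use e table'[OF t that(2)] in auto)
    also have "\<dots> \<le> i (R N) * (R N + 1) * (\<beta> + 1)" by (rule absorb)
    finally have 1: "I (Node ?qs (Node (right e) (new_table t ctx))) \<le> i (R N) * (R N + 1) * (\<beta> + 1)" .
    have IH: "C (Node t ctx) \<le> (len t + 1) * (W N * (\<beta> + 1))"
      using Node.IH(2) t by simp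
    have "C (Node (Node e t) ctx) = (p + g + k + l + 8 + s (size (Node (left e) ctx)))
        + I (Node ?qs (Node (right e) (new_table t ctx))) + C (Node t ctx)"
      by (subst C(2)) (simp add: h_def A_def new_table_args_def)
    also have "\<dots> \<le> (p + g + k + l + 8 + M N) + I (Node ?qs (Node (right e) (new_table t ctx))) + C (Node t ctx)"
      using qs(3)[OF e(1) that(2)] by simp
    also have "\<dots> \<le> (p + g + k + l + 8 + M N) * (\<beta> + 1) + i (R N) * (R N + 1) * (\<beta> + 1)
        + (len t + 1) * (W N * (\<beta> + 1))"
      using 1 IH by (intro add_mono) simp_all
    also have "\<dots> \<le> W N * (\<beta> + 1) + (len t + 1) * (W N * (\<beta> + 1))"
      unfolding add_mult_distrib[symmetric] by (intro add_mono mult_le_mono1) (simp_all add: W_def)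
    finally show ?case by simp
  qed
  have "C (Node t ctx) + 2 \<le> ((N + 1) * W N + 2) * (\<beta> + 1)"
    if "bounded_table N \<beta> t" "size ctx \<le> N" for t ctx N \<beta>
  proof -
    have "C (Node t ctx) \<le> (len t + 1) * (W N * (\<beta> + 1))" by (rule cost[OF that])
    also have "\<dots> \<le> (N + 1) * (W N * (\<beta> + 1))"
      using that(1) by (intro mult_le_mono1) (simp add: bounded_table_def)
    finally show ?thesis by (simp add: algebra_simps)
  qed
  from that[OF ub_b ub_R C(1) this table'] show ?thesis .
qed

definition accepted_count :: "tree \<Rightarrow> tree" where
  "accepted_count t = foldr (\<lambda>e r. if left (left e) \<noteq> Leaf then add_tree Leaf (right e) r else r) (lst t) Leaf"

lemma len_accepted_count: "bounded_table N \<beta> t \<Longrightarrow> len (accepted_count t) \<le> \<beta> + len t"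
proof (induction t)
  case (Node e t)
  have "len (accepted_count t) \<le> \<beta> + len t" "len (right e) \<le> \<beta>"
    using Node by (auto simp: bounded_table_def)
  then show ?case using len_add_tree[of Leaf "right e" "accepted_count t"] by (auto simp: accepted_count_def)
qed (simp add: accepted_count_def)

text \<open>The running sum exceeds the counters by at most one bit per row, so it too has a length
  of at most \<open>\<beta> + N\<close>.\<close>

lemma CT_accepted_count:
  obtains C b where "ub b" "CT accepted_count C" "\<And>t N \<beta>. bounded_table N \<beta> t \<Longrightarrow> C t \<le> b N * (\<beta> + 1)"
proof -
  obtain a where a: "CT add_args (\<lambda>x. a * (len (left (right x)) + len (right (right x)) + 1))"
    using CT_add .
  define P where "P x = left (left (left (left x)))" for x
  define A where "A z = Node Leaf (Node (right (left (left z))) (right z))" for z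
  have "CC P" "CC A" "CC (\<lambda>x. x)" "CC right"
    unfolding P_def A_def by (intro CC_intros)+
  then obtain p k q g where CT: "CT P (\<lambda>_. p)" "CT A (\<lambda>_. k)" "CT (\<lambda>x. x) (\<lambda>_. q)" "CT right (\<lambda>_. g)"
    unfolding CC_def by (elim exE) (rule that; assumption)
  define h where "h z = p + (k + a * (len (right (left (left z))) + len (right z) + 1)) + g + 3" for z
  have "CT (\<lambda>z. if P z \<noteq> Leaf then add_args (A z) else right z) h"
    by (rule CT_mono[OF CT_if[OF CT(1) CT_comp[OF a CT(2)] CT(4)]]) (auto simp: h_def A_def)
  note H = this
  have rec: "accepted_count x = (if x \<noteq> Leaf then (\<lambda>z. if P z \<noteq> Leaf then add_args (A z) else right z) (Node x (accepted_count (right x)))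
      else Leaf)" for x
    by (cases x) (auto simp: accepted_count_def P_def A_def add_args_def)
  obtain C where C: "CT accepted_count (\<lambda>x. C x + 2)"
    "\<And>x. C x = q + (if x \<noteq> Leaf then g + h (Node x (accepted_count (right x))) + C (right x) + 5 else 1 + 1)"
    using CT_rec_ex[where f = accepted_count and m = size, OF CT(3,4) H CT_Leaf rec size_right_less] by metis
  define W where "W N = p + k + 2 * g + q + 10 + a * 2 * (N + 1)" for N
  have ub_b: "ub (\<lambda>n. (n + 1) * W n + 2)" unfolding W_def by (intro ub_intros)
  have cost: "C t \<le> (len t + 1) * (W N * (\<beta> + 1))" if "bounded_table N \<beta> t" for t N \<beta>
    using that
  proof (induction t)
    case Leaf
    show ?case by (subst C(2)) (simp add: W_def)
  next
    case (Node e t)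
    have e: "len (right e) \<le> \<beta>" and t: "bounded_table N \<beta> t" "len t \<le> N"
      using Node.prems by (auto simp: bounded_table_def)
    have "len (right e) + len (accepted_count t) + 1 \<le> 2 * (\<beta> + N + 1)"
      using len_accepted_count[OF t(1)] t(2) e by simp
    then have "a * (len (right e) + len (accepted_count t) + 1) \<le> a * (2 * (\<beta> + N + 1))" by (rule mult_le_mono2)
    also have "\<dots> \<le> a * 2 * (N + 1) * (\<beta> + 1)" using absorb[of "a * 2" \<beta> N] by (simp add: mult.assoc)
    finally have 1: "a * (len (right e) + len (accepted_count t) + 1) \<le> a * 2 * (N + 1) * (\<beta> + 1)" .
    have IH: "C t \<le> (len t + 1) * (W N * (\<beta> + 1))" using Node.IH(2) t by simp
    have "C (Node e t) = (p + k + 2 * g + q + 8) + a * (len (right e) + len (accepted_count t) + 1) + C t"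
      by (subst C(2)) (simp add: h_def)
    also have "\<dots> \<le> (p + k + 2 * g + q + 8) * (\<beta> + 1) + a * 2 * (N + 1) * (\<beta> + 1) + (len t + 1) * (W N * (\<beta> + 1))"
      using 1 IH by (intro add_mono) simp_all
    also have "\<dots> \<le> W N * (\<beta> + 1) + (len t + 1) * (W N * (\<beta> + 1))"
      unfolding add_mult_distrib[symmetric] by (intro add_mono mult_le_mono1) (simp_all add: W_def)
    finally show ?case by simp
  qed
  have "C t + 2 \<le> ((N + 1) * W N + 2) * (\<beta> + 1)" if "bounded_table N \<beta> t" for t N \<beta>
  proof -
    have "C t \<le> (len t + 1) * (W N * (\<beta> + 1))" by (rule cost[OF that])
    also have "\<dots> \<le> (N + 1) * (W N * (\<beta> + 1))"
      using that(1) by (intro mult_le_mono1) (simp add: bounded_table_def)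
    finally show ?thesis by (simp add: algebra_simps)
  qed
  from that[OF ub_b C(1) this] show ?thesis .
qed

definition map_tree :: "(tree \<Rightarrow> tree) \<Rightarrow> tree \<Rightarrow> tree" where
  "map_tree F t = enc (map F (lst t))"

lemma CT_map_tree:
  assumes "CC F"
  obtains K where "CT (map_tree F) (\<lambda>t. K * (len t + 1))"
proof -
  have "CC (\<lambda>z. left (left z))" by (intro CC_intros)
  moreover obtain f where f: "CT F (\<lambda>_. f)" using assms by (rule CC_obtain)
  ultimately obtain l where l: "CT (\<lambda>z. left (left z)) (\<lambda>_. l)" using CC_obtain by blast
  have rec: "map_tree F x = (if x \<noteq> Leaf then (\<lambda>z. Node (F (left (left z))) (right z)) (Node x (map_tree F (right x)))
      else Leaf)" for x
    by (cases x) (auto simp: map_tree_def)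
  have "CT (map_tree F) (\<lambda>x. (f + l + 15) * (len x + 1) + 2)"
    by (rule CT_rec[where m = size, OF CT_id CT_right[OF CT_id] CT_Node[OF CT_comp[OF f l] CT_right[OF CT_id]] CT_Leaf rec size_right_less])
      (auto simp: len_right)
  then have "CT (map_tree F) (\<lambda>x. (f + l + 17) * (len x + 1))" by (rule CT_mono) simp
  then show ?thesis by (rule that)
qed

section \<open>The loop over the layers\<close>

definition layer_ctx :: "tree \<Rightarrow> tree \<Rightarrow> tree \<Rightarrow> tree" where
  "layer_ctx p D Ds = Node p (Node (left D) (map_tree left Ds))"

fun loop :: "tree \<Rightarrow> tree \<Rightarrow> tree \<Rightarrow> tree \<Rightarrow> tree" where
  "loop p Leaf Ds t = accepted_count t"
| "loop p (Node B D) Ds t = loop p D (map_tree right Ds) (new_table t (layer_ctx p (Node B D) Ds))"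

definition bounded_keys :: "nat \<Rightarrow> tree \<Rightarrow> bool" where
  "bounded_keys N t \<longleftrightarrow> len t \<le> N \<and> (\<forall>e\<in>set (lst t). size (left e) \<le> N)"

text \<open>Postulates for the whole run of the loop a common bound \<open>N\<close> on keys, rows
  and layer contexts. It cannot be derived from cost considerations; \<open>safe_states\<close>
  establishes it from the meaning of the tables.\<close>

fun safe :: "nat \<Rightarrow> tree \<Rightarrow> tree \<Rightarrow> tree \<Rightarrow> tree \<Rightarrow> bool" where
  "safe N p Leaf Ds t \<longleftrightarrow> bounded_keys N t"
| "safe N p (Node B D) Ds t \<longleftrightarrow> bounded_keys N t \<and> size (layer_ctx p (Node B D) Ds) \<le> N \<and>
     safe N p D (map_tree right Ds) (new_table t (layer_ctx p (Node B D) Ds))"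

lemma bounded_keys_table: "bounded_keys N t \<Longrightarrow> bounded_table N' \<beta> t \<Longrightarrow> bounded_table N \<beta> t"
  unfolding bounded_keys_def bounded_table_def by blast

lemma safe_keys: "safe N p D Ds t \<Longrightarrow> bounded_keys N t"
  by (cases D) auto

lemma len_map_tree [simp]: "len (map_tree F t) = len t"
  by (simp add: map_tree_def)

definition loop_args :: "tree \<Rightarrow> tree" where
  "loop_args x = loop (left (right x)) (left (right (right x))) (right (right (right x))) (left x)"

text \<open>Counters gain at most \<open>R N\<close> bits per layer, so at any time they have at
  most \<open>\<beta> + len D * R N\<close> bits, and each layer costs a parameter-dependent
  multiple of this. The product of layers and bits gives the quadratic bound.\<close>

lemma CT_loop:
  obtains C b R where "ub b" "ub R" "CT loop_args C"
    "\<And>N \<beta> p D Ds t. safe N p D Ds t \<Longrightarrow> bounded_table N \<beta> t \<Longrightarrow> len Ds \<le> N \<Longrightarrow>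
      C (Node t (Node p (Node D Ds))) \<le> (len D + 1) * (b N * (\<beta> + len D * R N + 1))"
proof -
  obtain T n R where n: "ub n" "ub R" "CT new_table_args T"
    "\<And>t ctx N \<beta>. bounded_table N \<beta> t \<Longrightarrow> size ctx \<le> N \<Longrightarrow> T (Node t ctx) \<le> n N * (\<beta> + 1)"
    "\<And>t ctx N \<beta>. bounded_table N \<beta> t \<Longrightarrow> size ctx \<le> N \<Longrightarrow> bounded_table (R N) (\<beta> + R N) (new_table t ctx)"
    by (rule CT_new_table) blast
  obtain S s where s: "ub s" "CT accepted_count S" "\<And>t N \<beta>. bounded_table N \<beta> t \<Longrightarrow> S t \<le> s N * (\<beta> + 1)"
    by (rule CT_accepted_count) blast
  have "CC left" "CC right" by (intro CC_intros)+
  then obtain l r where l: "CT (map_tree left) (\<lambda>t. l * (len t + 1))"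
    and r: "CT (map_tree right) (\<lambda>t. r * (len t + 1))"
    by (metis CT_map_tree)
  have "CC (\<lambda>x. left (right (right x)))" "CC (\<lambda>x. left (right x))" "CC (\<lambda>x. left (left (right (right x))))"
    "CC (\<lambda>x. right (right (right x)))" "CC (\<lambda>x. right (left (right (right x))))" "CC left" "CC right"
    by (intro CC_intros)+
  then obtain k1 k2 k3 k4 k5 k6 k7 where k: "CT (\<lambda>x. left (right (right x))) (\<lambda>_. k1)"
    "CT (\<lambda>x. left (right x)) (\<lambda>_. k2)" "CT (\<lambda>x. left (left (right (right x)))) (\<lambda>_. k3)"
    "CT (\<lambda>x. right (right (right x))) (\<lambda>_. k4)" "CT (\<lambda>x. right (left (right (right x)))) (\<lambda>_. k5)"
    "CT left (\<lambda>_. k6)" "CT right (\<lambda>_. k7)"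
    unfolding CC_def by (elim exE) (rule that; assumption)
  define A where "A x = Node (left x) (Node (left (right x)) (Node (left (left (right (right x))))
    (map_tree left (right (right (right x))))))" for x
  define G where "G x = Node (new_table_args (A x)) (Node (left (right x))
    (Node (right (left (right (right x)))) (map_tree right (right (right (right x))))))" for x
  define m where "m x = len (right (right (right x)))" for x
  define a where "a x = k6 + k2 + k3 + k4 + l * (m x + 1) + 4" for x
  have A: "CT A a"
    unfolding A_def
    by (rule CT_mono[OF CT_Node[OF k(6) CT_Node[OF k(2) CT_Node[OF k(3) CT_comp[OF l k(4)]]]]])
      (simp add: a_def m_def)
  define g where "g x = a x + T (A x) + k2 + k4 + k5 + r * (m x + 1) + 5" for x
  have G: "CT G g"
    unfolding G_def
    by (rule CT_mono[OF CT_Node[OF CT_comp[OF n(3) A] CT_Node[OF k(2) CT_Node[OF k(5) CT_comp[OF r k(4)]]]]])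
      (simp add: g_def m_def)
  have rec: "loop_args x = (if left (right (right x)) \<noteq> Leaf then right (Node x (loop_args (G x)))
      else accepted_count (left x))" for x
    by (cases "left (right (right x))")
      (simp_all add: loop_args_def G_def A_def new_table_args_def layer_ctx_def)
  have dec: "left (right (right x)) \<noteq> Leaf \<Longrightarrow> size (left (right (right (G x)))) < size (left (right (right x)))" for x
    by (simp add: G_def size_right_less)
  obtain C where C: "CT loop_args (\<lambda>x. C x + 2)"
    "\<And>x. C x = k1 + (if left (right (right x)) \<noteq> Leaf then g x + k7 + C (G x) + 5
       else k6 + S (left x) + 1 + 1)"
    using CT_rec_ex[where f = loop_args and m = "\<lambda>x. size (left (right (right x)))",
        OF k(1) G k(7) CT_comp[OF s(2) k(6)] rec dec] by metis
  define W where "W N = k1 + k2 + k2 + k3 + k4 + k4 + k5 + k6 + k7 + 20 + (l + r) * (N + 1) + n N + s N" for N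
  have cost: "C (Node t (Node p (Node D Ds))) \<le> (len D + 1) * (W N * (\<beta> + len D * R N + 1))"
    if "safe N p D Ds t" "bounded_table N \<beta> t" "len Ds \<le> N" for N \<beta> p D Ds t
    using that
  proof (induction D arbitrary: \<beta> Ds t)
    case Leaf
    have "C (Node t (Node p (Node Leaf Ds))) \<le> (k1 + k6 + 2) + s N * (\<beta> + 1)"
      using s(3)[OF Leaf(2)] by (subst C(2)) simp
    also have "\<dots> \<le> (k1 + k6 + 2) * (\<beta> + 1) + s N * (\<beta> + 1)" by simp
    also have "\<dots> \<le> W N * (\<beta> + 1)"
      unfolding add_mult_distrib[symmetric] by (intro mult_le_mono1) (simp add: W_def)
    finally show ?case by simp
  next
    case (Node B D)
    let ?ctx = "layer_ctx p (Node B D) Ds" and ?x = "Node t (Node p (Node (Node B D) Ds))"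
    have ctx: "size ?ctx \<le> N" and safe: "safe N p D (map_tree right Ds) (new_table t ?ctx)"
      using Node.prems(1) by auto
    \<comment> \<open>The bound \<open>N\<close> on keys and rows comes from \<open>safe\<close>,
      the bound on the bits from \<open>n(5)\<close>.\<close>
    have "bounded_table N (\<beta> + R N) (new_table t ?ctx)"
      using bounded_keys_table[OF safe_keys[OF safe] n(5)[OF Node.prems(2) ctx]] .
    from Node.IH(2)[OF safe this] Node.prems(3)
    have IH: "C (Node (new_table t ?ctx) (Node p (Node D (map_tree right Ds))))
        \<le> (len D + 1) * (W N * (\<beta> + len (Node B D) * R N + 1))"
      by (simp add: add.assoc)
    have Ax: "A ?x = Node t ?ctx" by (simp add: A_def layer_ctx_def)
    have Gx: "G ?x = Node (new_table t ?ctx) (Node p (Node D (map_tree right Ds)))"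
      by (simp add: G_def Ax new_table_args_def)
    have m: "m ?x \<le> N" using Node.prems(3) by (simp add: m_def)
    have T: "T (Node t ?ctx) \<le> n N * (\<beta> + 1)" using n(4)[OF Node.prems(2) ctx] .
    have "C ?x = (k1 + k2 + k2 + k3 + k4 + k4 + k5 + k6 + k7 + 14) + (l * (m ?x + 1) + r * (m ?x + 1))
        + T (Node t ?ctx) + C (G ?x)"
      by (subst C(2)) (simp add: g_def a_def Ax)
    also have "\<dots> \<le> (k1 + k2 + k2 + k3 + k4 + k4 + k5 + k6 + k7 + 14) * (\<beta> + 1) + ((l + r) * (N + 1)) * (\<beta> + 1)
        + n N * (\<beta> + 1) + (len D + 1) * (W N * (\<beta> + len (Node B D) * R N + 1))"
    proof (intro add_mono T)
      show "C (G ?x) \<le> (len D + 1) * (W N * (\<beta> + len (Node B D) * R N + 1))" using IH unfolding Gx .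
      have "l * (m ?x + 1) + r * (m ?x + 1) \<le> (l + r) * (N + 1)"
        unfolding add_mult_distrib using m by (intro add_mono mult_le_mono2) auto
      also have "\<dots> \<le> (l + r) * (N + 1) * (\<beta> + 1)" by simp
      finally show "l * (m ?x + 1) + r * (m ?x + 1) \<le> (l + r) * (N + 1) * (\<beta> + 1)" .
    qed simp
    also have "\<dots> \<le> W N * (\<beta> + 1) + (len D + 1) * (W N * (\<beta> + len (Node B D) * R N + 1))"
      unfolding add_mult_distrib[symmetric] by (intro add_mono mult_le_mono1) (simp_all add: W_def)
    also have "\<dots> \<le> W N * (\<beta> + len (Node B D) * R N + 1)
         + (len D + 1) * (W N * (\<beta> + len (Node B D) * R N + 1))"
      by (intro add_mono mult_le_mono2) simp_all
    finally show ?case by simp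
  qed
  have ub_b: "ub (\<lambda>N. W N + 2)" unfolding W_def using n(1) s(1) by (intro ub_intros)
  have "C (Node t (Node p (Node D Ds))) + 2 \<le> (len D + 1) * ((W N + 2) * (\<beta> + len D * R N + 1))"
    if "safe N p D Ds t" "bounded_table N \<beta> t" "len Ds \<le> N" for N \<beta> p D Ds t
  proof -
    have "2 \<le> (len D + 1) * (2 * (\<beta> + len D * R N + 1))" by simp
    from add_mono[OF cost[OF that] this] show ?thesis
      by (simp only: add_mult_distrib add_mult_distrib2)
  qed
  from that[OF ub_b n(2) C(1) this] show ?thesis .
qed

section \<open>The program\<close>

definition symbol_list :: "tree \<Rightarrow> tree list" where
  "symbol_list \<Sigma> = Leaf # map (Node Leaf) (lst \<Sigma>)"

text \<open>The code of \<open>guarded\<close>: \<open>code_nat 3\<close>, \<open>code_nat 5\<close>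
  and \<open>Leaf\<close> are the tags of \<open>And\<close>, \<open>Exists\<close> and
  \<open>Eq\<close>.\<close>

definition guard_fm :: "tree \<Rightarrow> tree \<Rightarrow> tree" where
  "guard_fm n t = foldr (\<lambda>v r. Node (code_nat 3) (Node (Node (code_nat 5) (Node n (Node Leaf (Node n v)))) r))
     (lst (vars n)) t"

definition columns :: "tree \<Rightarrow> tree \<Rightarrow> tree" where
  "columns \<Sigma> n = foldr (\<lambda>v r. enc (concat (map (\<lambda>col. map (\<lambda>a. Node (Node v a) col) (symbol_list \<Sigma>)) (lst r))))
     (lst (vars n)) (enc [Leaf])"

definition prepare :: "tree \<Rightarrow> tree" where
  "prepare x = (let \<Sigma> = left x; \<phi> = left (right (right (right x))); n = right (right (right (right x)))
     in Node (enc (symbol_list \<Sigma>)) (Node (guard_fm n \<phi>) (columns \<Sigma> n)))"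

lemma PR_prepare: "PR prepare"
  unfolding prepare_def Let_def symbol_list_def guard_fm_def columns_def
  by (intro PR_intros PR_vars)

text \<open>The empty word, counted once, in the common start state \<open>Leaf\<close>.\<close>

definition init_table :: tree where
  "init_table = Node (Node Leaf (Node (Node Leaf Leaf) Leaf)) Leaf"

definition count_main :: "tree \<Rightarrow> tree" where
  "count_main x = loop (prepare (left x)) (left (right x)) (right (right x)) init_table"

text \<open>The front part of length 1 in \<open>CT\<close> is filled by the expression itself,
  which thereby becomes function 0.\<close>

lemma CT_runs:
  assumes "CT F C"
  obtains P where "\<And>x. \<exists>t\<le>C x + 2. runs P x (F x) t"
proof -
  obtain R e where *: "\<And>Q S x. length Q = 1 \<Longrightarrow> ev (Q @ R @ S) x e (F x) (C x)"
    using CT_obtain[OF assms] by metis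
  have "\<exists>t\<le>C x + 2. runs ([e] @ R) x (F x) t" for x
  proof -
    have "ev ([e] @ R) x (Call 0 [Arg 0]) (F x) (1 + C x + 1)"
      using *[of "[e]" "[]" x] by (intro ev_Call[OF ev_Arg]) simp_all
    then show ?thesis by (simp add: ev_def runs_def)
  qed
  then show ?thesis by (rule that)
qed

lemma bounded_init_table: "1 \<le> N \<Longrightarrow> bounded_table N 1 init_table"
  by (simp add: bounded_table_def init_table_def)

theorem count_main_runs:
  obtains P b where "ub b" "\<And>N params D Ds. safe N (prepare params) D Ds init_table \<Longrightarrow> size params \<le> N \<Longrightarrow>
    len Ds \<le> N \<Longrightarrow> 1 \<le> N \<Longrightarrow> \<exists>t\<le>b N * (len D + 1)\<^sup>2. runs P (Node params (Node D Ds))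
      (loop (prepare params) D Ds init_table) t"
proof -
  obtain s where s: "ub s" "CT prepare (\<lambda>x. s (size x))" using PR_obtain[OF PR_prepare] by metis
  obtain L l R where l: "ub l" "ub R" "CT loop_args L"
    "\<And>N \<beta> p D Ds t. safe N p D Ds t \<Longrightarrow> bounded_table N \<beta> t \<Longrightarrow> len Ds \<le> N \<Longrightarrow>
      L (Node t (Node p (Node D Ds))) \<le> (len D + 1) * (l N * (\<beta> + len D * R N + 1))"
    by (rule CT_loop) blast
  have "CC (\<lambda>x. init_table)" "CC left" "CC right" by (intro CC_intros)+
  then obtain a b c where k: "CT (\<lambda>_. init_table) (\<lambda>_. a)" "CT left (\<lambda>_. b)" "CT right (\<lambda>_. c)"
    unfolding CC_def by (elim exE) (rule that; assumption)
  define A where "A x = Node init_table (Node (prepare (left x)) (right x))" for x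
  define M where "M x = a + b + c + s (size (left x)) + L (A x) + 4" for x
  have "CT (\<lambda>x. loop_args (A x)) M"
    unfolding A_def
    by (rule CT_mono[OF CT_comp[OF l(3) CT_Node[OF k(1) CT_Node[OF CT_comp[OF s(2) k(2)] k(3)]]]])
      (simp add: M_def A_def)
  then obtain P where P: "\<And>x. \<exists>t\<le>M x + 2. runs P x (loop_args (A x)) t"
    by (rule CT_runs) blast
  define B where "B N = a + b + c + s N + 6 + l N * (R N + 2)" for N
  have ub_B: "ub B" unfolding B_def using s(1) l(1,2) by (intro ub_intros)
  have "\<exists>t\<le>B N * (len D + 1)\<^sup>2. runs P (Node params (Node D Ds)) (loop (prepare params) D Ds init_table) t"
    if *: "safe N (prepare params) D Ds init_table" "size params \<le> N" "len Ds \<le> N" "1 \<le> N" for N params D Ds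
  proof -
    let ?x = "Node params (Node D Ds)"
    have "L (A ?x) \<le> (len D + 1) * (l N * (1 + len D * R N + 1))"
      unfolding A_def using l(4)[OF *(1) bounded_init_table[OF *(4)] *(3)] by simp
    also have "\<dots> \<le> (len D + 1) * (l N * ((R N + 2) * (len D + 1)))"
      by (intro mult_le_mono2) (simp add: algebra_simps)
    also have "\<dots> = l N * (R N + 2) * (len D + 1)\<^sup>2" by (simp only: power2_eq_square mult_ac)
    finally have 1: "L (A ?x) \<le> l N * (R N + 2) * (len D + 1)\<^sup>2" .
    have "M ?x + 2 \<le> (a + b + c + s N + 6) + L (A ?x)"
      using ub_mono[OF s(1) *(2)] by (simp add: M_def)
    also have "\<dots> \<le> (a + b + c + s N + 6) * (len D + 1)\<^sup>2 + l N * (R N + 2) * (len D + 1)\<^sup>2"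
      using 1 by (intro add_mono) simp_all
    also have "\<dots> = B N * (len D + 1)\<^sup>2" by (simp only: B_def add_mult_distrib)
    finally have "M ?x + 2 \<le> B N * (len D + 1)\<^sup>2" .
    then show ?thesis using P[of ?x] by (auto simp: loop_args_def A_def intro: le_trans)
  qed
  from that[OF ub_B this] show ?thesis .
qed

text \<open>The unary computation of the bound is preceded by measuring the input and followed by a
  conversion to binary, the required output format.\<close>

lemma computable_ub:
  assumes "ub b"
  shows "computable_on c A (\<lambda>x. b (size (c x)))"
proof -
  obtain F where F: "TC F" "\<And>n. F (un n) = un (b n)" using assms unfolding ub_def by blast
  obtain C D where C: "CT (\<lambda>x. un_to_bin x) C" "CT size_un D"
    using PR_obtain[OF PR_un_to_bin[OF PR_id]] PR_obtain[OF PR_size_un] by metis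
  have "TC (\<lambda>x. un_to_bin (F (size_un x)))"
    using TC_comp[OF CT_TC[OF C(1)] TC_comp[OF F(1) CT_TC[OF C(2)]]] .
  then obtain E where "CT (\<lambda>x. un_to_bin (F (size_un x))) E" unfolding TC_def by blast
  then obtain P where P: "\<And>x. \<exists>t\<le>E x + 2. runs P x (un_to_bin (F (size_un x))) t"
    by (rule CT_runs) blast
  show ?thesis
    unfolding computable_on_def
  proof (intro exI[of _ P] ballI)
    fix x
    show "\<exists>t. runs P (c x) (code_nat (b (size (c x)))) t"
      using P[of "c x"] by (auto simp: size_un_def F(2))
  qed
qed

section \<open>Tables as multisets of states\<close>

definition code_entry :: "tree \<times> nat \<Rightarrow> tree" where
  "code_entry e = Node (fst e) (code_nat (snd e))"

lemma code_entry_simps [simp]: "left (code_entry e) = fst e" "right (code_entry e) = code_nat (snd e)"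
  by (simp_all add: code_entry_def)

definition table_mset :: "(tree \<times> nat) list \<Rightarrow> tree multiset" where
  "table_mset xs = (\<Sum>e\<leftarrow>xs. replicate_mset (snd e) (fst e))"

lemma replicate_mset_add: "replicate_mset (m + n) x = replicate_mset m x + replicate_mset n x"
  by (induction m) simp_all

text \<open>Distinct keys let the number of possible states limit the rows. Positive counters
  exclude keys that no word reaches, whose size nothing would bound.\<close>

definition represents :: "tree \<Rightarrow> tree multiset \<Rightarrow> bool" where
  "represents t M \<longleftrightarrow> (\<exists>xs. t = enc (map code_entry xs) \<and> distinct (map fst xs) \<and>
     (\<forall>e\<in>set xs. 0 < snd e) \<and> M = table_mset xs)"

lemma insert_count_represents:
  assumes "represents t M" "0 < c"
  shows "represents (insert_count q (code_nat c) t) (M + replicate_mset c q)"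
proof -
  have "\<exists>ys. insert_count q (code_nat c) (enc (map code_entry xs)) = enc (map code_entry ys) \<and>
      distinct (map fst ys) \<and> (\<forall>e\<in>set ys. 0 < snd e) \<and> fst ` set ys = insert q (fst ` set xs) \<and>
      table_mset ys = table_mset xs + replicate_mset c q"
    if "distinct (map fst xs)" "\<forall>e\<in>set xs. 0 < snd e" for xs
    using that
  proof (induction xs)
    case Nil
    then show ?case using assms(2)
      by (intro exI[of _ "[(q, c)]"]) (simp add: code_entry_def table_mset_def)
  next
    case (Cons e xs)
    show ?case
    proof (cases "fst e = q")
      case True
      have "add_tree Leaf (code_nat c) (code_nat (snd e)) = code_nat (c + snd e)"
        using add_tree_code_nat[of False c "snd e"] by (simp add: code_bool_def)
      then show ?thesis using True Cons.prems assms(2)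
        by (intro exI[of _ "(q, c + snd e) # xs"])
          (auto simp: code_entry_def table_mset_def replicate_mset_add)
    next
      case False
      obtain ys where "insert_count q (code_nat c) (enc (map code_entry xs)) = enc (map code_entry ys)"
        "distinct (map fst ys)" "\<forall>e\<in>set ys. 0 < snd e" "fst ` set ys = insert q (fst ` set xs)"
        "table_mset ys = table_mset xs + replicate_mset c q"
        using Cons by auto
      then show ?thesis using False Cons.prems
        by (intro exI[of _ "e # ys"]) (auto simp: table_mset_def image_iff)
    qed
  qed
  then show ?thesis using assms(1) unfolding represents_def by metis
qed

lemma insert_all_represents:
  assumes "represents t M" "0 < c"
  shows "represents (insert_all (enc qs) (code_nat c) t) (M + (\<Sum>q\<leftarrow>qs. replicate_mset c q))"
proof (induction qs)
  case Nil
  then show ?case using assms by (simp add: insert_all_def)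
next
  case (Cons q qs)
  from insert_count_represents[OF this assms(2), of q] show ?case
    by (simp add: insert_all_def ac_simps)
qed

lemma sum_mset_replicate:
  "sum_mset (replicate_mset c (mset qs)) = (\<Sum>q\<leftarrow>qs. replicate_mset c q)"
proof (induction c)
  case 0
  show ?case by (induction qs) simp_all
next
  case (Suc c)
  have "(\<Sum>q\<leftarrow>qs. replicate_mset (Suc c) q) = mset qs + (\<Sum>q\<leftarrow>qs. replicate_mset c q)"
    by (induction qs) (simp_all add: ac_simps)
  with Suc show ?case by (simp only: replicate_mset_Suc sum_mset.add_mset)
qed

lemma filter_mset_replicate: "filter_mset P (replicate_mset n x) = (if P x then replicate_mset n x else {#})"
  by (induction n) auto

lemma represents_empty: "represents Leaf {#}"
  unfolding represents_def by (intro exI[of _ "[]"]) (simp add: table_mset_def)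

lemma new_table_represents:
  assumes "represents t M"
  shows "represents (new_table t ctx) (\<Sum>q\<in>#M. mset (lst (steps (Node q ctx))))"
proof -
  have "represents (new_table (enc (map code_entry xs)) ctx) (\<Sum>q\<in>#table_mset xs. mset (lst (steps (Node q ctx))))"
    if "\<forall>e\<in>set xs. 0 < snd e" for xs
    using that
  proof (induction xs)
    case Nil
    then show ?case by (simp add: new_table_def table_mset_def represents_empty)
  next
    case (Cons e xs)
    then have "represents (new_table (enc (map code_entry xs)) ctx) (\<Sum>q\<in>#table_mset xs. mset (lst (steps (Node q ctx))))"
      by simp
    from insert_all_represents[OF this, of "snd e" "lst (steps (Node (fst e) ctx))"] Cons.prems
    show ?case by (simp add: new_table_def table_mset_def sum_mset_replicate ac_simps)
  qed
  then show ?thesis using assms unfolding represents_def by blast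
qed

lemma accepted_count_represents:
  assumes "represents t M"
  shows "accepted_count t = code_nat (size (filter_mset (\<lambda>q. left q \<noteq> Leaf) M))"
proof -
  have add: "add_tree Leaf (code_nat m) (code_nat n) = code_nat (m + n)" for m n
    using add_tree_code_nat[of False m n] by (simp add: code_bool_def)
  have "accepted_count (enc (map code_entry xs)) = code_nat (size (filter_mset (\<lambda>q. left q \<noteq> Leaf) (table_mset xs)))" for xs
    by (induction xs) (auto simp: accepted_count_def table_mset_def add filter_mset_replicate)
  then show ?thesis using assms unfolding represents_def by blast
qed

lemma represents_keys:
  assumes "represents t M"
  shows "distinct (map left (lst t))" "left ` set (lst t) = set_mset M"
proof -
  obtain xs where xs: "t = enc (map code_entry xs)" "distinct (map fst xs)" "\<forall>e\<in>set xs. 0 < snd e"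
      "M = table_mset xs"
    using assms unfolding represents_def by blast
  show "distinct (map left (lst t))" using xs by (simp add: comp_def code_entry_def)
  have "set_mset (table_mset xs) = fst ` set xs"
    using xs(3) by (induction xs) (auto simp: table_mset_def)
  then show "left ` set (lst t) = set_mset M" using xs by (simp add: image_image code_entry_def)
qed

lemma init_table_represents: "represents init_table {#Leaf#}"
  unfolding represents_def
  by (intro exI[of _ "[(Leaf, 1)]"])
    (simp add: init_table_def code_entry_def table_mset_def code_nat_pos code_bool_def)

section \<open>Reachable states of a decision diagram\<close>

primrec reach :: "'s layer list \<Rightarrow> (nat \<Rightarrow> 's option) \<Rightarrow> nat \<Rightarrow> nat set" where
  "reach D s 0 = istates (D ! 0)"
| "reach D s (Suc j) = {q. \<exists>p\<in>reach D s j. (p, s j, q) \<in> transitions (D ! j)}"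

lemma reach_cong: "(\<And>i. i < j \<Longrightarrow> s i = s' i) \<Longrightarrow> reach D s j = reach D s' j"
  by (induction j) auto

lemma reach_iff:
  "y \<in> reach D s j \<longleftrightarrow> (\<exists>p. p 0 \<in> istates (D ! 0) \<and> p j = y \<and>
     (\<forall>i<j. (p i, s i, p (Suc i)) \<in> transitions (D ! i)))"
proof (induction j arbitrary: y)
  case 0
  then show ?case by (auto intro: exI[of _ "\<lambda>_. y"])
next
  case (Suc j)
  show ?case
  proof
    assume "y \<in> reach D s (Suc j)"
    then obtain z where z: "z \<in> reach D s j" "(z, s j, y) \<in> transitions (D ! j)" by auto
    from z(1)[unfolded Suc.IH] z(2) obtain p where p: "p 0 \<in> istates (D ! 0)"
      "(p j, s j, y) \<in> transitions (D ! j)" "\<forall>i<j. (p i, s i, p (Suc i)) \<in> transitions (D ! i)"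
      by blast
    then show "\<exists>p. p 0 \<in> istates (D ! 0) \<and> p (Suc j) = y \<and>
        (\<forall>i<Suc j. (p i, s i, p (Suc i)) \<in> transitions (D ! i))"
      by (intro exI[of _ "p(Suc j := y)"]) (simp add: less_Suc_eq)
  next
    assume "\<exists>p. p 0 \<in> istates (D ! 0) \<and> p (Suc j) = y \<and>
        (\<forall>i<Suc j. (p i, s i, p (Suc i)) \<in> transitions (D ! i))"
    then obtain p where "p 0 \<in> istates (D ! 0)" "p (Suc j) = y"
      "\<forall>i<Suc j. (p i, s i, p (Suc i)) \<in> transitions (D ! i)" by blast
    moreover from this have "p j \<in> reach D s j" unfolding Suc.IH by (intro exI[of _ p]) simp
    ultimately show "y \<in> reach D s (Suc j)" by auto
  qed
qed

lemma odd_accepts_reach: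
  assumes "D \<noteq> []"
  shows "odd_accepts D s \<longleftrightarrow> s \<noteq> [] \<and> length s \<le> length D \<and>
    reach D (padded_nth s) (length D) \<inter> fstates (D ! (length D - 1)) \<noteq> {}"
proof -
  obtain k where k: "length D = Suc k" using assms by (cases D) auto
  have "(\<exists>p q. (\<forall>i<length D. (p i, padded_nth s i, q i) \<in> transitions (D ! i)) \<and>
            (\<forall>i. Suc i < length D \<longrightarrow> p (Suc i) = q i) \<and>
            p 0 \<in> istates (D ! 0) \<and> q (length D - 1) \<in> fstates (D ! (length D - 1)))
     \<longleftrightarrow> reach D (padded_nth s) (length D) \<inter> fstates (D ! (length D - 1)) \<noteq> {}"  (is "?L = ?R")
  proof
    assume ?L
    then obtain p q where pq: "\<forall>i<length D. (p i, padded_nth s i, q i) \<in> transitions (D ! i)"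
      "\<forall>i. Suc i < length D \<longrightarrow> p (Suc i) = q i" "p 0 \<in> istates (D ! 0)"
      "q (length D - 1) \<in> fstates (D ! (length D - 1))" by blast
    \<comment> \<open>In an accepting run the right state of a layer is the left state of the next;
      \<open>r\<close> merges both sequences into one path with one state more than there are
      layers.\<close>
    define r where "r i = (case i of 0 \<Rightarrow> p 0 | Suc i \<Rightarrow> q i)" for i
    have r: "r i = p i" if "i < Suc k" for i
      using pq(2) that k by (cases i) (auto simp: r_def)
    have "r 0 \<in> istates (D ! 0)" "r (Suc k) = q k"
      "\<forall>i<Suc k. (r i, padded_nth s i, r (Suc i)) \<in> transitions (D ! i)"
      using pq(1,3) k by (simp_all add: r) (simp_all add: r_def)
    then have "q k \<in> reach D (padded_nth s) (Suc k)"
      unfolding reach_iff by blast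
    then show ?R using pq k by auto
  next
    assume ?R
    then obtain p where "p 0 \<in> istates (D ! 0)" "p (Suc k) \<in> fstates (D ! k)"
      "\<forall>i<Suc k. (p i, padded_nth s i, p (Suc i)) \<in> transitions (D ! i)"
      using k by (auto simp: reach_iff simp del: reach.simps)
    then show ?L using k by (intro exI[of _ p] exI[of _ "\<lambda>i. p (Suc i)"]) auto
  qed
  then show ?thesis unfolding odd_accepts_def by blast
qed

section \<open>Coded layers\<close>

lemma set_code_set: "finite A \<Longrightarrow> set (lst (code_set c A)) = c ` A"
  by (simp add: code_set_def code_list_enc[of c])

lemma inj_code_option: "inj c \<Longrightarrow> inj (code_option c)"
proof (rule injI)
  show "inj c \<Longrightarrow> code_option c x = code_option c y \<Longrightarrow> x = y" for x y
    by (cases x; cases y) (auto dest: injD)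
qed

lemma inj_code_list: "inj c \<Longrightarrow> inj (code_list c)"
proof (rule injI)
  show "inj c \<Longrightarrow> code_list c xs = code_list c ys \<Longrightarrow> xs = ys" for xs ys
  proof (induction xs arbitrary: ys)
    case Nil
    then show ?case by (cases ys) auto
  next
    case (Cons x xs)
    then show ?case by (cases ys) (auto dest: injD)
  qed
qed

lemma layer_code:
  "layer_right (code_layer c B) = code_set code_nat (rstates B)"
  "layer_trans (code_layer c B) = code_set (code_prod code_nat (code_prod (code_option c) code_nat)) (transitions B)"
  "layer_init (code_layer c B) = code_set code_nat (istates B)"
  "layer_fin (code_layer c B) = code_set code_nat (fstates B)"
  "layer_iflag (code_layer c B) = code_bool (iflag B)"
  "layer_fflag (code_layer c B) = code_bool (fflag B)"
  by (simp_all add: layer_defs code_layer_def)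

lemma finite_layer:
  assumes "B \<in> layers \<Sigma> w" "finite \<Sigma>"
  shows "finite (lstates B)" "finite (rstates B)" "finite (transitions B)" "finite (istates B)" "finite (fstates B)"
proof -
  show l: "finite (lstates B)" and r: "finite (rstates B)"
    using assms(1) finite_subset[OF _ finite_lessThan[of w]] by (auto simp: layers_def)
  then show "finite (istates B)" "finite (fstates B)"
    using assms(1) finite_subset by (auto simp: layers_def)
  show "finite (transitions B)"
    using assms l r finite_subset[of "transitions B" "lstates B \<times> insert None (Some ` \<Sigma>) \<times> rstates B"]
    by (auto simp: layers_def)
qed

text \<open>Everything is stated for the sets of entries, because order and repetitions in
  \<open>R\<close> have no influence. Comparing codes is sound as all codings are injective.\<close>

lemma post_code_layer:
  assumes B: "B \<in> layers \<Sigma> w" "finite \<Sigma>" and c: "inj c" and R: "set (lst R) = code_nat ` S"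
  shows "set (lst (post (code_layer c B) R (code_option c a))) = code_nat `
    {q. (\<exists>p\<in>if iflag B then istates B else S. (p, a, q) \<in> transitions B) \<and> (fflag B \<longrightarrow> q \<in> fstates B)}"
proof -
  note fin = finite_layer[OF B]
  have q: "q \<in> rstates B" if "(p, b, q) \<in> transitions B" for p b q
    using B(1) that by (auto simp: layers_def)
  have R': "set (lst (if iflag B then code_set code_nat (istates B) else R))
      = code_nat ` (if iflag B then istates B else S)"
    using R fin by (simp add: set_code_set)
  have ex: "(\<exists>t\<in>set (lst (layer_trans (code_layer c B))). left t \<in> code_nat ` P \<and> left (right t) = code_option c a \<and>
      right (right t) = code_nat q) \<longleftrightarrow> (\<exists>p\<in>P. (p, a, q) \<in> transitions B)" for P q
    using fin injD[OF inj_code_option[OF c]] by (force simp: layer_code set_code_set)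
  define Q where "Q t \<longleftrightarrow> (fflag B \<longrightarrow> t \<in> set (lst (layer_fin (code_layer c B)))) \<and>
     (\<exists>u\<in>set (lst (layer_trans (code_layer c B))).
        left u \<in> code_nat ` (if iflag B then istates B else S) \<and>
        left (right u) = code_option c a \<and> right (right u) = t)" for t
  have Q: "Q (code_nat q) \<longleftrightarrow> (fflag B \<longrightarrow> q \<in> fstates B) \<and>
      (\<exists>p\<in>if iflag B then istates B else S. (p, a, q) \<in> transitions B)" for q
    unfolding Q_def ex using fin by (simp add: layer_code set_code_set inj_image_mem_iff[OF inj_code_nat])
  have "post (code_layer c B) R (code_option c a) = enc (filter Q (lst (code_set code_nat (rstates B))))"
    unfolding post_def Q_def layer_code code_bool_eq_Leaf not_not R' ..
  then have "set (lst (post (code_layer c B) R (code_option c a))) = code_nat ` {q \<in> rstates B. Q (code_nat q)}"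
    using fin by (auto simp: set_code_set)
  also have "{q \<in> rstates B. Q (code_nat q)} =
      {q. (\<exists>p\<in>if iflag B then istates B else S. (p, a, q) \<in> transitions B) \<and> (fflag B \<longrightarrow> q \<in> fstates B)}"
    unfolding Q using q by blast
  finally show ?thesis .
qed

section \<open>Correctness of the automaton\<close>

definition code_symbol :: "nat option \<Rightarrow> tree" where
  "code_symbol = code_option code_nat"

definition code_tuple_layer :: "nat option list layer \<Rightarrow> tree" where
  "code_tuple_layer = code_layer (code_list (code_option code_nat))"

definition column_symbol :: "nat option list \<Rightarrow> nat option list option" where
  "column_symbol as = (if \<forall>a\<in>set as. a = None then None else Some as)"

lemma code_symbol_eq_Leaf [simp]: "code_symbol a = Leaf \<longleftrightarrow> a = None"
  by (cases a) (simp_all add: code_symbol_def)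

lemma code_symbol_None [simp]: "code_symbol None = Leaf"
  by (simp add: code_symbol_def)

lemma inj_code_symbol: "inj code_symbol"
  unfolding code_symbol_def by (intro inj_code_option inj_code_nat)

lemma code_symbol_inject [simp]: "code_symbol a = code_symbol b \<longleftrightarrow> a = b"
  using inj_code_symbol by (auto dest: injD)

lemma tuple_symbol_code:
  "tuple_symbol (map code_symbol as) = code_option (code_list (code_option code_nat)) (column_symbol as)"
  by (auto simp: tuple_symbol_def column_symbol_def code_list_enc[of code_symbol]
      code_symbol_def[symmetric])

lemma finite_tensor_alphabet: "finite \<Sigma> \<Longrightarrow> finite (tensor_alphabet \<Sigma> a)"
  using finite_lists_length_eq[of "insert None (Some ` \<Sigma>)" a]
  by (simp add: tensor_alphabet_def conj_commute)

locale structural_tuple =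
  fixes \<Sigma> :: "nat set" and w :: nat and \<tau> :: "nat list" and k :: nat
    and D0 :: "nat layer list" and Ds :: "nat option list layer list list"
  assumes fin: "finite \<Sigma>" and structural: "structural \<Sigma> w \<tau> k D0 Ds" and arity_pos: "\<forall>a\<in>set \<tau>. 1 \<le> a"
begin

definition symbols :: "nat option list" where
  "symbols = None # map Some (sorted_list_of_set \<Sigma>)"

lemma set_symbols: "set symbols = insert None (Some ` \<Sigma>)"
  using fin by (simp add: symbols_def)

definition sym_tree :: tree where "sym_tree = enc (map code_symbol symbols)"

definition ctx :: "nat \<Rightarrow> tree" where
  "ctx j = Node sym_tree (Node (code_layer code_nat (D0 ! j)) (enc (map (\<lambda>D. code_tuple_layer (D ! j)) Ds)))"

lemma odd_layers:
  assumes "D \<in> odds \<Gamma> w k" "j < k"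
  shows "D ! j \<in> layers \<Gamma> w" "iflag (D ! j) \<longleftrightarrow> j = 0" "fflag (D ! j) \<longleftrightarrow> Suc j = k"
proof -
  have "D ! j \<in> set D" using assms by (auto simp: odds_def)
  then show "D ! j \<in> layers \<Gamma> w" using assms by (auto simp: odds_def)
  show "iflag (D ! j) \<longleftrightarrow> j = 0" "fflag (D ! j) \<longleftrightarrow> Suc j = k" using assms by (auto simp: odds_def)
qed

lemma D0: "D0 \<in> odds \<Sigma> w k" and Ds: "i < length \<tau> \<Longrightarrow> Ds ! i \<in> odds (tensor_alphabet \<Sigma> (\<tau> ! i)) w k"
  and length_Ds: "length Ds = length \<tau>"
  using structural by (auto simp: structural_def)

lemma length_D0: "length D0 = k" and k_pos: "1 \<le> k"
  using D0 by (auto simp: odds_def)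

lemma length_Ds_nth: "i < length \<tau> \<Longrightarrow> length (Ds ! i) = k"
  using Ds by (auto simp: odds_def)

lemma ctx_simps [simp]:
  "ctx_symbols (ctx j) = map code_symbol symbols" "ctx_dom (ctx j) = code_layer code_nat (D0 ! j)"
  "ctx_rels (ctx j) = enc (map (\<lambda>D. code_tuple_layer (D ! j)) Ds)"
  by (simp_all add: ctx_def sym_tree_def)

lemma ctx_first [simp]: "j < k \<Longrightarrow> layer_iflag (code_layer code_nat (D0 ! j)) = Leaf \<longleftrightarrow> j \<noteq> 0"
  using odd_layers[OF D0] by (simp add: layer_code)

lemma ctx_rel_nth:
  assumes "i < length \<tau>"
  shows "left ((right ^^ i) (enc (map (\<lambda>D. code_tuple_layer (D ! j)) Ds))) = code_tuple_layer (Ds ! i ! j)"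
proof -
  have "left ((right ^^ i) (enc xs)) = xs ! i" if "i < length xs" for xs
    using that
  proof (induction i arbitrary: xs)
    case 0
    then show ?case by (cases xs) auto
  next
    case (Suc i)
    then obtain x ys where xs: "xs = x # ys" by (cases xs) auto
    have "(right ^^ Suc i) (enc xs) = (right ^^ i) (enc ys)"
      by (simp add: xs funpow_swap1 del: funpow.simps) (simp add: funpow_Suc_right del: funpow.simps)
    then show ?case using Suc by (simp add: xs)
  qed
  then show ?thesis using assms length_Ds by simp
qed

section \<open>Runs of the automata and the words they accept\<close>

primrec run :: "fm \<Rightarrow> (nat \<Rightarrow> nat \<Rightarrow> nat option) \<Rightarrow> nat \<Rightarrow> tree" where
  "run \<phi> e 0 = Leaf"
| "run \<phi> e (Suc j) = delta \<phi> (run \<phi> e j) (\<lambda>x. code_symbol (e x j)) (ctx j)"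

primrec dom_run :: "(nat \<Rightarrow> nat option) \<Rightarrow> nat \<Rightarrow> tree" where
  "dom_run u 0 = Leaf"
| "dom_run u (Suc j) = dom_step (code_layer code_nat (D0 ! j)) (dom_run u j) (code_symbol (u j))"

text \<open>A run depends only on the columns already read. This independence of past and future
  carries both the treatment of quantifiers and the recurrence for counting.\<close>

lemma run_cong: "(\<And>x i. i < j \<Longrightarrow> e x i = e' x i) \<Longrightarrow> run \<phi> e j = run \<phi> e' j"
  by (induction j) auto

lemma dom_run_cong: "(\<And>i. i < j \<Longrightarrow> u i = u' i) \<Longrightarrow> dom_run u j = dom_run u' j"
  by (induction j) auto

text \<open>Restricting to the final states after the last layer makes acceptance the nonemptiness of this set.\<close>

definition live :: "'s layer list \<Rightarrow> (nat \<Rightarrow> 's option) \<Rightarrow> nat \<Rightarrow> nat set" where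
  "live D s j = {q \<in> reach D s j. j = k \<longrightarrow> q \<in> fstates (D ! (k - 1))}"

text \<open>For \<open>j = 0\<close> nothing is assumed on \<open>R\<close>, since the first layer
  starts from its initial states.\<close>

lemma post_live:
  assumes D: "D \<in> odds \<Gamma> w k" and "finite \<Gamma>" "inj c" "j < k"
    and R: "0 < j \<Longrightarrow> set (lst R) = code_nat ` live D s j"
  shows "set (lst (post (code_layer c (D ! j)) R (code_option c (s j)))) = code_nat ` live D s (Suc j)"
proof -
  note l = odd_layers[OF D \<open>j < k\<close>]
  obtain S where S: "set (lst (if j = 0 then Leaf else R)) = code_nat ` S" "0 < j \<Longrightarrow> S = live D s j"
    using R by (cases "j = 0") (auto intro: that[of "{}"])
  have "post (code_layer c (D ! j)) R a = post (code_layer c (D ! j)) (if j = 0 then Leaf else R) a" for a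
    using l(2) by (simp add: post_def layer_code)
  moreover have "{q. (\<exists>p\<in>if iflag (D ! j) then istates (D ! j) else S. (p, s j, q) \<in> transitions (D ! j)) \<and>
      (fflag (D ! j) \<longrightarrow> q \<in> fstates (D ! j))} = live D s (Suc j)"
    using \<open>j < k\<close> S(2) unfolding l live_def by (cases "j = 0") auto
  ultimately show ?thesis
    using post_code_layer[OF l(1) \<open>finite \<Gamma>\<close> \<open>inj c\<close> S(1), of "s j"] by simp
qed

definition proper :: "(nat \<Rightarrow> nat option) \<Rightarrow> nat \<Rightarrow> bool" where
  "proper u j \<longleftrightarrow> u 0 \<noteq> None \<and> (\<forall>i. Suc i < j \<longrightarrow> u i = None \<longrightarrow> u (Suc i) = None)"

lemma dom_run:
  assumes "j < k"
  shows "left (dom_run u (Suc j)) = code_symbol (u j) \<and>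
    set (lst (right (dom_run u (Suc j)))) = (if proper u (Suc j) then code_nat ` live D0 u (Suc j) else {})"
  using assms
proof (induction j)
  case 0
  have "set (lst (post (code_layer code_nat (D0 ! 0)) Leaf (code_option code_nat (u 0)))) = code_nat ` live D0 u (Suc 0)"
    using 0 by (intro post_live[OF D0 fin inj_code_nat]) auto
  then show ?case using 0 ctx_first[of 0] by (auto simp: dom_step_def proper_def code_symbol_def[symmetric])
next
  case (Suc j)
  let ?B = "code_layer code_nat (D0 ! Suc j)" and ?R = "right (dom_run u (Suc j))"
  have IH: "left (dom_run u (Suc j)) = code_symbol (u j)"
    "set (lst ?R) = (if proper u (Suc j) then code_nat ` live D0 u (Suc j) else {})"
    using Suc by auto
  have first: "layer_iflag ?B = Leaf" using Suc.prems by simp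
  have proper: "proper u (Suc (Suc j)) \<longleftrightarrow> proper u (Suc j) \<and> (u j = None \<longrightarrow> u (Suc j) = None)"
    by (auto simp: proper_def less_Suc_eq)
  have step: "dom_run u (Suc (Suc j)) = Node (code_symbol (u (Suc j)))
      (if u j = None \<longrightarrow> u (Suc j) = None then post ?B ?R (code_symbol (u (Suc j))) else Leaf)"
    using IH(1) first by (subst dom_run.simps(2)) (simp only: dom_step_def code_symbol_eq_Leaf simp_thms if_False)
  have "set (lst (post ?B ?R (code_symbol (u (Suc j))))) = (if proper u (Suc j) then code_nat ` live D0 u (Suc (Suc j)) else {})"
  proof (cases "proper u (Suc j)")
    case True
    then show ?thesis
      unfolding code_symbol_def using IH(2) Suc.prems
      by (simp only: if_True) (intro post_live[OF D0 fin inj_code_nat], auto)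
  next
    case False
    \<comment> \<open>A track that has already failed owns no state, and only the first layer could
      introduce new ones.\<close>
    then have "?R = Leaf" using IH(2) by simp
    then show ?thesis using False first by (simp add: post_def)
  qed
  then show ?case
    unfolding step proper
    by (cases "u j = None \<longrightarrow> u (Suc j) = None"; cases "proper u (Suc j)") (auto simp del: dom_run.simps)
qed

lemma padded_nth_proper: "v \<noteq> [] \<Longrightarrow> proper (padded_nth v) j"
  by (auto simp: proper_def padded_nth_def)

lemma proper_obtain:
  assumes "proper u k" "\<And>i. u i \<in> set symbols"
  obtains v where "v \<noteq> []" "length v \<le> k" "v \<in> lists \<Sigma>" "\<And>i. i < k \<Longrightarrow> u i = padded_nth v i"
proof -
  \<comment> \<open>The length of the string: the first padded position, or \<open>k\<close> if no
    column before \<open>k\<close> is padded.\<close>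
  define l where "l = (LEAST i. i = k \<or> u i = None)"
  have l: "l = k \<or> u l = None" unfolding l_def by (rule LeastI[of _ k]) simp
  have lt: "u i \<noteq> None \<and> i \<noteq> k" if "i < l" for i using not_less_Least[OF that[unfolded l_def]] by blast
  have "l \<le> k" unfolding l_def by (rule Least_le) simp
  have None: "u i = None" if "l \<le> i" "i < k" for i
    using that
  proof (induction i rule: dec_induct)
    case base
    then show ?case using l by auto
  next
    case (step i)
    then show ?case using assms(1) by (simp add: proper_def)
  qed
  define v where "v = map (\<lambda>i. the (u i)) [0..<l]"
  have "u 0 \<noteq> None" using assms(1) by (simp add: proper_def)
  then have "l \<noteq> 0" using l k_pos by (cases l) auto
  show ?thesis
  proof
    show "v \<noteq> []" "length v \<le> k" using \<open>l \<noteq> 0\<close> \<open>l \<le> k\<close> by (simp_all add: v_def)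
    show "u i = padded_nth v i" if "i < k" for i
      using None[of i] lt[of i] that by (cases "i < l") (auto simp: v_def padded_nth_def)
    have "the (u i) \<in> \<Sigma>" if "i < l" for i
      using assms(2)[of i] lt[OF that] unfolding set_symbols by auto
    then show "v \<in> lists \<Sigma>" by (auto simp: v_def)
  qed
qed

lemma odd_lang_iff:
  assumes D: "D \<in> odds \<Gamma> w k"
  shows "v \<in> odd_lang \<Gamma> D \<longleftrightarrow> v \<in> lists \<Gamma> \<and> v \<noteq> [] \<and> length v \<le> k \<and> live D (padded_nth v) k \<noteq> {}"
proof -
  have "length D = k" "D \<noteq> []" using D by (auto simp: odds_def)
  then show ?thesis
    by (auto simp: odd_lang_def odd_accepts_reach live_def)
qed

lemma live_cong: "(\<And>i. i < j \<Longrightarrow> s i = s' i) \<Longrightarrow> live D s j = live D s' j"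
  unfolding live_def using reach_cong[of j s s'] by simp

text \<open>Trades tracks for elements of the domain. A track is unconstrained from column
  \<open>k\<close> on, so \<open>P\<close> must not look there.\<close>

lemma dom_run_accepts:
  "(\<exists>u. (\<forall>i. u i \<in> set symbols) \<and> right (dom_run u k) \<noteq> Leaf \<and> P u) \<longleftrightarrow>
    (\<exists>v\<in>odd_lang \<Sigma> D0. P (padded_nth v))"
  if P: "\<And>u u'. (\<And>i. i < k \<Longrightarrow> u i = u' i) \<Longrightarrow> P u \<Longrightarrow> P u'" for P
proof -
  obtain k' where k': "k = Suc k'" using k_pos by (cases k) auto
  have iff: "right (dom_run u k) \<noteq> Leaf \<longleftrightarrow> proper u k \<and> live D0 u k \<noteq> {}" for u
  proof -
    have "right (dom_run u k) \<noteq> Leaf \<longleftrightarrow> set (lst (right (dom_run u k))) \<noteq> {}" by simp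
    also have "\<dots> \<longleftrightarrow> proper u k \<and> live D0 u k \<noteq> {}"
      using dom_run[of k' u] unfolding k' by simp
    finally show ?thesis .
  qed
  show ?thesis
  proof
    assume "\<exists>u. (\<forall>i. u i \<in> set symbols) \<and> right (dom_run u k) \<noteq> Leaf \<and> P u"
    then obtain u where u: "\<And>i. u i \<in> set symbols" "proper u k" "live D0 u k \<noteq> {}" "P u"
      unfolding iff by blast
    obtain v where v: "v \<noteq> []" "length v \<le> k" "v \<in> lists \<Sigma>" "\<And>i. i < k \<Longrightarrow> u i = padded_nth v i"
      using proper_obtain[OF u(2,1)] by metis
    have "live D0 (padded_nth v) k \<noteq> {}" using u(3) live_cong[of k u "padded_nth v" D0] v(4) by simp
    then have "v \<in> odd_lang \<Sigma> D0" using v by (simp add: odd_lang_iff[OF D0])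
    moreover have "P (padded_nth v)" using P[OF v(4) u(4)] .
    ultimately show "\<exists>v\<in>odd_lang \<Sigma> D0. P (padded_nth v)" by blast
  next
    assume "\<exists>v\<in>odd_lang \<Sigma> D0. P (padded_nth v)"
    then obtain v where v: "v \<in> odd_lang \<Sigma> D0" "P (padded_nth v)" by blast
    then have "\<forall>i. padded_nth v i \<in> set symbols"
      by (auto simp: odd_lang_def padded_nth_def set_symbols)
    moreover have "right (dom_run (padded_nth v) k) \<noteq> Leaf"
      unfolding iff using v(1) by (auto simp: odd_lang_iff[OF D0] padded_nth_proper)
    ultimately show "\<exists>u. (\<forall>i. u i \<in> set symbols) \<and> right (dom_run u k) \<noteq> Leaf \<and> P u"
      using v(2) by blast
  qed
qed

lemma run_Eq: "j < k \<Longrightarrow> left (run (Eq x y) e (Suc j)) = code_bool (\<forall>i<Suc j. e x i = e y i)"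
proof (induction j)
  case 0
  then show ?case by (simp add: delta.simps(1))
next
  case (Suc j)
  then have "left (run (Eq x y) e (Suc j)) \<noteq> Leaf \<longleftrightarrow> (\<forall>i<Suc j. e x i = e y i)" by simp
  then show ?case using Suc.prems by (subst run.simps(2), subst delta.simps(1)) (auto simp: less_Suc_eq simp del: run.simps)
qed

text \<open>The set of states appears twice, as acceptance bit (it is \<open>Leaf\<close> iff empty)
  and as the information passed to the next layer.\<close>

lemma run_Rel:
  assumes "i < length \<tau>" "j < k"
  shows "\<exists>R. run (Rel i xs) e (Suc j) = Node R R \<and>
    set (lst R) = code_nat ` live (Ds ! i) (\<lambda>j. column_symbol (map (\<lambda>x. e x j) xs)) (Suc j)"
  using assms(2)
proof (induction j)
  case 0
  have "set (lst (post (code_tuple_layer (Ds ! i ! 0)) (right (run (Rel i xs) e 0))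
      (tuple_symbol (map (\<lambda>x. code_symbol (e x 0)) xs))))
    = code_nat ` live (Ds ! i) (\<lambda>j. column_symbol (map (\<lambda>x. e x j) xs)) (Suc 0)"
    using post_live[OF Ds[OF assms(1)] finite_tensor_alphabet[OF fin] inj_code_list[OF inj_code_option[OF inj_code_nat]],
        where j = 0 and s = "\<lambda>j. column_symbol (map (\<lambda>x. e x j) xs)"] 0
      tuple_symbol_code[of "map (\<lambda>x. e x 0) xs"]
    by (simp add: code_tuple_layer_def comp_def)
  then show ?case by (simp add: ctx_rel_nth[OF assms(1)] Let_def)
next
  case (Suc j)
  then obtain R where R: "run (Rel i xs) e (Suc j) = Node R R"
    "set (lst R) = code_nat ` live (Ds ! i) (\<lambda>j. column_symbol (map (\<lambda>x. e x j) xs)) (Suc j)" by auto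
  have "set (lst (post (code_tuple_layer (Ds ! i ! Suc j)) R
      (tuple_symbol (map (\<lambda>x. code_symbol (e x (Suc j))) xs))))
    = code_nat ` live (Ds ! i) (\<lambda>j. column_symbol (map (\<lambda>x. e x j) xs)) (Suc (Suc j))"
    using post_live[OF Ds[OF assms(1)] finite_tensor_alphabet[OF fin] inj_code_list[OF inj_code_option[OF inj_code_nat]],
        where j = "Suc j" and s = "\<lambda>j. column_symbol (map (\<lambda>x. e x j) xs)", OF _ R(2)] Suc.prems
      tuple_symbol_code[of "map (\<lambda>x. e x (Suc j)) xs"]
    by (simp add: code_tuple_layer_def comp_def)
  then show ?case
    by (subst run.simps(2)) (simp add: R(1) ctx_rel_nth[OF assms(1)] Let_def del: run.simps)
qed

lemma run_Neg: "right (run (Neg \<phi>) e j) = run \<phi> e j"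
  by (induction j) (auto simp: Let_def)

lemma run_And: "left (right (run (And \<phi> \<psi>) e j)) = run \<phi> e j \<and> right (right (run (And \<phi> \<psi>) e j)) = run \<psi> e j"
  by (induction j) (auto simp: Let_def)

lemma run_Or: "left (right (run (Or \<phi> \<psi>) e j)) = run \<phi> e j \<and> right (right (run (Or \<phi> \<psi>) e j)) = run \<psi> e j"
  by (induction j) (auto simp: Let_def)

text \<open>At \<open>j = 0\<close> the state is \<open>Leaf\<close> for every formula and carries
  no acceptance information, hence the restriction to positive \<open>j\<close>.\<close>

lemma run_bits:
  "0 < j \<Longrightarrow> left (run (Neg \<phi>) e j) \<noteq> Leaf \<longleftrightarrow> left (run \<phi> e j) = Leaf"
  "0 < j \<Longrightarrow> left (run (And \<phi> \<psi>) e j) \<noteq> Leaf \<longleftrightarrow> left (run \<phi> e j) \<noteq> Leaf \<and> left (run \<psi> e j) \<noteq> Leaf"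
  "0 < j \<Longrightarrow> left (run (Or \<phi> \<psi>) e j) \<noteq> Leaf \<longleftrightarrow> left (run \<phi> e j) \<noteq> Leaf \<or> left (run \<psi> e j) \<noteq> Leaf"
  by (cases j; simp add: Let_def run_Neg run_And run_Or)+

section \<open>Quantifiers as projections of tracks\<close>

definition quant_set :: "nat \<Rightarrow> fm \<Rightarrow> (nat \<Rightarrow> nat \<Rightarrow> nat option) \<Rightarrow> nat \<Rightarrow> tree set" where
  "quant_set x \<phi> e j = (\<lambda>u. Node (run \<phi> (e(x := u)) j) (dom_run u j)) ` {u. \<forall>i. u i \<in> set symbols}"

text \<open>Changing a track in column \<open>j\<close> leaves the runs over the earlier columns
  untouched, so the past of the track and its next symbol can be chosen independently. One layer of
  the automaton thus keeps exactly the reachable pairs.\<close>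

lemma quant_set_Suc:
  "(\<Union>p\<in>quant_set x \<phi> e j. (\<lambda>a. Node (delta \<phi> (left p) ((\<lambda>x. code_symbol (e x j))(x := a)) (ctx j))
      (dom_step (code_layer code_nat (D0 ! j)) (right p) a)) ` code_symbol ` set symbols)
    = quant_set x \<phi> e (Suc j)" (is "?L = ?R")
proof -
  have upd: "(\<lambda>z. code_symbol ((e(x := u)) z j)) = (\<lambda>z. code_symbol (e z j))(x := code_symbol (u j))" for u
    by auto
  show ?thesis
  proof
    show "?L \<subseteq> ?R"
    proof
      fix t assume "t \<in> ?L"
      then obtain u a where u: "\<forall>i. u i \<in> set symbols" and a: "a \<in> set symbols"
        and t: "t = Node (delta \<phi> (run \<phi> (e(x := u)) j) ((\<lambda>x. code_symbol (e x j))(x := code_symbol a)) (ctx j))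
          (dom_step (code_layer code_nat (D0 ! j)) (dom_run u j) (code_symbol a))"
        by (auto simp: quant_set_def)
      define u' where "u' = u(j := a)"
      have "run \<phi> (e(x := u)) j = run \<phi> (e(x := u')) j" by (rule run_cong) (simp add: u'_def)
      moreover have "dom_run u j = dom_run u' j" by (rule dom_run_cong) (simp add: u'_def)
      moreover have "u' j = a" by (simp add: u'_def)
      ultimately have "t = Node (run \<phi> (e(x := u')) (Suc j)) (dom_run u' (Suc j))"
        unfolding t run.simps dom_run.simps upd by simp
      moreover have "\<forall>i. u' i \<in> set symbols" using u a by (simp add: u'_def)
      ultimately show "t \<in> ?R" unfolding quant_set_def by blast
    qed
    show "?R \<subseteq> ?L"
    proof
      fix t assume "t \<in> ?R"
      then obtain u where u: "\<forall>i. u i \<in> set symbols" and t: "t = Node (run \<phi> (e(x := u)) (Suc j)) (dom_run u (Suc j))"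
        by (auto simp: quant_set_def)
      have "Node (run \<phi> (e(x := u)) j) (dom_run u j) \<in> quant_set x \<phi> e j" using u by (auto simp: quant_set_def)
      moreover have "t = (\<lambda>a. Node (delta \<phi> (left (Node (run \<phi> (e(x := u)) j) (dom_run u j)))
            ((\<lambda>x. code_symbol (e x j))(x := a)) (ctx j))
          (dom_step (code_layer code_nat (D0 ! j)) (right (Node (run \<phi> (e(x := u)) j) (dom_run u j))) a)) (code_symbol (u j))"
        unfolding t run.simps dom_run.simps upd by simp
      ultimately show "t \<in> ?L" using u by blast
    qed
  qed
qed

lemma set_delta_quant:
  assumes "\<psi> = Exists x \<phi> \<or> \<psi> = Forall x \<phi>"
  shows "set (lst (right (delta \<psi> q c (ctx j)))) =
    (\<Union>p\<in>set (quant_states (ctx j) q). (\<lambda>a. Node (delta \<phi> (left p) (c(x := a)) (ctx j))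
      (dom_step (code_layer code_nat (D0 ! j)) (right p) a)) ` code_symbol ` set symbols)"
  using assms by (elim disjE) (simp_all add: Let_def image_image)

lemma quant_states_run:
  assumes "\<psi> = Exists x \<phi> \<or> \<psi> = Forall x \<phi>" "j < k"
  shows "set (quant_states (ctx j) (run \<psi> e j)) = quant_set x \<phi> e j \<and>
    set (lst (right (run \<psi> e (Suc j)))) = quant_set x \<phi> e (Suc j)"
  using assms(2)
proof (induction j)
  case 0
  have "{u. \<forall>i. u i \<in> set symbols} \<noteq> {}" by (auto simp: set_symbols intro!: exI[of _ "\<lambda>_. None"])
  then have 1: "set (quant_states (ctx 0) (run \<psi> e 0)) = quant_set x \<phi> e 0"
    using 0 by (auto simp: quant_states_def quant_set_def)
  have "set (lst (right (run \<psi> e (Suc 0)))) = quant_set x \<phi> e (Suc 0)"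
    unfolding run.simps(2)[of _ _ 0] set_delta_quant[OF assms(1)] 1 by (rule quant_set_Suc)
  with 1 show ?case by simp
next
  case (Suc j)
  have 1: "set (quant_states (ctx (Suc j)) (run \<psi> e (Suc j))) = quant_set x \<phi> e (Suc j)"
    using Suc by (simp add: quant_states_def del: run.simps)
  have "set (lst (right (run \<psi> e (Suc (Suc j))))) = quant_set x \<phi> e (Suc (Suc j))"
    unfolding run.simps(2)[of _ _ "Suc j"] set_delta_quant[OF assms(1)] 1 by (rule quant_set_Suc)
  with 1 show ?case by simp
qed

lemma quant_set_accepts:
  "(\<exists>p\<in>quant_set x \<phi> e k. right (right p) \<noteq> Leaf \<and> Q (left (left p))) \<longleftrightarrow>
    (\<exists>v\<in>odd_lang \<Sigma> D0. Q (left (run \<phi> (e(x := padded_nth v)) k)))"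
proof -
  have "(\<exists>p\<in>quant_set x \<phi> e k. right (right p) \<noteq> Leaf \<and> Q (left (left p))) \<longleftrightarrow>
      (\<exists>u. (\<forall>i. u i \<in> set symbols) \<and> right (dom_run u k) \<noteq> Leaf \<and> Q (left (run \<phi> (e(x := u)) k)))"
    by (auto simp: quant_set_def)
  also have "\<dots> \<longleftrightarrow> (\<exists>v\<in>odd_lang \<Sigma> D0. Q (left (run \<phi> (e(x := padded_nth v)) k)))"
  proof (rule dom_run_accepts)
    fix u u' assume "\<And>i. i < k \<Longrightarrow> u i = u' i" "Q (left (run \<phi> (e(x := u)) k))"
    then show "Q (left (run \<phi> (e(x := u')) k))"
      using run_cong[of k "e(x := u)" "e(x := u')" \<phi>] by simp
  qed
  finally show ?thesis .
qed

text \<open>A universal quantifier fails iff some pair accepts in the domain and rejects in the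
  body. Both statements are instances of \<open>quant_set_accepts\<close>, with acceptance and with
  rejection of the body.\<close>

lemma run_quant:
  "left (run (Exists x \<phi>) e k) \<noteq> Leaf \<longleftrightarrow> (\<exists>v\<in>odd_lang \<Sigma> D0. left (run \<phi> (e(x := padded_nth v)) k) \<noteq> Leaf)"
  "left (run (Forall x \<phi>) e k) \<noteq> Leaf \<longleftrightarrow> (\<forall>v\<in>odd_lang \<Sigma> D0. left (run \<phi> (e(x := padded_nth v)) k) \<noteq> Leaf)"
proof -
  obtain k' where k': "k = Suc k'" using k_pos by (cases k) auto
  have "left (run (Exists x \<phi>) e (Suc k')) = ex_bit (lst (right (run (Exists x \<phi>) e (Suc k'))))"
    "left (run (Forall x \<phi>) e (Suc k')) = all_bit (lst (right (run (Forall x \<phi>) e (Suc k'))))"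
    by (simp_all add: Let_def)
  then have "left (run (Exists x \<phi>) e k) \<noteq> Leaf \<longleftrightarrow>
      (\<exists>p\<in>quant_set x \<phi> e k. right (right p) \<noteq> Leaf \<and> left (left p) \<noteq> Leaf)"
    and "left (run (Forall x \<phi>) e k) \<noteq> Leaf \<longleftrightarrow>
      \<not> (\<exists>p\<in>quant_set x \<phi> e k. right (right p) \<noteq> Leaf \<and> left (left p) = Leaf)"
    using quant_states_run[of "Exists x \<phi>" x \<phi> k' e] quant_states_run[of "Forall x \<phi>" x \<phi> k' e]
    by (auto simp: ex_bit_def all_bit_def k' simp del: run.simps)
  then show "left (run (Exists x \<phi>) e k) \<noteq> Leaf \<longleftrightarrow> (\<exists>v\<in>odd_lang \<Sigma> D0. left (run \<phi> (e(x := padded_nth v)) k) \<noteq> Leaf)"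
    "left (run (Forall x \<phi>) e k) \<noteq> Leaf \<longleftrightarrow> (\<forall>v\<in>odd_lang \<Sigma> D0. left (run \<phi> (e(x := padded_nth v)) k) \<noteq> Leaf)"
    using quant_set_accepts[of x \<phi> e "\<lambda>t. t \<noteq> Leaf"] quant_set_accepts[of x \<phi> e "\<lambda>t. t = Leaf"] by auto
qed

lemma padded_nth_inject:
  assumes "length u \<le> k" "length v \<le> k" "\<forall>i<k. padded_nth u i = padded_nth v i"
  shows "u = v"
proof -
  have "length u = length v"
    using assms by (metis (no_types) linorder_neqE_nat less_le_trans option.distinct(1) padded_nth_def nat_less_le)
  moreover have "u ! i = v ! i" if "i < length u" for i
    using assms(3)[rule_format, of i] assms(1) that calculation by (simp add: padded_nth_def)
  ultimately show ?thesis by (rule nth_equalityI)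
qed

text \<open>The tensor product ends with its longest component, so a column lies beyond it iff every
  component is padded there.\<close>

lemma padded_nth_tensor:
  assumes "us \<noteq> []"
  shows "padded_nth (tensor us) j = column_symbol (map (\<lambda>u. padded_nth u j) us)"
proof -
  have "j < Max (length ` set us) \<longleftrightarrow> (\<exists>u\<in>set us. j < length u)"
    using assms by (subst Max_gr_iff) auto
  then show ?thesis
    by (auto simp: padded_nth_def[of "tensor us"] tensor_def column_symbol_def padded_nth_def)
qed

lemma tensor_lists:
  assumes "set us \<subseteq> lists \<Sigma>" "length us = a"
  shows "tensor us \<in> lists (tensor_alphabet \<Sigma> a)"
proof -
  have "padded_nth u j \<in> insert None (Some ` \<Sigma>)" if "u \<in> set us" for u j
    using assms(1) that by (auto simp: padded_nth_def)
  then have "map (\<lambda>u. padded_nth u j) us \<in> tensor_alphabet \<Sigma> a" for j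
    using assms(2) unfolding tensor_alphabet_def by (simp add: image_subset_iff)
  then show ?thesis by (auto simp: tensor_def)
qed

text \<open>Agreement of \<open>e\<close> with the assignment is demanded for free variables and for
  the first \<open>k\<close> columns only; the induction can then overwrite the track of a bound
  variable.\<close>

lemma run_sat:
  assumes "wf_fm \<tau> \<phi>"
    "\<And>x. x \<in> free_vars \<phi> \<Longrightarrow> vs x \<in> odd_lang \<Sigma> D0 \<and> (\<forall>i<k. e x i = padded_nth (vs x) i)"
  shows "left (run \<phi> e k) \<noteq> Leaf \<longleftrightarrow> sat (derived_structure \<Sigma> \<tau> D0 Ds) vs \<phi>"
  using assms
proof (induction \<phi> arbitrary: e vs)
  case (Eq x y)
  obtain k' where k': "k = Suc k'" using k_pos by (cases k) auto
  have "left (run (Eq x y) e k) \<noteq> Leaf \<longleftrightarrow> (\<forall>i<k. e x i = e y i)"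
    using run_Eq[of k' x y e] by (simp add: k' del: run.simps)
  also have "\<dots> \<longleftrightarrow> (\<forall>i<k. padded_nth (vs x) i = padded_nth (vs y) i)"
    using Eq.prems(2) by simp
  also have "\<dots> \<longleftrightarrow> vs x = vs y"
    using padded_nth_inject[of "vs x" "vs y"] Eq.prems(2) by (auto simp: odd_lang_iff[OF D0])
  finally show ?case by simp
next
  case (Rel i xs)
  then have i: "i < length \<tau>" and len: "length xs = \<tau> ! i" by auto
  let ?us = "map vs xs" and ?s = "\<lambda>j. column_symbol (map (\<lambda>x. e x j) xs)"
  obtain k' where k': "k = Suc k'" using k_pos by (cases k) auto
  obtain R where R: "run (Rel i xs) e k = Node R R" "set (lst R) = code_nat ` live (Ds ! i) ?s k"
    using run_Rel[OF i, of k' xs e] unfolding k' by auto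
  \<comment> \<open>Positive arity makes the list of strings nonempty, so that \<open>Max\<close> in
    \<open>tensor\<close> is taken over a nonempty set.\<close>
  have "1 \<le> \<tau> ! i" using arity_pos i by auto
  then have ne: "?us \<noteq> []" using len by auto
  have us: "u \<in> lists \<Sigma> \<and> u \<noteq> [] \<and> length u \<le> k" if "u \<in> set ?us" for u
    using Rel.prems(2) that by (auto simp: odd_lang_iff[OF D0])
  have "?s j = padded_nth (tensor ?us) j" if "j < k" for j
  proof -
    have "map (\<lambda>x. e x j) xs = map (\<lambda>u. padded_nth u j) ?us" using Rel.prems(2) that by simp
    then show ?thesis unfolding padded_nth_tensor[OF ne] by (rule arg_cong)
  qed
  then have live: "live (Ds ! i) ?s k = live (Ds ! i) (padded_nth (tensor ?us)) k" by (rule live_cong)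
  have "length (tensor ?us) \<le> k"
    unfolding tensor_def using us ne by (simp del: map_map)
  moreover have "tensor ?us \<noteq> []"
  proof -
    obtain u where u: "u \<in> set ?us" using ne by (metis ex_in_conv set_empty)
    then have "0 < length u" using us by auto
    then have "0 < Max (length ` set ?us)" using u by (subst Max_gr_iff) auto
    then show ?thesis by (simp add: tensor_def)
  qed
  moreover have "tensor ?us \<in> lists (tensor_alphabet \<Sigma> (\<tau> ! i))"
    using us len by (intro tensor_lists) auto
  ultimately have "tensor ?us \<in> odd_lang (tensor_alphabet \<Sigma> (\<tau> ! i)) (Ds ! i) \<longleftrightarrow> live (Ds ! i) ?s k \<noteq> {}"
    unfolding odd_lang_iff[OF Ds[OF i]] live by simp
  moreover have "left (run (Rel i xs) e k) \<noteq> Leaf \<longleftrightarrow> live (Ds ! i) ?s k \<noteq> {}"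
    using R by (metis image_is_empty left.simps(2) lst_eq_Nil set_empty)
  moreover have "[] \<notin> set ?us" using us by blast
  ultimately show ?case using len by (simp add: derived_structure_def relation_of_def)
next
  case (Neg \<phi>)
  then have "left (run \<phi> e k) \<noteq> Leaf \<longleftrightarrow> sat (derived_structure \<Sigma> \<tau> D0 Ds) vs \<phi>" by simp
  then show ?case using run_bits(1)[of k \<phi> e] k_pos by auto
next
  case (And \<phi> \<psi>)
  have "left (run \<phi> e k) \<noteq> Leaf \<longleftrightarrow> sat (derived_structure \<Sigma> \<tau> D0 Ds) vs \<phi>"
    using And.prems by (intro And.IH) auto
  moreover have "left (run \<psi> e k) \<noteq> Leaf \<longleftrightarrow> sat (derived_structure \<Sigma> \<tau> D0 Ds) vs \<psi>"
    using And.prems by (intro And.IH) auto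
  ultimately show ?case using run_bits(2)[of k \<phi> \<psi> e] k_pos by auto
next
  case (Or \<phi> \<psi>)
  have "left (run \<phi> e k) \<noteq> Leaf \<longleftrightarrow> sat (derived_structure \<Sigma> \<tau> D0 Ds) vs \<phi>"
    using Or.prems by (intro Or.IH) auto
  moreover have "left (run \<psi> e k) \<noteq> Leaf \<longleftrightarrow> sat (derived_structure \<Sigma> \<tau> D0 Ds) vs \<psi>"
    using Or.prems by (intro Or.IH) auto
  ultimately show ?case using run_bits(3)[of k \<phi> \<psi> e] k_pos by auto
next
  case (Exists x \<phi>)
  have "left (run \<phi> (e(x := padded_nth v)) k) \<noteq> Leaf \<longleftrightarrow> sat (derived_structure \<Sigma> \<tau> D0 Ds) (vs(x := v)) \<phi>"
    if "v \<in> odd_lang \<Sigma> D0" for v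
    using Exists.prems that by (intro Exists.IH) auto
  then show ?case unfolding run_quant(1) by (simp add: derived_structure_def)
next
  case (Forall x \<phi>)
  have "left (run \<phi> (e(x := padded_nth v)) k) \<noteq> Leaf \<longleftrightarrow> sat (derived_structure \<Sigma> \<tau> D0 Ds) (vs(x := v)) \<phi>"
    if "v \<in> odd_lang \<Sigma> D0" for v
    using Forall.prems that by (intro Forall.IH) auto
  then show ?case unfolding run_quant(2) by (simp add: derived_structure_def)
qed

end

section \<open>Counting solutions\<close>

text \<open>The conjuncts \<open>\<exists>x\<^sub>n. x\<^sub>n = x\<^sub>i\<close> force every counted track into the domain.\<close>

definition guarded :: "nat \<Rightarrow> nat list \<Rightarrow> fm \<Rightarrow> fm" where
  "guarded n is \<phi> = foldr (\<lambda>i r. And (Exists n (Eq n i)) r) is \<phi>"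

lemma code_guarded: "code_fm (guarded n (rev [0..<n]) \<phi>) = guard_fm (code_nat n) (code_fm \<phi>)"
proof -
  have "code_fm (guarded n is \<phi>) = foldr (\<lambda>v r. Node (code_nat 3) (Node (Node (code_nat 5) (Node (code_nat n)
      (Node Leaf (Node (code_nat n) v)))) r)) (map code_nat is) (code_fm \<phi>)" for "is"
    by (induction "is") (simp_all add: guarded_def)
  then show ?thesis by (simp add: guard_fm_def)
qed

lemma concat_map_product: "concat (map (\<lambda>x. map (g x) ys) xs) = map (\<lambda>(x, y). g x y) (List.product xs ys)"
  by (simp add: product_concat_map map_concat comp_def)

lemma distinct_concat_map:
  assumes "distinct xs" "distinct ys" "inj_on (\<lambda>(x, y). g x y) (set xs \<times> set ys)"
  shows "distinct (concat (map (\<lambda>x. map (g x) ys) xs))"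
  unfolding concat_map_product using assms by (simp add: distinct_map distinct_product)

primrec assignments :: "nat option list \<Rightarrow> nat list \<Rightarrow> (nat \<times> nat option) list list" where
  "assignments as [] = [[]]"
| "assignments as (v # vs) = concat (map (\<lambda>l. map (\<lambda>a. (v, a) # l) as) (assignments as vs))"

definition assignment_fun :: "(nat \<times> nat option) list \<Rightarrow> nat \<Rightarrow> nat option" where
  "assignment_fun l x = (case map_of l x of None \<Rightarrow> None | Some a \<Rightarrow> a)"

definition assignment_tree :: "(nat \<times> nat option) list \<Rightarrow> tree" where
  "assignment_tree l = enc (map (\<lambda>p. Node (code_nat (fst p)) (code_symbol (snd p))) l)"

lemma assignment_fun_simps [simp]:
  "assignment_fun [] = (\<lambda>_. None)" "assignment_fun ((v, a) # l) = (assignment_fun l)(v := a)"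
  by (auto simp: assignment_fun_def fun_eq_iff)

lemma look_assignment_tree [simp]: "look (code_nat x) (assignment_tree l) = code_symbol (assignment_fun l x)"
proof (induction l)
  case (Cons p l)
  then show ?case by (cases p) (auto simp: assignment_tree_def)
qed (simp add: assignment_tree_def)

lemma columns_assignments:
  assumes "symbol_list S = map code_symbol as"
  shows "columns S (code_nat n) = enc (map assignment_tree (assignments as (rev [0..<n])))"
proof -
  have "foldr (\<lambda>v r. enc (concat (map (\<lambda>col. map (\<lambda>a. Node (Node v a) col) (map code_symbol as)) (lst r))))
     (map code_nat vs) (enc [Leaf]) = enc (map assignment_tree (assignments as vs))" for vs
  proof (induction vs)
    case (Cons v vs)
    have "(\<lambda>col. map (\<lambda>a. Node (Node (code_nat v) a) col) (map code_symbol as)) \<circ> assignment_tree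
        = (\<lambda>l. map assignment_tree (map (\<lambda>a. (v, a) # l) as))"
      by (simp add: fun_eq_iff assignment_tree_def)
    with Cons show ?case by (simp add: map_concat comp_def)
  qed (simp add: assignment_tree_def)
  then show ?thesis using assms by (simp add: columns_def)
qed

text \<open>Words are counted as functions, so distinctness is needed after passing from association
  lists to functions. The value \<open>None\<close> outside \<open>vs\<close> makes the function
  unique.\<close>

lemma assignments_funs:
  assumes "distinct as" "distinct vs"
  shows "distinct (map assignment_fun (assignments as vs)) \<and> set (map assignment_fun (assignments as vs)) =
    {f. (\<forall>x\<in>set vs. f x \<in> set as) \<and> (\<forall>x. x \<notin> set vs \<longrightarrow> f x = None)}"
  using assms(2)
proof (induction vs)
  case Nil
  show ?case by auto
next
  case (Cons v vs)
  let ?F = "map assignment_fun (assignments as vs)"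
  have IH: "distinct ?F" "set ?F = {f. (\<forall>x\<in>set vs. f x \<in> set as) \<and> (\<forall>x. x \<notin> set vs \<longrightarrow> f x = None)}"
    and v: "v \<notin> set vs" using Cons by auto
  have eq: "map assignment_fun (assignments as (v # vs)) = concat (map (\<lambda>f. map (\<lambda>a. f(v := a)) as) ?F)"
    by (simp add: map_concat comp_def)
  have None: "f v = None" if "f \<in> set ?F" for f using that v unfolding IH(2) by blast
  have "inj_on (\<lambda>(f, a). f(v := a)) (set ?F \<times> set as)"
  proof (rule inj_onI, clarify)
    fix f a g b assume f: "f \<in> set ?F" "g \<in> set ?F" and *: "f(v := a) = g(v := b)"
    have "f = (f(v := a))(v := None)" "g = (g(v := b))(v := None)" using None f by auto
    moreover have "a = b" using fun_cong[OF *, of v] by simp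
    ultimately show "f = g \<and> a = b" using * by metis
  qed
  then have "distinct (concat (map (\<lambda>f. map (\<lambda>a. f(v := a)) as) ?F))"
    by (intro distinct_concat_map IH assms)
  moreover have "set (concat (map (\<lambda>f. map (\<lambda>a. f(v := a)) as) ?F)) =
      {f. (\<forall>x\<in>set (v # vs). f x \<in> set as) \<and> (\<forall>x. x \<notin> set (v # vs) \<longrightarrow> f x = None)}" (is "?L = ?R")
  proof
    have L: "?L = (\<Union>f\<in>set ?F. (\<lambda>a. f(v := a)) ` set as)" by simp
    show "?L \<subseteq> ?R" unfolding L IH(2) using v by auto
    show "?R \<subseteq> ?L"
    proof
      fix f assume f: "f \<in> ?R"
      then have "f(v := None) \<in> set ?F" unfolding IH(2) using v by auto
      moreover have "f \<in> (\<lambda>a. (f(v := None))(v := a)) ` set as"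
        using f by (intro image_eqI[of _ _ "f v"]) auto
      ultimately show "f \<in> ?L" unfolding L by (rule UN_I[of "f(v := None)"])
    qed
  qed
  ultimately show ?case unfolding eq by blast
qed

section \<open>Counting words by the states they reach\<close>

context structural_tuple
begin

lemma distinct_symbols: "distinct symbols"
  by (simp add: symbols_def distinct_map)

definition cols :: "nat \<Rightarrow> (nat \<Rightarrow> nat option) list" where
  "cols n = map assignment_fun (assignments symbols (rev [0..<n]))"

lemma cols: "distinct (cols n)" "set (cols n) = {f. (\<forall>x<n. f x \<in> set symbols) \<and> (\<forall>x. \<not> x < n \<longrightarrow> f x = None)}"
  using assignments_funs[OF distinct_symbols, of "rev [0..<n]"] unfolding cols_def by auto

text \<open>The default \<open>None\<close> outside of \<open>n\<close> tracks and \<open>j\<close>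
  columns gives each word a single representative, so the length of the list is the number of
  words.\<close>

primrec words :: "nat \<Rightarrow> nat \<Rightarrow> (nat \<Rightarrow> nat \<Rightarrow> nat option) list" where
  "words n 0 = [\<lambda>_ _. None]"
| "words n (Suc j) = concat (map (\<lambda>e. map (\<lambda>f x i. if i = j then f x else e x i) (cols n)) (words n j))"

lemma words: "distinct (words n j) \<and> set (words n j) =
    {e. \<forall>x i. if x < n \<and> i < j then e x i \<in> set symbols else e x i = None}"
proof (induction j)
  case 0
  show ?case by (auto simp: fun_eq_iff)
next
  case (Suc j)
  let ?g = "\<lambda>e f x i. if i = j then f x else e x i"
  have None: "e x j = None" if "e \<in> set (words n j)" for e x using that Suc by auto
  have "inj_on (\<lambda>(e, f). ?g e f) (set (words n j) \<times> set (cols n))"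
  proof (rule inj_onI, clarify)
    fix e f e' f' assume e: "e \<in> set (words n j)" "e' \<in> set (words n j)" and *: "?g e f = ?g e' f'"
    have **: "?g e f x i = ?g e' f' x i" for x i using * by meson
    have "f x = f' x" for x using **[of j x] by simp
    moreover have "e x i = e' x i" for x i using **[of i x] None[OF e(1)] None[OF e(2)] by (cases "i = j") auto
    ultimately show "e = e' \<and> f = f'" by blast
  qed
  then have "distinct (words n (Suc j))"
    unfolding words.simps using Suc cols by (intro distinct_concat_map) auto
  moreover have "set (words n (Suc j)) =
    {e. \<forall>x i. if x < n \<and> i < Suc j then e x i \<in> set symbols else e x i = None}" (is "_ = ?R")
  proof
    have eq: "set (words n (Suc j)) = (\<Union>e\<in>set (words n j). ?g e ` set (cols n))" by simp
    show "set (words n (Suc j)) \<subseteq> ?R"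
      unfolding eq using Suc cols(2) by (fastforce simp: less_Suc_eq)
    show "?R \<subseteq> set (words n (Suc j))"
    proof
      fix e assume e: "e \<in> ?R"
      \<comment> \<open>Resetting column \<open>j\<close> to the default recovers the shorter word
        of which \<open>e\<close> is an extension.\<close>
      define e' where "e' x i = (if i = j then None else e x i)" for x i
      have e: "if x < n \<and> i < Suc j then e x i \<in> set symbols else e x i = None" for x i
        using e by blast
      have "if x < n \<and> i < j then e' x i \<in> set symbols else e' x i = None" for x i
        using e[of x i] by (cases "i = j"; cases "x < n \<and> i < j") (auto simp: e'_def)
      then have "e' \<in> set (words n j)" using Suc by blast
      moreover have col: "(\<lambda>x. e x j) \<in> set (cols n)"
        unfolding cols(2) mem_Collect_eq using e[of _ j] by (metis lessI)
      have "e = ?g e' (\<lambda>x. e x j)" by (simp add: e'_def fun_eq_iff)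
      then have "e \<in> ?g e' ` set (cols n)" using col by (rule image_eqI)
      ultimately show "e \<in> set (words n (Suc j))" unfolding eq by (rule UN_I[of e'])
    qed
  qed
  ultimately show ?case by blast
qed

definition states :: "nat \<Rightarrow> fm \<Rightarrow> nat \<Rightarrow> tree multiset" where
  "states n \<psi> j = mset (map (\<lambda>e. run \<psi> e j) (words n j))"

text \<open>The recurrence of the dynamic program. The successor depends on the state and the new
  column only, so words in the same state can be merged, provided that multiplicities are kept;
  hence multisets.\<close>

lemma states_Suc:
  "states n \<psi> (Suc j) =
    (\<Sum>q\<in>#states n \<psi> j. mset (map (\<lambda>f. delta \<psi> q (\<lambda>x. code_symbol (f x)) (ctx j)) (cols n)))"
proof -
  have "run \<psi> (\<lambda>x i. if i = j then f x else e x i) (Suc j) = delta \<psi> (run \<psi> e j) (\<lambda>x. code_symbol (f x)) (ctx j)"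
    for e f
    using run_cong[of j "\<lambda>x i. if i = j then f x else e x i" e \<psi>] by simp
  then have "map (\<lambda>e. run \<psi> e (Suc j)) (words n (Suc j)) =
      concat (map (\<lambda>e. map (\<lambda>f. delta \<psi> (run \<psi> e j) (\<lambda>x. code_symbol (f x)) (ctx j)) (cols n)) (words n j))"
    by (simp add: map_concat comp_def del: run.simps)
  then show ?thesis
    unfolding states_def mset_concat sum_mset_sum_list[symmetric]
    by (simp add: mset_concat sum_mset_sum_list[symmetric] image_mset.compositionality comp_def del: mset_map flip: mset_map)
qed

definition prepared :: "nat \<Rightarrow> fm \<Rightarrow> tree" where
  "prepared n \<psi> = Node sym_tree (Node (code_fm \<psi>) (enc (map assignment_tree (assignments symbols (rev [0..<n])))))"

lemma symbol_list_code: "symbol_list (code_set code_nat \<Sigma>) = map code_symbol symbols"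
  by (simp add: symbol_list_def symbols_def code_set_def code_list_enc[of code_nat] code_symbol_def)

lemma prepare_params:
  "prepare (code_params (\<Sigma>, w', \<tau>', \<phi>, n)) = prepared n (guarded n (rev [0..<n]) \<phi>)"
  by (simp add: prepare_def code_params_def prepared_def symbol_list_code sym_tree_def code_guarded
      columns_assignments[OF symbol_list_code])

definition coded_dom :: "nat \<Rightarrow> tree" where
  "coded_dom j = code_list (code_layer code_nat) (drop j D0)"

definition coded_rels :: "nat \<Rightarrow> tree" where
  "coded_rels j = enc (map (\<lambda>D. code_list code_tuple_layer (drop j D)) Ds)"

lemma coded_Suc:
  assumes "j < k"
  shows "coded_dom j = Node (code_layer code_nat (D0 ! j)) (coded_dom (Suc j))"
    "map_tree left (coded_rels j) = enc (map (\<lambda>D. code_tuple_layer (D ! j)) Ds)"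
    "map_tree right (coded_rels j) = coded_rels (Suc j)"
proof -
  show "coded_dom j = Node (code_layer code_nat (D0 ! j)) (coded_dom (Suc j))"
    using assms length_D0 by (simp add: coded_dom_def Cons_nth_drop_Suc[symmetric])
  have "drop j D = D ! j # drop (Suc j) D" if "D \<in> set Ds" for D
    using assms length_Ds_nth length_Ds that by (metis Cons_nth_drop_Suc in_set_conv_nth)
  then show "map_tree left (coded_rels j) = enc (map (\<lambda>D. code_tuple_layer (D ! j)) Ds)"
    "map_tree right (coded_rels j) = coded_rels (Suc j)"
    by (simp_all add: map_tree_def coded_rels_def)
qed

lemma layer_ctx_coded:
  "j < k \<Longrightarrow> layer_ctx (prepared n \<psi>) (coded_dom j) (coded_rels j) = Node (prepared n \<psi>) (right (ctx j))"
  by (simp add: layer_ctx_def coded_Suc ctx_def)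

lemma steps_coded:
  "lst (steps (Node q (Node (prepared n \<psi>) (right (ctx j))))) =
    map (\<lambda>f. delta \<psi> q (\<lambda>x. code_symbol (f x)) (ctx j)) (cols n)"
proof -
  have "ctx j = Node sym_tree (right (ctx j))" by (simp add: ctx_def)
  then have "delta_tree (delta_arg (code_fm \<psi>) q (assignment_tree l) (Node sym_tree (right (ctx j))) Leaf)
      = delta \<psi> q (\<lambda>x. code_symbol (assignment_fun l x)) (ctx j)" for l
    by (simp add: delta_tree)
  then show ?thesis by (simp add: steps_def prepared_def cols_def comp_def)
qed

lemma new_table_states:
  assumes "represents t (states n \<psi> j)" "j < k"
  shows "represents (new_table t (layer_ctx (prepared n \<psi>) (coded_dom j) (coded_rels j))) (states n \<psi> (Suc j))"
  using new_table_represents[OF assms(1), of "layer_ctx (prepared n \<psi>) (coded_dom j) (coded_rels j)"]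
  unfolding layer_ctx_coded[OF assms(2)] steps_coded states_Suc .

lemma init_table_states: "represents init_table (states n \<psi> 0)"
  using init_table_represents by (simp add: states_def)

lemma coded_k: "coded_dom k = Leaf"
  using length_D0 by (simp add: coded_dom_def)

lemma loop_states:
  assumes "j \<le> k" "represents t (states n \<psi> j)"
  shows "loop (prepared n \<psi>) (coded_dom j) (coded_rels j) t =
    code_nat (size (filter_mset (\<lambda>q. left q \<noteq> Leaf) (states n \<psi> k)))"
  using assms
proof (induction "k - j" arbitrary: j t)
  case 0
  then have j: "j = k" by simp
  show ?case using accepted_count_represents 0 unfolding j by (simp add: coded_k)
next
  case (Suc d)
  then have j: "j < k" by simp
  have "loop (prepared n \<psi>) (coded_dom j) (coded_rels j) t = loop (prepared n \<psi>) (coded_dom (Suc j)) (coded_rels (Suc j))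
      (new_table t (layer_ctx (prepared n \<psi>) (coded_dom j) (coded_rels j)))"
    using coded_Suc[OF j] by simp
  then show ?case using Suc.hyps(1)[of "Suc j", OF _ _ new_table_states[OF Suc.prems(2) j]] Suc.hyps(2) j by simp
qed

text \<open>Delivers the hypothesis of the cost analysis. Every table met by the loop represents
  some \<open>states n \<psi> j\<close>, so a bound for such tables is enough.\<close>

lemma safe_states:
  assumes "j \<le> k" "represents t (states n \<psi> j)"
    and keys: "\<And>j t. j \<le> k \<Longrightarrow> represents t (states n \<psi> j) \<Longrightarrow> bounded_keys N t"
    and ctx: "\<And>j. j < k \<Longrightarrow> size (Node (prepared n \<psi>) (right (ctx j))) \<le> N"
  shows "safe N (prepared n \<psi>) (coded_dom j) (coded_rels j) t"
  using assms(1,2)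
proof (induction "k - j" arbitrary: j t)
  case 0
  then have j: "j = k" by simp
  show ?case using keys[of j t] 0 unfolding j by (simp add: coded_k)
next
  case (Suc d)
  then have j: "j < k" by simp
  have "safe N (prepared n \<psi>) (coded_dom (Suc j)) (coded_rels (Suc j))
      (new_table t (layer_ctx (prepared n \<psi>) (coded_dom j) (coded_rels j)))"
    using Suc.hyps(1)[of "Suc j", OF _ _ new_table_states[OF Suc.prems(2) j]] Suc.hyps(2) j by simp
  then show ?case
    using keys[OF Suc.prems] ctx[OF j] coded_Suc[OF j] layer_ctx_coded[OF j, of n \<psi>] by simp
qed

text \<open>Nothing is assumed on the tracks of \<open>e\<close>; the guards have to detect those
  outside the domain. Because of \<open>i < n\<close>, the bound variable \<open>n\<close> does not
  capture \<open>i\<close>.\<close>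

lemma run_guarded:
  assumes "\<forall>i\<in>set is. i < n"
  shows "left (run (guarded n is \<phi>) e k) \<noteq> Leaf \<longleftrightarrow>
    left (run \<phi> e k) \<noteq> Leaf \<and> (\<forall>i\<in>set is. \<exists>v\<in>odd_lang \<Sigma> D0. \<forall>j<k. e i j = padded_nth v j)"
  using assms
proof (induction "is")
  case Nil
  show ?case by (simp add: guarded_def)
next
  case (Cons i "is")
  obtain k' where k': "k = Suc k'" using k_pos by (cases k) auto
  have "left (run (Exists n (Eq n i)) e k) \<noteq> Leaf \<longleftrightarrow> (\<exists>v\<in>odd_lang \<Sigma> D0. \<forall>j<k. e i j = padded_nth v j)"
  proof -
    have "left (run (Eq n i) (e(n := padded_nth v)) k) \<noteq> Leaf \<longleftrightarrow> (\<forall>j<k. e i j = padded_nth v j)" for v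
      using run_Eq[of k' n i "e(n := padded_nth v)"] Cons.prems by (auto simp: k' simp del: run.simps)
    then show ?thesis unfolding run_quant(1) by simp
  qed
  then show ?case
    using Cons run_bits(2)[of k "Exists n (Eq n i)" "guarded n is \<phi>" e] k_pos by (auto simp: guarded_def)
qed

text \<open>\<open>word\<close> is a bijection between solutions and accepted words: the guards make
  every track the padding of a domain element, and padding to \<open>k\<close> columns is injective
  on strings of length at most \<open>k\<close>.\<close>

lemma count_states:
  assumes \<phi>: "wf_fm \<tau> \<phi>" "free_vars \<phi> \<subseteq> {..<n}"
  shows "size (filter_mset (\<lambda>q. left q \<noteq> Leaf) (states n (guarded n (rev [0..<n]) \<phi>) k)) =
    card (solutions (derived_structure \<Sigma> \<tau> D0 Ds) \<phi> n)"
proof -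
  let ?\<psi> = "guarded n (rev [0..<n]) \<phi>" and ?S = "derived_structure \<Sigma> \<tau> D0 Ds"
  define word where "word vs x i = (if x < n \<and> i < k then padded_nth (vs ! x) i else None)" for vs :: "nat list list" and x i
  define A where "A = {e \<in> set (words n k). left (run ?\<psi> e k) \<noteq> Leaf}"
  have guard: "left (run ?\<psi> e k) \<noteq> Leaf \<longleftrightarrow> left (run \<phi> e k) \<noteq> Leaf \<and>
      (\<forall>x<n. \<exists>v\<in>odd_lang \<Sigma> D0. \<forall>i<k. e x i = padded_nth v i)" for e
    using run_guarded[of "rev [0..<n]" n \<phi> e] by auto
  have L: "v \<in> lists \<Sigma> \<and> length v \<le> k" if "v \<in> odd_lang \<Sigma> D0" for v
    using that by (auto simp: odd_lang_iff[OF D0])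
  have dom: "domain ?S = odd_lang \<Sigma> D0" by (simp add: derived_structure_def)
  have sat: "left (run \<phi> (word vs) k) \<noteq> Leaf \<longleftrightarrow> sat ?S (\<lambda>i. vs ! i) \<phi>"
    if "length vs = n" "set vs \<subseteq> odd_lang \<Sigma> D0" for vs
  proof (rule run_sat[OF \<phi>(1)])
    fix x assume "x \<in> free_vars \<phi>"
    then have "x < n" using \<phi>(2) by auto
    then show "vs ! x \<in> odd_lang \<Sigma> D0 \<and> (\<forall>i<k. word vs x i = padded_nth (vs ! x) i)"
      using that by (auto simp: word_def)
  qed
  have "word ` solutions ?S \<phi> n = A"
  proof
    show "word ` solutions ?S \<phi> n \<subseteq> A"
    proof
      fix e assume "e \<in> word ` solutions ?S \<phi> n"
      then obtain vs where vs: "length vs = n" "set vs \<subseteq> odd_lang \<Sigma> D0" "sat ?S (\<lambda>i. vs ! i) \<phi>" and e: "e = word vs"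
        unfolding solutions_def dom by blast
      have mem: "vs ! x \<in> odd_lang \<Sigma> D0" if "x < n" for x using vs that by auto
      have "word vs x i \<in> set symbols" if "x < n" "i < k" for x i
        using L[OF mem[OF that(1)]] that by (auto simp: word_def padded_nth_def set_symbols)
      then have "e \<in> set (words n k)" unfolding e using words by (auto simp: word_def)
      moreover have "\<forall>x<n. \<exists>v\<in>odd_lang \<Sigma> D0. \<forall>i<k. e x i = padded_nth v i"
        unfolding e using mem by (auto simp: word_def)
      ultimately show "e \<in> A" unfolding A_def using guard[of e] sat[OF vs(1,2)] vs(3) e by blast
    qed
    show "A \<subseteq> word ` solutions ?S \<phi> n"
    proof
      fix e assume "e \<in> A"
      then have e: "e \<in> set (words n k)" "left (run \<phi> e k) \<noteq> Leaf"
        "\<forall>x<n. \<exists>v\<in>odd_lang \<Sigma> D0. \<forall>i<k. e x i = padded_nth v i"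
        unfolding A_def using guard[of e] by auto
      from e(3) obtain v where v: "\<forall>x<n. v x \<in> odd_lang \<Sigma> D0 \<and> (\<forall>i<k. e x i = padded_nth (v x) i)" by metis
      define vs where "vs = map v [0..<n]"
      have vs: "length vs = n" "set vs \<subseteq> odd_lang \<Sigma> D0" using v by (auto simp: vs_def)
      have "e x i = word vs x i" for x i
        using e(1) v words[of n k] by (auto simp: word_def vs_def)
      then have "e = word vs" by blast
      moreover from this have "vs \<in> solutions ?S \<phi> n"
        using sat[OF vs] e(2) vs unfolding solutions_def dom by blast
      ultimately show "e \<in> word ` solutions ?S \<phi> n" by blast
    qed
  qed
  moreover have "inj_on word (solutions ?S \<phi> n)"
  proof (rule inj_onI)
    fix us vs assume "us \<in> solutions ?S \<phi> n" "vs \<in> solutions ?S \<phi> n" and eq: "word us = word vs"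
    then have us: "length us = n" "set us \<subseteq> odd_lang \<Sigma> D0" and vs: "length vs = n" "set vs \<subseteq> odd_lang \<Sigma> D0"
      unfolding solutions_def dom by auto
    show "us = vs"
    proof (rule nth_equalityI)
      fix x assume x: "x < length us"
      have "\<forall>i<k. padded_nth (us ! x) i = padded_nth (vs ! x) i"
        using x us(1) fun_cong[OF fun_cong[OF eq], of x] unfolding word_def by metis
      moreover have "us ! x \<in> odd_lang \<Sigma> D0" "vs ! x \<in> odd_lang \<Sigma> D0" using us vs x by auto
      ultimately show "us ! x = vs ! x" using L by (intro padded_nth_inject) auto
    qed (use us vs in simp)
  qed
  ultimately have "card (solutions ?S \<phi> n) = card A" using card_image by metis
  also have "A = set (filter (\<lambda>e. left (run ?\<psi> e k) \<noteq> Leaf) (words n k))" by (auto simp: A_def)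
  also have "card \<dots> = length (filter (\<lambda>e. left (run ?\<psi> e k) \<noteq> Leaf) (words n k))"
    using words by (intro distinct_card) simp
  also have "\<dots> = size (filter_mset (\<lambda>q. left q \<noteq> Leaf) (states n ?\<psi> k))"
    unfolding states_def mset_filter[symmetric] size_mset by (simp add: filter_map comp_def)
  finally show ?thesis ..
qed

end

section \<open>Size bounds\<close>

text \<open>Bounds the number of trees of size at most \<open>z\<close>: a tree other than
  \<open>Leaf\<close> is a pair of smaller trees, so the count for \<open>z + 1\<close> is at most
  one plus the square of the count for \<open>z\<close>.\<close>

definition tree_bound :: "nat \<Rightarrow> nat" where
  "tree_bound z = ((\<lambda>n. 1 + n * n) ^^ z) 1"

definition list_bound :: "nat \<Rightarrow> nat" where
  "list_bound z = tree_bound z * (z + 1)"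

lemma ub_tree_bound: "ub tree_bound"
proof -
  have "n \<le> 1 + n * n" for n :: nat by (cases n) auto
  then show ?thesis
    unfolding tree_bound_def by (intro ub_funpow ub_intros)
qed

lemma ub_list_bound: "ub list_bound"
  unfolding list_bound_def by (intro ub_intros ub_tree_bound)

lemma card_trees: "finite {t :: tree. size t \<le> z} \<and> card {t :: tree. size t \<le> z} \<le> tree_bound z"
proof (induction z)
  case 0
  have "{t :: tree. size t \<le> 0} = {Leaf}" by (auto elim: tree.exhaust)
      (metis add_is_0 nat.distinct(1) tree.exhaust tree.size(4) plus_1_eq_Suc)
  then show ?case by (simp add: tree_bound_def)
next
  case (Suc z)
  let ?A = "{t :: tree. size t \<le> z}"
  have sub: "{t :: tree. size t \<le> Suc z} \<subseteq> insert Leaf ((\<lambda>(a, b). Node a b) ` (?A \<times> ?A))"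
  proof
    fix t :: tree assume "t \<in> {t. size t \<le> Suc z}"
    then show "t \<in> insert Leaf ((\<lambda>(a, b). Node a b) ` (?A \<times> ?A))" by (cases t) auto
  qed
  have fin: "finite (insert Leaf ((\<lambda>(a, b). Node a b) ` (?A \<times> ?A)))" using Suc by auto
  have "card {t :: tree. size t \<le> Suc z} \<le> card (insert Leaf ((\<lambda>(a, b). Node a b) ` (?A \<times> ?A)))"
    using fin sub by (rule card_mono)
  also have "\<dots> \<le> Suc (card ((\<lambda>(a, b). Node a b) ` (?A \<times> ?A)))" using Suc by (intro card_insert_le_m1) auto
  also have "\<dots> \<le> Suc (card (?A \<times> ?A))" using Suc by (intro Suc_le_mono[THEN iffD2] card_image_le) auto
  also have "\<dots> \<le> 1 + tree_bound z * tree_bound z"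
    using Suc by (simp add: card_cartesian_product mult_le_mono)
  finally show ?case using finite_subset[OF sub fin] by (simp add: tree_bound_def)
qed

lemma sum_list_le: "(\<And>x. x \<in> set xs \<Longrightarrow> f x \<le> c) \<Longrightarrow> sum_list (map f xs) \<le> length xs * (c :: nat)"
  using sum_list_mono[of xs f "\<lambda>_. c"] by (simp add: sum_list_triv)

lemma distinct_trees:
  assumes "distinct xs" "\<And>x. x \<in> set xs \<Longrightarrow> size (x :: tree) \<le> z"
  shows "length xs \<le> tree_bound z" "size (enc xs) \<le> list_bound z"
proof -
  have "card (set xs) \<le> card {t :: tree. size t \<le> z}"
    using assms(2) card_trees by (intro card_mono) auto
  then show len: "length xs \<le> tree_bound z"
    using card_trees[of z] distinct_card[OF assms(1)] by linarith
  have "sum_list (map size xs) \<le> length xs * z"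
    using assms(2) by (rule sum_list_le)
  then have "size (enc xs) \<le> length xs * (z + 1)" by (simp add: size_enc)
  also have "\<dots> \<le> tree_bound z * (z + 1)" using len by (rule mult_le_mono1)
  finally show "size (enc xs) \<le> list_bound z" by (simp add: list_bound_def)
qed

lemma size_code_bool: "size (code_bool b) \<le> 1"
  by (simp add: code_bool_def)

lemma size_code_nat: "size (code_nat n) \<le> 2 * n"
proof (induction n rule: less_induct)
  case (less n)
  show ?case
  proof (cases "n = 0")
    case False
    then have "size (code_nat (n div 2)) \<le> 2 * (n div 2)" using less[of "n div 2"] by simp
    moreover have "2 * (2 * (n div 2)) + 2 * (n mod 2) = 2 * n" by presburger
    ultimately show ?thesis using False size_code_bool[of "odd n"]
      by (cases "odd n") (auto simp: code_nat_pos odd_iff_mod_2_eq_one even_iff_mod_2_eq_zero code_bool_def)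
  qed simp
qed

text \<open>The width and the arities are coded in binary and can be exponential in the size of the
  parameters. This is the origin of the powers of two in \<open>layer_bound\<close>.\<close>

lemma less_power_size_code_nat: "n < 2 ^ size (code_nat n)"
proof (induction n rule: less_induct)
  case (less n)
  show ?case
  proof (cases "n = 0")
    case False
    then have "n div 2 < 2 ^ size (code_nat (n div 2))" using less[of "n div 2"] by simp
    then have "n < 2 ^ Suc (size (code_nat (n div 2)))" by simp
    also have "\<dots> \<le> 2 ^ size (code_nat n)" using False by (intro power_increasing) (simp_all add: code_nat_pos)
    finally show ?thesis .
  qed simp
qed

lemma size_code_set:
  assumes "finite A" "inj c" "\<And>x. x \<in> A \<Longrightarrow> size (c x) \<le> z"
  shows "size (code_set c A) \<le> list_bound z"
  unfolding code_set_def code_list_enc[of c] using assms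
  by (intro distinct_trees) (auto simp: distinct_map dest: inj_on_subset)

lemma inj_code_prod: "inj c \<Longrightarrow> inj d \<Longrightarrow> inj (code_prod c d)"
  by (auto simp: inj_def)

text \<open>\<open>4 * w + z + 3\<close> bounds a transition: two states of size
  \<open>2 * w\<close>, an optional symbol of size \<open>z + 1\<close>, two pairing nodes. A layer
  consists of five sets, seven list cells and two flags.\<close>

lemma size_code_layer:
  assumes B: "B \<in> layers \<Gamma> w" "finite \<Gamma>" and c: "inj c" and z: "\<And>s. s \<in> \<Gamma> \<Longrightarrow> size (c s) \<le> z"
  shows "size (code_layer c B) \<le> 5 * list_bound (4 * w + z + 3) + 9"
proof -
  note fin = finite_layer[OF B]
  let ?z = "4 * w + z + 3"
  have st: "size (code_nat q) \<le> 2 * w" if "q < w" for q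
    using size_code_nat[of q] that by linarith
  have nat: "size (code_set code_nat A) \<le> list_bound ?z" if "finite A" "A \<subseteq> {..<w}" for A
  proof (intro size_code_set inj_code_nat that(1))
    fix x assume "x \<in> A"
    then have "size (code_nat x) \<le> 2 * w" using that(2) by (intro st) auto
    then show "size (code_nat x) \<le> ?z" by simp
  qed
  have sub: "lstates B \<subseteq> {..<w}" "rstates B \<subseteq> {..<w}" "istates B \<subseteq> {..<w}" "fstates B \<subseteq> {..<w}"
    "transitions B \<subseteq> lstates B \<times> insert None (Some ` \<Gamma>) \<times> rstates B"
    using B(1) by (auto simp: layers_def)
  have "size (code_set (code_prod code_nat (code_prod (code_option c) code_nat)) (transitions B)) \<le> list_bound ?z"
  proof (intro size_code_set fin inj_code_prod inj_code_nat inj_code_option c)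
    fix x assume "x \<in> transitions B"
    then obtain p s q where x: "x = (p, s, q)" and "p < w" "q < w" "s \<in> insert None (Some ` \<Gamma>)"
      using sub by blast
    then have "size (code_nat p) \<le> 2 * w" "size (code_nat q) \<le> 2 * w" "size (code_option c s) \<le> z + 1"
      using st z by auto
    then show "size (code_prod code_nat (code_prod (code_option c) code_nat) x) \<le> ?z" by (simp add: x)
  qed
  with nat[OF fin(1) sub(1)] nat[OF fin(2) sub(2)] nat[OF fin(4) sub(3)] nat[OF fin(5) sub(4)]
    size_code_bool[of "iflag B"] size_code_bool[of "fflag B"]
  show ?thesis by (simp add: code_layer_def size_enc)
qed

lemma size_code_tuple:
  assumes "xs \<in> tensor_alphabet \<Sigma> a" "\<And>s. s \<in> \<Sigma> \<Longrightarrow> size (code_nat s) \<le> z"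
  shows "size (code_list (code_option code_nat) xs) \<le> a * (z + 2)"
proof -
  have "size (code_option code_nat s) \<le> z + 1" if "s \<in> set xs" for s
    using assms that by (auto simp: tensor_alphabet_def)
  then have "size (code_list (code_option code_nat) xs) \<le> length xs * (z + 2)"
    by (induction xs) fastforce+
  then show ?thesis using assms(1) by (simp add: tensor_alphabet_def)
qed

text \<open>The growth of a state by one connective or quantifier: \<open>3 + 2 * z\<close> for a
  pair of states with its bit, and \<open>list_bound (2 * z + 1)\<close> for a duplicate-free list
  of pairs.\<close>

definition state_bound :: "nat \<Rightarrow> nat" where
  "state_bound z = 2 * z + 4 + list_bound (2 * z + 1)"

lemma ub_state_bound: "ub state_bound"
  unfolding state_bound_def using ub_comp[OF ub_list_bound, of "\<lambda>n. 2 * n + 1"]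
  by (intro ub_intros) (simp add: ub_intros)

lemma state_bound_ge: "z \<le> state_bound z"
  by (simp add: state_bound_def)

lemma state_bound_iter_mono: "i \<le> j \<Longrightarrow> (state_bound ^^ i) z \<le> (state_bound ^^ j) z"
  using ub_state_bound state_bound_ge by (intro funpow_mono_bound) (auto simp: ub_def)

lemma sum_list_filter_le: "sum_list (map f (filter P xs)) \<le> (sum_list (map f xs) :: nat)"
  by (induction xs) auto

text \<open>The result is a sublist of the right states of the layer, so it cannot grow with
  \<open>R\<close> and hence not with the number of layers.\<close>

lemma size_post: "size (post B R a) \<le> size B"
proof -
  have "size (post B R a) \<le> size (enc (lst (layer_right B)))"
    unfolding post_def size_enc by (intro add_mono sum_list_filter_le) simp
  also have "\<dots> = size (left (right B))" by (simp add: layer_right_def)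
  also have "\<dots> \<le> size B" using size_left_le[of "right B"] size_right_le[of B] by linarith
  finally show ?thesis .
qed

lemma size_dom_step: "size (dom_step B s a) \<le> size B + size a + 1"
  using size_post[of B "right s" a] by (auto simp: dom_step_def)

context structural_tuple
begin

lemma size_run_pair:
  assumes "t \<le> 3 + r + s" "r \<le> (state_bound ^^ i) z" "s \<le> (state_bound ^^ j) z" "i < l" "j < l"
  shows "t \<le> (state_bound ^^ l) z"
proof -
  let ?b = "(state_bound ^^ max i j) z"
  have "r \<le> ?b" "s \<le> ?b"
    using assms(2,3) state_bound_iter_mono[of _ "max i j" z] by (meson le_trans max.cobounded1 max.cobounded2)+
  then have "t \<le> (state_bound ^^ Suc (max i j)) z" using assms(1) by (simp add: state_bound_def)
  also have "\<dots> \<le> (state_bound ^^ l) z" using assms(4,5) by (intro state_bound_iter_mono) simp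
  finally show ?thesis .
qed

text \<open>Owing to \<open>remdups\<close>, the number of entries is at most the number of possible
  pairs, however many tracks there are. The bound \<open>b\<close> for the body holds for all
  \<open>e\<close>, so it covers every track put in place of \<open>x\<close>.\<close>

lemma size_run_quant:
  assumes \<psi>: "\<psi> = Exists x \<phi> \<or> \<psi> = Forall x \<phi>" and "j \<le> k"
    and b: "\<And>e. size (run \<phi> e j) \<le> b" "2 * L + 2 \<le> b"
    and L: "\<And>j. j < k \<Longrightarrow> size (code_layer code_nat (D0 ! j)) \<le> L"
      "\<And>a. a \<in> set symbols \<Longrightarrow> size (code_symbol a) \<le> L"
  shows "size (run \<psi> e j) \<le> state_bound b"
proof (cases j)
  case (Suc i)
  then have i: "i < k" using assms(2) by simp
  have "\<exists>c S. delta \<psi> q f ctx = Node (code_bool c) (enc S) \<and> distinct S" for q f ctx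
    using \<psi> by (elim disjE) (auto simp: Let_def ex_bit_def all_bit_def)
  then obtain c S where S: "run \<psi> e (Suc i) = Node (code_bool c) (enc S)" "distinct S"
    unfolding run.simps by blast
  have "set S = quant_set x \<phi> e (Suc i)"
    using quant_states_run[OF \<psi> i, of e] unfolding S(1) by simp
  moreover have "size t \<le> 2 * b + 1" if t: "t \<in> quant_set x \<phi> e (Suc i)" for t
  proof -
    obtain u where u: "\<forall>i. u i \<in> set symbols" "t = Node (run \<phi> (e(x := u)) (Suc i)) (dom_run u (Suc i))"
      using t by (auto simp: quant_set_def)
    have "size (dom_run u (Suc i)) \<le> size (code_layer code_nat (D0 ! i)) + size (code_symbol (u i)) + 1"
      unfolding dom_run.simps by (rule size_dom_step)
    then have "size (dom_run u (Suc i)) \<le> 2 * L + 1"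
      using L(1)[OF i] L(2)[of "u i"] u(1) by fastforce
    then show ?thesis using b(1)[of "e(x := u)"] b(2) unfolding u(2) Suc by (simp del: run.simps dom_run.simps)
  qed
  ultimately have "size (enc S) \<le> list_bound (2 * b + 1)" using S(2) by (intro distinct_trees) auto
  then show ?thesis unfolding Suc S(1) using size_code_bool[of c] by (simp add: state_bound_def)
qed simp

text \<open>The bound is the same for all \<open>e\<close> and \<open>j\<close>, which is what the
  loop needs. The size of the coded formula serves as a generous bound on its nesting depth.\<close>

lemma size_run:
  assumes "wf_fm \<tau> \<phi>" "j \<le> k"
    and L: "\<And>j. j < k \<Longrightarrow> size (code_layer code_nat (D0 ! j)) \<le> L"
      "\<And>i j. i < length \<tau> \<Longrightarrow> j < k \<Longrightarrow> size (code_tuple_layer (Ds ! i ! j)) \<le> L"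
      "\<And>a. a \<in> set symbols \<Longrightarrow> size (code_symbol a) \<le> L"
  shows "size (run \<phi> e j) \<le> (state_bound ^^ size (code_fm \<phi>)) (2 * L + 2)"
  using assms(1,2)
proof (induction \<phi> arbitrary: e j)
  case (Eq x y)
  have "size (run (Eq x y) e j) \<le> 2 * L + 2" by (cases j) (simp_all add: code_bool_def)
  also have "\<dots> \<le> (state_bound ^^ size (code_fm (Eq x y))) (2 * L + 2)"
    using state_bound_ge by (rule funpow_ge)
  finally show ?case .
next
  case (Rel i xs)
  have "size (run (Rel i xs) e j) \<le> 2 * L + 2"
  proof (cases j)
    case (Suc j')
    then have "size (code_tuple_layer (Ds ! i ! j')) \<le> L" using L(2)[of i j'] Rel by simp
    then have "size (post (code_tuple_layer (Ds ! i ! j')) R a) \<le> L" for R a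
      using size_post le_trans by blast
    note this[of "right (run (Rel i xs) e j')" "tuple_symbol (map (\<lambda>x. code_symbol (e x j')) xs)"]
    then show ?thesis using Suc Rel by (simp add: Let_def ctx_rel_nth)
  qed simp
  also have "\<dots> \<le> (state_bound ^^ size (code_fm (Rel i xs))) (2 * L + 2)"
    using state_bound_ge by (rule funpow_ge)
  finally show ?case .
next
  case (Neg \<phi>)
  let ?b = "(state_bound ^^ size (code_fm \<phi>)) (2 * L + 2)"
  have "size (run (Neg \<phi>) e j) \<le> 2 + size (right (run (Neg \<phi>) e j))"
    by (cases j) (simp_all add: Let_def code_bool_def)
  also have "\<dots> \<le> 2 + ?b" unfolding run_Neg using Neg by simp
  also have "\<dots> \<le> state_bound ?b" by (simp add: state_bound_def)
  also have "\<dots> = (state_bound ^^ Suc (size (code_fm \<phi>))) (2 * L + 2)" by simp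
  also have "\<dots> \<le> (state_bound ^^ size (code_fm (Neg \<phi>))) (2 * L + 2)"
    by (rule state_bound_iter_mono) simp
  finally show ?case .
next
  case (And \<phi> \<psi>)
  show ?case
  proof (rule size_run_pair)
    show "size (run (And \<phi> \<psi>) e j) \<le> 3 + size (run \<phi> e j) + size (run \<psi> e j)"
      unfolding run_And[of \<phi> \<psi> e j, THEN conjunct1, symmetric] run_And[of \<phi> \<psi> e j, THEN conjunct2, symmetric]
      by (cases j) (simp_all add: Let_def code_bool_def)
  qed (use And in auto)
next
  case (Or \<phi> \<psi>)
  show ?case
  proof (rule size_run_pair)
    show "size (run (Or \<phi> \<psi>) e j) \<le> 3 + size (run \<phi> e j) + size (run \<psi> e j)"
      unfolding run_Or[of \<phi> \<psi> e j, THEN conjunct1, symmetric] run_Or[of \<phi> \<psi> e j, THEN conjunct2, symmetric]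
      by (cases j) (simp_all add: Let_def code_bool_def)
  qed (use Or in auto)
next
  case (Exists x \<phi>)
  let ?b = "(state_bound ^^ size (code_fm \<phi>)) (2 * L + 2)"
  have "size (run (Exists x \<phi>) e j) \<le> state_bound ?b"
    using Exists L by (intro size_run_quant[where x = x and \<phi> = \<phi> and L = L] funpow_ge state_bound_ge) auto
  also have "\<dots> = (state_bound ^^ Suc (size (code_fm \<phi>))) (2 * L + 2)" by simp
  also have "\<dots> \<le> (state_bound ^^ size (code_fm (Exists x \<phi>))) (2 * L + 2)"
    by (rule state_bound_iter_mono) simp
  finally show ?case .
next
  case (Forall x \<phi>)
  let ?b = "(state_bound ^^ size (code_fm \<phi>)) (2 * L + 2)"
  have "size (run (Forall x \<phi>) e j) \<le> state_bound ?b"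
    using Forall L by (intro size_run_quant[where x = x and \<phi> = \<phi> and L = L] funpow_ge state_bound_ge) auto
  also have "\<dots> = (state_bound ^^ Suc (size (code_fm \<phi>))) (2 * L + 2)" by simp
  also have "\<dots> \<le> (state_bound ^^ size (code_fm (Forall x \<phi>))) (2 * L + 2)"
    by (rule state_bound_iter_mono) simp
  finally show ?case .
qed

lemma wf_guarded: "wf_fm \<tau>' \<phi> \<Longrightarrow> wf_fm \<tau>' (guarded n is \<phi>)"
  by (induction "is") (simp_all add: guarded_def)

text \<open>Keys are distinct states of runs, so there are at most as many rows as trees of size
  \<open>S\<close>.\<close>

lemma bounded_keys_states:
  assumes "represents t (states n \<psi> j)" "\<And>e. size (run \<psi> e j) \<le> S" "S + tree_bound S \<le> N"
  shows "bounded_keys N t"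
proof -
  have "left ` set (lst t) \<subseteq> {q. size q \<le> S}"
    unfolding represents_keys(2)[OF assms(1)] using assms(2) by (auto simp: states_def)
  then have S: "size (left x) \<le> S" if "x \<in> set (lst t)" for x using that by blast
  moreover have "length (map left (lst t)) \<le> tree_bound S"
    using represents_keys(1)[OF assms(1)] S by (intro distinct_trees) auto
  ultimately show ?thesis using assms(3) unfolding bounded_keys_def by fastforce
qed

end

section \<open>Bounds in terms of the size of the coded parameters\<close>

lemma size_code_list_mem: "x \<in> set xs \<Longrightarrow> size (c x) \<le> size (code_list c xs)"
  by (induction xs) auto

lemma length_le_size_code_list: "length xs \<le> size (code_list c xs)"
  by (induction xs) auto

text \<open>\<open>2 ^ s\<close> stands for the width and the arities,
  \<open>2 ^ s * (s + 2)\<close> for a tuple symbol and \<open>s\<close> for a letter, so that both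
  alphabets are covered at once. The last \<open>s + 1\<close> is for a single symbol that may be
  \<open>#\<close>.\<close>

definition layer_bound :: "nat \<Rightarrow> nat" where
  "layer_bound s = 5 * list_bound (4 * 2 ^ s + (2 ^ s * (s + 2) + s) + 3) + 9 + (s + 1)"

lemma ub_layer_bound: "ub layer_bound"
proof -
  have "ub (\<lambda>s. 4 * 2 ^ s + (2 ^ s * (s + 2) + s) + 3)" by (intro ub_intros ub_power2)
  from ub_comp[OF ub_list_bound this] show ?thesis
    unfolding layer_bound_def by (intro ub_intros)
qed

context structural_tuple
begin

lemma param_sizes:
  fixes \<phi> :: fm and n :: nat
  defines "s \<equiv> size (code_params (\<Sigma>, w, \<tau>, \<phi>, n))"
  shows "w \<le> 2 ^ s" "i < length \<tau> \<Longrightarrow> \<tau> ! i \<le> 2 ^ s" "a \<in> \<Sigma> \<Longrightarrow> size (code_nat a) \<le> s" "length \<tau> \<le> s"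
proof -
  have s: "size (code_set code_nat \<Sigma>) \<le> s" "size (code_nat w) \<le> s" "size (code_list code_nat \<tau>) \<le> s"
    by (simp_all add: s_def code_params_def)
  have pow: "m \<le> 2 ^ s" if "size (code_nat m) \<le> s" for m
    using less_power_size_code_nat[of m] power_increasing[OF that, of "2 :: nat"] by linarith
  show "w \<le> 2 ^ s" using s(2) by (rule pow)
  show "\<tau> ! i \<le> 2 ^ s" if "i < length \<tau>"
    using size_code_list_mem[of "\<tau> ! i" \<tau> code_nat] s(3) that by (intro pow) simp
  show "size (code_nat a) \<le> s" if "a \<in> \<Sigma>"
    using size_code_list_mem[of a "sorted_list_of_set \<Sigma>" code_nat] s(1) fin that by (simp add: code_set_def)
  show "length \<tau> \<le> s" using length_le_size_code_list[of \<tau> code_nat] s(3) by linarith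
qed

lemma layer_sizes:
  fixes \<phi> :: fm and n :: nat
  defines "s \<equiv> size (code_params (\<Sigma>, w, \<tau>, \<phi>, n))"
  shows "j < k \<Longrightarrow> size (code_layer code_nat (D0 ! j)) \<le> layer_bound s"
    "i < length \<tau> \<Longrightarrow> j < k \<Longrightarrow> size (code_tuple_layer (Ds ! i ! j)) \<le> layer_bound s"
    "a \<in> set symbols \<Longrightarrow> size (code_symbol a) \<le> layer_bound s"
proof -
  note p = param_sizes[where \<phi> = \<phi> and n = n, folded s_def]
  have bound: "5 * list_bound (4 * w + z + 3) + 9 \<le> layer_bound s" if "z \<le> 2 ^ s * (s + 2) + s" for z
  proof -
    have "4 * w + z + 3 \<le> 4 * 2 ^ s + (2 ^ s * (s + 2) + s) + 3" using p(1) that by linarith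
    from ub_mono[OF ub_list_bound this] show ?thesis by (simp add: layer_bound_def)
  qed
  show "size (code_layer code_nat (D0 ! j)) \<le> layer_bound s" if "j < k"
    using size_code_layer[OF odd_layers(1)[OF D0 that] fin inj_code_nat p(3)] bound[of s] by (rule le_trans) auto
  show "size (code_tuple_layer (Ds ! i ! j)) \<le> layer_bound s" if "i < length \<tau>" "j < k"
  proof -
    have "size (code_list (code_option code_nat) xs) \<le> 2 ^ s * (s + 2)" if "xs \<in> tensor_alphabet \<Sigma> (\<tau> ! i)" for xs
      using size_code_tuple[OF that p(3)] mult_le_mono1[OF p(2)[OF \<open>i < length \<tau>\<close>], of "s + 2"] by linarith
    from size_code_layer[OF odd_layers(1)[OF Ds[OF that(1)] that(2)] finite_tensor_alphabet[OF fin]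
        inj_code_list[OF inj_code_option[OF inj_code_nat]] this]
    show ?thesis unfolding code_tuple_layer_def using bound[of "2 ^ s * (s + 2)"] by (rule le_trans) auto
  qed
  show "size (code_symbol a) \<le> layer_bound s" if "a \<in> set symbols"
  proof -
    have "size (code_symbol a) \<le> s + 1"
      using that p(3) by (auto simp: set_symbols code_symbol_def)
    then show ?thesis by (simp add: layer_bound_def)
  qed
qed

lemma size_ctx:
  assumes "j < k" "\<And>i. i < length \<tau> \<Longrightarrow> size (code_tuple_layer (Ds ! i ! j)) \<le> L"
    "size (code_layer code_nat (D0 ! j)) \<le> L"
  shows "size (Node p (right (ctx j))) \<le> size p + L + length \<tau> * (L + 1) + 2"
proof -
  have "size (code_tuple_layer (D ! j)) \<le> L" if "D \<in> set Ds" for D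
    using that assms(2) length_Ds by (metis in_set_conv_nth)
  then have "sum_list (map (\<lambda>D. size (code_tuple_layer (D ! j))) Ds) \<le> length Ds * L"
    by (rule sum_list_le)
  then show ?thesis using assms(3) length_Ds by (simp add: ctx_def size_enc comp_def)
qed

end

theorem theorem5:
  shows "\<exists>f :: params \<Rightarrow> nat. computable_on code_params valid_params f \<and>
    (\<exists>P :: program. \<forall>\<Sigma> w \<tau> \<phi> n k D0 Ds.
       (\<Sigma>, w, \<tau>, \<phi>, n) \<in> valid_params \<longrightarrow> structural \<Sigma> w \<tau> k D0 Ds \<longrightarrow>
       (\<exists>t \<le> f (\<Sigma>, w, \<tau>, \<phi>, n) * k\<^sup>2.
          runs P (Node (code_params (\<Sigma>, w, \<tau>, \<phi>, n)) (code_tuple D0 Ds))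
            (code_nat (card (solutions (derived_structure \<Sigma> \<tau> D0 Ds) \<phi> n))) t))"
proof -
  obtain P b where b: "ub b" and P: "\<And>N params D Ds. safe N (prepare params) D Ds init_table \<Longrightarrow> size params \<le> N \<Longrightarrow>
    len Ds \<le> N \<Longrightarrow> 1 \<le> N \<Longrightarrow> \<exists>t\<le>b N * (len D + 1)\<^sup>2. runs P (Node params (Node D Ds))
      (loop (prepare params) D Ds init_table) t"
    by (rule count_main_runs) blast
  obtain q where q: "ub q" "\<And>x. size (prepare x) \<le> q (size x)"
    using PR_obtain[OF PR_prepare] by metis
  define S where "S s = (state_bound ^^ q s) (2 * layer_bound s + 2)" for s
  \<comment> \<open>One number for all requirements of \<open>P\<close>: the keys and rows of the
    tables, the layer context, the size of the parameters together with the number of relation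
    diagrams, and \<open>1 \<le> N\<close>.\<close>
  define N where "N s = (S s + tree_bound (S s)) + (q s + layer_bound s + s * (layer_bound s + 1) + 2) + s + 1" for s
  have ub_S: "ub S"
    unfolding S_def using q(1) by (intro ub_funpow ub_state_bound state_bound_ge ub_intros ub_layer_bound)
  have "ub N"
    unfolding N_def using q(1) by (intro ub_intros ub_S ub_comp[OF ub_tree_bound ub_S] ub_layer_bound)
  then have "ub (\<lambda>s. 4 * b (N s))" by (intro ub_intros ub_comp[OF b])
  then have "computable_on code_params valid_params (\<lambda>p. 4 * b (N (size (code_params p))))"
    by (rule computable_ub)
  moreover have "\<exists>t\<le>4 * b (N (size (code_params (\<Sigma>, w, \<tau>, \<phi>, n)))) * k\<^sup>2.
      runs P (Node (code_params (\<Sigma>, w, \<tau>, \<phi>, n)) (code_tuple D0 Ds))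
        (code_nat (card (solutions (derived_structure \<Sigma> \<tau> D0 Ds) \<phi> n))) t"
    if valid: "(\<Sigma>, w, \<tau>, \<phi>, n) \<in> valid_params" and structural: "structural \<Sigma> w \<tau> k D0 Ds"
    for \<Sigma> w \<tau> \<phi> n k D0 Ds
  proof -
    interpret structural_tuple \<Sigma> w \<tau> k D0 Ds
      using valid structural by unfold_locales (auto simp: valid_params_def)
    let ?p = "code_params (\<Sigma>, w, \<tau>, \<phi>, n)" and ?\<psi> = "guarded n (rev [0..<n]) \<phi>"
    define s where "s = size ?p"
    note L = layer_sizes[where \<phi> = \<phi> and n = n, folded s_def]
    have \<phi>: "wf_fm \<tau> \<phi>" "free_vars \<phi> \<subseteq> {..<n}" using valid by (auto simp: valid_params_def)
    have prep: "prepare ?p = prepared n ?\<psi>" by (rule prepare_params)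
    have q_s: "size (prepared n ?\<psi>) \<le> q s" using q(2)[of ?p] by (simp add: prep s_def)
    then have "size (code_fm ?\<psi>) \<le> q s" by (simp add: prepared_def)
    then have run: "size (run ?\<psi> e j) \<le> S s" if "j \<le> k" for e j
      unfolding S_def using size_run[OF wf_guarded[OF \<phi>(1)] that L, of n "rev [0..<n]" e]
        state_bound_iter_mono le_trans by blast
    have "safe (N s) (prepared n ?\<psi>) (coded_dom 0) (coded_rels 0) init_table"
    proof (rule safe_states[OF _ init_table_states])
      show "bounded_keys (N s) t" if "j \<le> k" "represents t (states n ?\<psi> j)" for j t
        using that(2) run[OF that(1)] by (rule bounded_keys_states) (simp add: N_def)
      show "size (Node (prepared n ?\<psi>) (right (ctx j))) \<le> N s" if "j < k" for j
      proof -
        have "size (Node (prepared n ?\<psi>) (right (ctx j)))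
            \<le> size (prepared n ?\<psi>) + layer_bound s + length \<tau> * (layer_bound s + 1) + 2"
          using L that by (intro size_ctx) auto
        also have "\<dots> \<le> q s + layer_bound s + s * (layer_bound s + 1) + 2"
          using q_s param_sizes(4)[of \<phi> n, folded s_def] by (intro add_mono mult_le_mono) auto
        finally show ?thesis by (simp add: N_def)
      qed
    qed simp
    moreover have "len (coded_rels 0) \<le> N s"
      using param_sizes(4)[of \<phi> n, folded s_def] length_Ds by (simp add: coded_rels_def N_def)
    ultimately obtain t where t: "t \<le> b (N s) * (len (coded_dom 0) + 1)\<^sup>2"
      "runs P (Node ?p (Node (coded_dom 0) (coded_rels 0))) (loop (prepared n ?\<psi>) (coded_dom 0) (coded_rels 0) init_table) t"
      using P[of "N s" ?p "coded_dom 0" "coded_rels 0"] unfolding prep by (auto simp: N_def s_def)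
    have "loop (prepared n ?\<psi>) (coded_dom 0) (coded_rels 0) init_table
        = code_nat (card (solutions (derived_structure \<Sigma> \<tau> D0 Ds) \<phi> n))"
      using loop_states[OF _ init_table_states] count_states[OF \<phi>] by simp
    moreover have "code_tuple D0 Ds = Node (coded_dom 0) (coded_rels 0)"
      by (simp add: code_tuple_def coded_dom_def coded_rels_def code_tuple_layer_def
          code_list_enc[of "code_list (code_layer (code_list (code_option code_nat)))"])
    moreover have "t \<le> 4 * b (N s) * k\<^sup>2"
    proof -
      have "len (coded_dom 0) = k"
        using length_D0 by (simp add: coded_dom_def code_list_enc[of "code_layer code_nat"])
      \<comment> \<open>Here \<open>k \<ge> 1\<close> enters: it turns \<open>k + 1\<close> into
        \<open>2 * k\<close>, whose square accounts for the factor 4 in \<open>f\<close>.\<close>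
      moreover have "(k + 1)\<^sup>2 \<le> (2 * k)\<^sup>2" using k_pos by (intro power_mono) auto
      ultimately have "b (N s) * (len (coded_dom 0) + 1)\<^sup>2 \<le> b (N s) * (2 * k)\<^sup>2"
        by (intro mult_le_mono2) simp
      with t(1) have "t \<le> b (N s) * (2 * k)\<^sup>2" by (rule le_trans)
      then show ?thesis by (simp add: power_mult_distrib mult_ac)
    qed
    ultimately show ?thesis using t(2) by (auto simp: s_def)
  qed
  ultimately show ?thesis
    by (intro exI[of _ "\<lambda>p. 4 * b (N (size (code_params p)))"] conjI exI[of _ P]) blast+
qed

end
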